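(* Let $\psi\in\mathcal{E}(\mathcal{O},R)$ be an optimal embedding with $\tau_{\psi,p}\in A_0$, and let $x\in\mathcal{H}^*$ be a base point. The assignment $$\gamma\longmapsto \varphi_\psi(\gamma)=\sum_{w\in\Gamma_0\tau_{\psi,\infty}}\delta_\gamma(w)\cdot w_p$$ defines a $1$-cocycle in $Z^1(\Gamma_0,\operatorname{Div}A_0)$. Moreover, the corresponding cohomology class in $H^1(\Gamma_0,\operatorname{Div}A_0)$ is independent of the choice of the base point $x$ that was made to define it.
   Context: Setting. $F$ is a totally real number field of narrow class number $1$; $B$ is a quaternion algebra over $F$ that is split at exactly one archimedean place $v_\infty$ of $F$; $\mathfrak p$ is a finite prime of $F$, above the rational prime $p$, at which $B$ is split. $\mathbb{Q}_{\mathfrak p}$ is the completion of $F$ at $\mathfrak p$, $\mathbb{Z}_{\mathfrak p}$ its ring of integers, $\mathbb{C}_p$ the completion of an algebraic closure of $\mathbb{Q}_p$. Fix embeddings $\iota_{\mathfrak p}\colon B\hookrightarrow M_2(\mathbb{Q}_{\mathfrak p})$ and $\iota_\infty\colon B\hookrightarrow M_2(\mathbb{R})$ induced by splittings at $\mathfrak p$ and $v_\infty$. $R\subset B$ is a maximal order with $\iota_{\mathfrak p}(R\otimes\mathbb{Z}_{\mathfrak p})=M_2(\mathbb{Z}_{\mathfrak p})$, and $\Gamma_0$ is the group of reduced norm $1$ units of $R$. $\Gamma_0$ acts by fractional linear transformations on the complex upper half plane $\mathcal{H}$ and on $\mathbb{P}^1(\mathbb{R})$ via $\iota_\infty$, and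 on $\mathcal{H}_{\mathfrak p}=\mathbb{P}^1(\mathbb{C}_p)\setminus\mathbb{P}^1(\mathbb{Q}_{\mathfrak p})$ via $\iota_{\mathfrak p}$; the latter action preserves $$A_0=\{z\in\mathbb{C}_p : |z|\le 1 \text{ and } |z-t|\ge 1 \text{ for all } t\in\mathbb{Z}_{\mathfrak p}\}.$$ $\operatorname{Div}A_0$ is the group of divisors (finite formal $\mathbb{Z}$-combinations of points) on $A_0$. For a group $G$ and $G$-module $V$, $Z^1(G,V)$ is the group of maps $\varphi\colon G\to V$ with $\varphi(gh)=\varphi(g)+g\varphi(h)$, and $H^1(G,V)$ is its quotient by the coboundaries $g\mapsto gv-v$. $K/F$ is a quadratic extension in which $\mathfrak p$ is inert, $v_\infty$ splits and all other infinite places of $F$ ramify; $\mathcal{O}$ is an $\mathcal{O}_F$-order of $K$; $\mathcal{E}(\mathcal{O},R)$ is the set of $F$-algebra embeddings $\psi\colon K\hookrightarrow B$ with $\psi^{-1}(R)=\mathcal{O}$. Let $u$ be a generator of the free part of the rank one group $\{w\in\mathcal{O}^\times : \mathrm{Norm}_{K/F}(w)=1\}$ and put $\gamma_\psi=\psi(u)\in\Gamma_0$. Fix an embedding of $K$ into its completion $K_{\mathfrak p}\subset\mathbb{C}_p$. The two fixed points of $\iota_{\mathfrak p}(\gamma_\psi)$ in $\mathcal{H}_{\mathfrak p}$ are $\tau_{\psi,p},\tau'_{\psi,p}$, where $\tau_{\psi,p}$ is the one with $\iota_{\mathfrak p}(\psi(a))\binom{\tau_{\psi,p}}{1}=a\binom{\tau_{\psi,p}}{1}$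 for all $a\in K$. Write $\iota_\infty(\gamma_\psi)=\begin{pmatrix}a&b\\c&d\end{pmatrix}$, assumed to have $c\ne0$; its fixed points in $\mathbb{P}^1(\mathbb{R})$ are $\frac{a-d\pm\sqrt{(d-a)^2+4bc}}{2c}$, and $\tau_{\psi,\infty}$ (resp. $\tau'_{\psi,\infty}$) denotes the one with the $+$ (resp. $-$) sign. For $w\in\Gamma_0\tau_{\psi,\infty}$ choose $\gamma_w\in\Gamma_0$ with $w=\gamma_w\tau_{\psi,\infty}$ and put $w_p=\gamma_w\tau_{\psi,p}\in A_0$ and $w'=\gamma_w\tau'_{\psi,\infty}\in\mathbb{P}^1(\mathbb{R})$; these do not depend on the choice of $\gamma_w$. $\mathcal{H}^*=\mathcal{H}\cup\mathbb{P}^1(\mathbb{Q})$ if $B\cong M_2(\mathbb{Q})$, and $\mathcal{H}^*=\mathcal{H}$ otherwise. For $a,b\in\mathcal{H}\cup\mathbb{P}^1(\mathbb{R})$, $C(a,b)$ is the oriented geodesic segment from $a$ to $b$. For $\gamma\in\Gamma_0$ and $w\in\Gamma_0\tau_{\psi,\infty}$, $\delta_\gamma(w)\in\{-1,0,1\}$ is the signed intersection number of the oriented geodesics $C(x,\gamma x)$ and $C(w,w')$; in particular it is $\pm1$ if $C(x,\gamma x)\cap C(w,w')\ne\emptyset$, and $0$ otherwise. For each $\gamma$ only finitely many $w$ have $\delta_\gamma(w)\neq 0$.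
   Formalization: If x lies on some C(w,w'), taking δ=±1 whenever the geodesics meet fails (γ=1 gives φ(1)≠0), so points on C(w,w') are counted as lying to its left; if B≅M_2(Q), ι_∞ is assumed to have image M_2(Q), so that P^1(Q) is the set of cusps. *)

theory Defs
  imports
    "HOL-Analysis.Analysis"
    "HOL-Computational_Algebra.Polynomial"
    "HOL-Algebra.Subrings"
    "HOL-Algebra.Coset"
    "HOL-Algebra.Free_Abelian_Groups"
begin

section \<open>Rings, fields and algebras\<close>

text \<open>
  The fields \<open>F\<close>, \<open>K\<close>, \<open>\<complex>\<^sub>p\<close> and the algebra \<open>B\<close> are types; subrings, orders and ideals are sets.
  A subset \<open>S\<close> of such a type, with the inherited operations, becomes a record of the algebra
  library through \<open>ring_on\<close>.
\<close>

definition ring_on :: "'a::ring_1 set \<Rightarrow> 'a ring" where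
  "ring_on S = \<lparr>carrier = S, monoid.mult = (*), one = 1, ring.zero = 0, ring.add = (+)\<rparr>"

definition is_ring_hom :: "('a::ring_1 \<Rightarrow> 'b::ring_1) \<Rightarrow> bool" where
  "is_ring_hom f \<longleftrightarrow>
     f 1 = 1 \<and> (\<forall>x y. f (x + y) = f x + f y) \<and> (\<forall>x y. f (x * y) = f x * f y)"

text \<open>The componentwise product that the type \<open>'a^2^2\<close> also carries is not the ring structure of
  \<open>M\<^sub>2\<close>, hence a separate notion of homomorphism.\<close>

definition is_mat_hom :: "('b::ring_1 \<Rightarrow> 'a::field^2^2) \<Rightarrow> bool" where
  "is_mat_hom f \<longleftrightarrow>
     f 1 = mat 1 \<and> (\<forall>x y. f (x + y) = f x + f y) \<and> (\<forall>x y. f (x * y) = f x ** f y)"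

definition mat2_over :: "'a set \<Rightarrow> ('a^2^2) set" where
  "mat2_over S = {M. \<forall>i j. M $ i $ j \<in> S}"

definition span_over :: "'a set \<Rightarrow> ('a \<Rightarrow> 'm \<Rightarrow> 'm) \<Rightarrow> 'm set \<Rightarrow> 'm::comm_monoid_add set" where
  "span_over A sc T = {(\<Sum>x\<in>U. sc (c x) x) | U c. finite U \<and> U \<subseteq> T \<and> c ` U \<subseteq> A}"

definition mat_scale :: "'a::field \<Rightarrow> 'a^2^2 \<Rightarrow> 'a^2^2" where
  "mat_scale c M = mat c ** M"

text \<open>An algebra over the field \<open>'f\<close>, given by its structure map.\<close>

definition is_algebra :: "('f::field \<Rightarrow> 'a::ring_1) \<Rightarrow> bool" where
  "is_algebra e \<longleftrightarrow> is_ring_hom e \<and> (\<forall>c x. e c * x = x * e c)"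

definition is_quadratic_ext :: "('f::field \<Rightarrow> 'k::field) \<Rightarrow> bool" where
  "is_quadratic_ext e \<longleftrightarrow> is_ring_hom e \<and> vector_space.dim (\<lambda>c x. e c * x) (UNIV :: 'k set) = 2"

text \<open>Relative norm of a Galois extension, as the product of the conjugates.\<close>

definition rel_norm :: "('f::field \<Rightarrow> 'k::field) \<Rightarrow> 'k \<Rightarrow> 'f" where
  "rel_norm e x =
     (THE n. e n = (\<Prod>\<sigma> | is_ring_hom \<sigma> \<and> bij \<sigma> \<and> (\<forall>c. \<sigma> (e c) = e c). \<sigma> x))"


section \<open>Number fields\<close>

definition is_number_field :: "'f::field_char_0 itself \<Rightarrow> bool" where
  "is_number_field _ \<longleftrightarrow> (\<exists>T :: 'f set. finite T \<and> span_over \<rat> (*) T = UNIV)"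

definition integers_of :: "'f::field_char_0 itself \<Rightarrow> 'f set" where
  "integers_of _ = {x. algebraic_int x}"

definition is_totally_real :: "'f::field_char_0 itself \<Rightarrow> bool" where
  "is_totally_real _ \<longleftrightarrow> (\<forall>\<sigma> :: 'f \<Rightarrow> complex. is_ring_hom \<sigma> \<longrightarrow> range \<sigma> \<subseteq> \<real>)"

definition is_totally_positive :: "'f::field_char_0 \<Rightarrow> bool" where
  "is_totally_positive a \<longleftrightarrow> (\<forall>\<sigma> :: 'f \<Rightarrow> real. is_ring_hom \<sigma> \<longrightarrow> \<sigma> a > 0)"

definition fractional_ideals :: "'f::field_char_0 set set" where
  "fractional_ideals =
     {I. I \<noteq> {0} \<and> 0 \<in> I \<and> (\<forall>x\<in>I. \<forall>y\<in>I. x + y \<in> I) \<and>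
         (\<forall>a\<in>integers_of TYPE('f). \<forall>x\<in>I. a * x \<in> I) \<and>
         (\<exists>c. c \<noteq> 0 \<and> (\<forall>x\<in>I. c * x \<in> integers_of TYPE('f)))}"

text \<open>The quotient set is the narrow class group: fractional ideals modulo multiplication by
  principal ideals with a totally positive generator.\<close>

definition narrow_class_number :: "'f::field_char_0 itself \<Rightarrow> nat" where
  "narrow_class_number _ =
     card ((fractional_ideals :: 'f set set) //
           {(I, J). I \<in> fractional_ideals \<and> J \<in> fractional_ideals \<and>
                    (\<exists>a. a \<noteq> 0 \<and> is_totally_positive a \<and> J = (*) a ` I)})"

text \<open>Infinite places of a totally real field are its ring homomorphisms into \<open>\<real>\<close>. The next two
  predicates describe the behaviour of such a place in an extension with structure map \<open>e\<close>.\<close>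

definition inf_place_splits :: "('f::field \<Rightarrow> 'k::field) \<Rightarrow> ('f \<Rightarrow> real) \<Rightarrow> bool" where
  "inf_place_splits e \<sigma> \<longleftrightarrow> card {\<rho> :: 'k \<Rightarrow> real. is_ring_hom \<rho> \<and> \<rho> \<circ> e = \<sigma>} = 2"

definition inf_place_ramifies :: "('f::field \<Rightarrow> 'k::field) \<Rightarrow> ('f \<Rightarrow> real) \<Rightarrow> bool" where
  "inf_place_ramifies e \<sigma> \<longleftrightarrow>
     (\<exists>\<rho> :: 'k \<Rightarrow> complex. is_ring_hom \<rho> \<and> \<rho> \<circ> e = complex_of_real \<circ> \<sigma> \<and> \<not> range \<rho> \<subseteq> \<real>)"

definition is_inert ::
    "('f::field_char_0 \<Rightarrow> 'k::field_char_0) \<Rightarrow> 'f set \<Rightarrow> bool" where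
  "is_inert e P \<longleftrightarrow>
     primeideal (genideal (ring_on (integers_of TYPE('k))) (e ` P)) (ring_on (integers_of TYPE('k)))"

definition is_order :: "('f::field_char_0 \<Rightarrow> 'a::ring_1) \<Rightarrow> 'a set \<Rightarrow> bool" where
  "is_order e S \<longleftrightarrow>
     subring S (ring_on UNIV) \<and>
     (\<exists>T. finite T \<and> S = span_over (integers_of TYPE('f)) (\<lambda>c x. e c * x) T) \<and>
     span_over UNIV (\<lambda>c x. e c * x) S = UNIV"

definition is_maximal_order :: "('f::field_char_0 \<Rightarrow> 'a::ring_1) \<Rightarrow> 'a set \<Rightarrow> bool" where
  "is_maximal_order e S \<longleftrightarrow> is_order e S \<and> (\<forall>S'. is_order e S' \<and> S \<subseteq> S' \<longrightarrow> S' = S)"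

text \<open>\<open>u\<close> has infinite order and generates the multiplicative group \<open>U\<close> modulo torsion.\<close>

definition generates_free_part :: "'k::field \<Rightarrow> 'k set \<Rightarrow> bool" where
  "generates_free_part u U \<longleftrightarrow>
     u \<in> U \<and> (\<forall>n>0. u ^ n \<noteq> 1) \<and>
     (\<forall>w\<in>U. \<exists>\<zeta>\<in>U. \<exists>n::int. (\<exists>m>0. \<zeta> ^ m = 1) \<and> w = \<zeta> * u powi n)"

definition norm_one_units_field :: "('f::field \<Rightarrow> 'k::field) \<Rightarrow> 'k set \<Rightarrow> 'k set" where
  "norm_one_units_field e S = {w \<in> Units (ring_on S). rel_norm e w = 1}"


section \<open>Quaternion algebras\<close>

definition is_quaternion_basis ::
    "('f::field_char_0 \<Rightarrow> 'b::ring_1) \<Rightarrow> 'f \<Rightarrow> 'f \<Rightarrow> 'b \<Rightarrow> 'b \<Rightarrow> bool" where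
  "is_quaternion_basis e a b i j \<longleftrightarrow>
     a \<noteq> 0 \<and> b \<noteq> 0 \<and> i * i = e a \<and> j * j = e b \<and> j * i = - (i * j) \<and>
     (\<forall>x. \<exists>!(t, u, v, w). x = e t + e u * i + e v * j + e w * (i * j))"

definition is_quaternion_algebra :: "('f::field_char_0 \<Rightarrow> 'b::ring_1) \<Rightarrow> bool" where
  "is_quaternion_algebra e \<longleftrightarrow> is_algebra e \<and> (\<exists>a b i j. is_quaternion_basis e a b i j)"

text \<open>The value does not depend on the quaternion basis used to compute it.\<close>

definition reduced_norm :: "('f::field_char_0 \<Rightarrow> 'b::ring_1) \<Rightarrow> 'b \<Rightarrow> 'f" where
  "reduced_norm e x =
     (THE n. \<exists>a b i j t u v w. is_quaternion_basis e a b i j \<and>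
        x = e t + e u * i + e v * j + e w * (i * j) \<and>
        n = t\<^sup>2 - a * u\<^sup>2 - b * v\<^sup>2 + a * b * w\<^sup>2)"

definition norm_one_units :: "('f::field_char_0 \<Rightarrow> 'b::ring_1) \<Rightarrow> 'b set \<Rightarrow> 'b set" where
  "norm_one_units e R = {g \<in> Units (ring_on R). reduced_norm e g = 1}"

text \<open>\<open>\<iota>\<close> is the restriction to \<open>B\<close> of an isomorphism \<open>B \<otimes>\<^sub>F L \<cong> M\<^sub>2(L)\<close>, where \<open>L\<close> is a subfield of
  \<open>'l\<close>, regarded as an extension of \<open>F\<close> through \<open>\<sigma>\<close>. Surjectivity of the \<open>L\<close>-linear extension of \<open>\<iota>\<close>
  is the last condition; injectivity then follows because both sides have dimension 4 over \<open>L\<close>.\<close>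

definition is_splitting ::
    "('f::field \<Rightarrow> 'b::ring_1) \<Rightarrow> 'l set \<Rightarrow> ('f \<Rightarrow> 'l::field) \<Rightarrow> ('b \<Rightarrow> 'l^2^2) \<Rightarrow> bool" where
  "is_splitting e L \<sigma> \<iota> \<longleftrightarrow>
     is_mat_hom \<iota> \<and> (\<forall>c. \<iota> (e c) = mat (\<sigma> c)) \<and> range \<iota> \<subseteq> mat2_over L \<and>
     span_over L mat_scale (range \<iota>) = mat2_over L"

definition is_split_real :: "('f::field \<Rightarrow> 'b::ring_1) \<Rightarrow> ('f \<Rightarrow> real) \<Rightarrow> bool" where
  "is_split_real e \<sigma> \<longleftrightarrow> (\<exists>\<iota>. is_splitting e UNIV \<sigma> \<iota>)"

definition is_M2Q :: "'b::ring_1 itself \<Rightarrow> bool" where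
  "is_M2Q _ \<longleftrightarrow> (\<exists>h :: 'b \<Rightarrow> rat^2^2. is_mat_hom h \<and> bij h)"

definition optimal_embeddings ::
    "('f::field \<Rightarrow> 'k::field) \<Rightarrow> ('f \<Rightarrow> 'b::ring_1) \<Rightarrow> 'k set \<Rightarrow> 'b set \<Rightarrow> ('k \<Rightarrow> 'b) set" where
  "optimal_embeddings eK eB S R = {\<psi>. is_ring_hom \<psi> \<and> \<psi> \<circ> eK = eB \<and> \<psi> -` R = S}"


section \<open>The field \<open>\<complex>\<^sub>p\<close>\<close>

definition is_nonarch_abs :: "('c::field \<Rightarrow> real) \<Rightarrow> bool" where
  "is_nonarch_abs v \<longleftrightarrow>
     (\<forall>x. 0 \<le> v x) \<and> (\<forall>x. v x = 0 \<longleftrightarrow> x = 0) \<and>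
     (\<forall>x y. v (x * y) = v x * v y) \<and> (\<forall>x y. v (x + y) \<le> max (v x) (v y))"

definition abs_complete :: "('c::field \<Rightarrow> real) \<Rightarrow> bool" where
  "abs_complete v \<longleftrightarrow>
     (\<forall>X :: nat \<Rightarrow> 'c.
        (\<forall>\<epsilon>>0. \<exists>N. \<forall>m\<ge>N. \<forall>n\<ge>N. v (X m - X n) < \<epsilon>) \<longrightarrow>
        (\<exists>l. \<forall>\<epsilon>>0. \<exists>N. \<forall>n\<ge>N. v (X n - l) < \<epsilon>))"

definition abs_closure :: "('c::field \<Rightarrow> real) \<Rightarrow> 'c set \<Rightarrow> 'c set" where
  "abs_closure v S = {z. \<forall>\<epsilon>>0. \<exists>s\<in>S. v (z - s) < \<epsilon>}"

text \<open>\<open>'c\<close> with the absolute value \<open>v\<close> is a completion of an algebraic closure \<open>A\<close> of \<open>\<rat>\<^sub>p\<close>, where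
  \<open>\<rat>\<^sub>p\<close> is the closure of \<open>\<rat>\<close>; the normalisation \<open>v p = 1/p\<close> makes \<open>v\<close> restrict to the
  \<open>p\<close>-adic absolute value of \<open>\<rat>\<close>.\<close>

definition is_Cp :: "nat \<Rightarrow> ('c::field_char_0 \<Rightarrow> real) \<Rightarrow> bool" where
  "is_Cp p v \<longleftrightarrow>
     prime p \<and> is_nonarch_abs v \<and> v (of_nat p) = 1 / real p \<and> abs_complete v \<and>
     (\<exists>A. subfield A (ring_on UNIV) \<and> abs_closure v \<rat> \<subseteq> A \<and>
        (\<forall>x\<in>A. \<exists>q. q \<noteq> 0 \<and> (\<forall>n. poly.coeff q n \<in> abs_closure v \<rat>) \<and> poly q x = 0) \<and>
        (\<forall>q. Polynomial.degree q > 0 \<and> (\<forall>n. poly.coeff q n \<in> A) \<longrightarrow> (\<exists>x\<in>A. poly q x = 0)) \<and>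
        abs_closure v A = UNIV)"

text \<open>A completion of \<open>F\<close> is realised as the closure of the image of \<open>F\<close> under an embedding \<open>j\<close>.
  The embedding induces the prime \<open>P\<close> if \<open>P\<close> is the set of integers of absolute value less
  than 1, and then this closure is the completion at \<open>P\<close>.\<close>

definition induces_prime ::
    "('c::field \<Rightarrow> real) \<Rightarrow> ('f::field_char_0 \<Rightarrow> 'c) \<Rightarrow> 'f set \<Rightarrow> bool" where
  "induces_prime v j P \<longleftrightarrow> is_ring_hom j \<and> P = {x \<in> integers_of TYPE('f). v (j x) < 1}"

definition completion_in :: "('c::field \<Rightarrow> real) \<Rightarrow> ('f \<Rightarrow> 'c) \<Rightarrow> 'c set" where
  "completion_in v j = abs_closure v (range j)"

definition completion_integers_in :: "('c::field \<Rightarrow> real) \<Rightarrow> ('f \<Rightarrow> 'c) \<Rightarrow> 'c set" where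
  "completion_integers_in v j = {z \<in> completion_in v j. v z \<le> 1}"


section \<open>Projective lines and fractional linear transformations\<close>

datatype 'a proj_line = Pt 'a | Infty

fun moebius :: "'a::field^2^2 \<Rightarrow> 'a proj_line \<Rightarrow> 'a proj_line" where
  "moebius M (Pt z) =
     (if M $ 2 $ 1 * z + M $ 2 $ 2 = 0 then Infty
      else Pt ((M $ 1 $ 1 * z + M $ 1 $ 2) / (M $ 2 $ 1 * z + M $ 2 $ 2)))"
| "moebius M Infty = (if M $ 2 $ 1 = 0 then Infty else Pt (M $ 1 $ 1 / M $ 2 $ 1))"

text \<open>The subset \<open>\<H> \<union> \<pp>\<^sup>1(\<real>)\<close> of \<open>\<pp>\<^sup>1(\<complex>)\<close> is stable under the action of \<open>SL\<^sub>2(\<real>)\<close>.\<close>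

definition real_moebius :: "real^2^2 \<Rightarrow> complex proj_line \<Rightarrow> complex proj_line" where
  "real_moebius M = moebius (\<chi> i j. complex_of_real (M $ i $ j))"

definition upper_half_plane :: "complex proj_line set" where
  "upper_half_plane = Pt ` {z. Im z > 0}"

text \<open>For \<open>B \<cong> M\<^sub>2(\<rat>)\<close> this presupposes that the real splitting identifies \<open>B\<close> with \<open>M\<^sub>2(\<rat>)\<close>.\<close>

definition extended_half_plane :: "'b::ring_1 itself \<Rightarrow> complex proj_line set" where
  "extended_half_plane T =
     (if is_M2Q T then upper_half_plane \<union> Pt ` \<rat> \<union> {Infty} else upper_half_plane)"

text \<open>The set \<open>A\<^sub>0\<close>; its second argument is the ring of integers of the completion at \<open>\<pp>\<close>.\<close>

definition standard_affinoid :: "('c::field \<Rightarrow> real) \<Rightarrow> 'c set \<Rightarrow> 'c proj_line set" where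
  "standard_affinoid v Z = Pt ` {z. v z \<le> 1 \<and> (\<forall>t\<in>Z. v (z - t) \<ge> 1)}"


section \<open>Geodesics and signed intersection numbers\<close>

text \<open>The point \<open>t\<close> times the imaginary unit on the closed imaginary axis, for \<open>0 \<le> t \<le> \<infinity>\<close>.\<close>

definition axis_point :: "ereal \<Rightarrow> complex proj_line" where
  "axis_point t = (if t = \<infinity> then Infty else Pt (Complex 0 (real_of_ereal t)))"

text \<open>The geodesics of \<open>\<H>\<close> are the images of the imaginary axis under \<open>SL\<^sub>2(\<real>)\<close>. The segment from
  \<open>a\<close> to \<open>b\<close> is given as a set of points, including \<open>a\<close> and \<open>b\<close>; its orientation is recorded by the
  order of the arguments.\<close>

definition geodesic :: "complex proj_line \<Rightarrow> complex proj_line \<Rightarrow> complex proj_line set" where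
  "geodesic a b =
     {z. \<exists>M r s t. det M = 1 \<and> 0 \<le> r \<and> r \<le> s \<and> s \<le> t \<and>
          a = real_moebius M (axis_point r) \<and> z = real_moebius M (axis_point s) \<and>
          b = real_moebius M (axis_point t)}"

text \<open>\<open>z\<close> lies strictly to the right of the complete oriented geodesic from \<open>w\<close> to \<open>w'\<close>. In the
  coordinate where this geodesic is the imaginary axis from \<open>0\<close> to \<open>\<infinity>\<close>, this is the
  half-plane of positive real part.\<close>

definition right_of :: "complex proj_line \<Rightarrow> complex proj_line \<Rightarrow> complex proj_line \<Rightarrow> bool" where
  "right_of w w' z \<longleftrightarrow>
     (\<exists>M \<zeta>. det M = 1 \<and> w = real_moebius M (Pt 0) \<and> w' = real_moebius M Infty \<and>
          z = real_moebius M (Pt \<zeta>) \<and> Re \<zeta> > 0)"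

text \<open>The signed intersection number of \<open>C(a,b)\<close> with the complete geodesic \<open>C(w,w')\<close>, where
  \<open>w, w'\<close> are distinct points of \<open>\<pp>\<^sup>1(\<real>)\<close>. If neither \<open>a\<close> nor \<open>b\<close> lies on \<open>C(w,w')\<close> and the two
  geodesics meet, then they cross, and the value is \<open>+1\<close> if \<open>C(a,b)\<close> crosses from left to right
  (so that the tangent of \<open>C(a,b)\<close> followed by that of \<open>C(w,w')\<close> is a positively oriented frame)
  and \<open>-1\<close> if it crosses from right to left.

  If \<open>a\<close> or \<open>b\<close> lies on \<open>C(w,w')\<close>, the intersection is not transversal in its interior. Such points
  are counted as lying to the left, which amounts to pushing \<open>C(w,w')\<close> infinitesimally to its right.
  A value of \<open>\<plusminus>1\<close> for all such configurations would be inconsistent with additivity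
  in \<open>C(a,b)\<close>, for example for \<open>a = b\<close>, or for a segment contained in \<open>C(w,w')\<close>.\<close>

definition signed_intersection ::
    "complex proj_line \<Rightarrow> complex proj_line \<Rightarrow> complex proj_line \<Rightarrow> complex proj_line \<Rightarrow> int" where
  "signed_intersection a b w w' =
     (if geodesic a b \<inter> geodesic w w' = {} then 0
      else of_bool (right_of w w' b) - of_bool (right_of w w' a))"


section \<open>Group cohomology in degree one\<close>

text \<open>The group \<open>V\<close> is written multiplicatively, as in the algebra library; cocycles are extensional
  functions, so that equal cochains are equal as functions on the whole type.\<close>

definition Z1 :: "('g, 'm) monoid_scheme \<Rightarrow> ('v, 'n) monoid_scheme \<Rightarrow> ('g \<Rightarrow> 'v \<Rightarrow> 'v)
    \<Rightarrow> ('g \<Rightarrow> 'v) monoid" where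
  "Z1 G V act =
     \<lparr>carrier = {\<phi> \<in> carrier G \<rightarrow>\<^sub>E carrier V.
        \<forall>g\<in>carrier G. \<forall>h\<in>carrier G. \<phi> (g \<otimes>\<^bsub>G\<^esub> h) = \<phi> g \<otimes>\<^bsub>V\<^esub> act g (\<phi> h)},
      monoid.mult = (\<lambda>\<phi> \<eta>. \<lambda>g\<in>carrier G. \<phi> g \<otimes>\<^bsub>V\<^esub> \<eta> g),
      one = (\<lambda>g\<in>carrier G. \<one>\<^bsub>V\<^esub>)\<rparr>"

definition B1 :: "('g, 'm) monoid_scheme \<Rightarrow> ('v, 'n) monoid_scheme \<Rightarrow> ('g \<Rightarrow> 'v \<Rightarrow> 'v)
    \<Rightarrow> ('g \<Rightarrow> 'v) set" where
  "B1 G V act = {(\<lambda>g\<in>carrier G. act g v \<otimes>\<^bsub>V\<^esub> inv\<^bsub>V\<^esub> v) | v. v \<in> carrier V}"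

definition H1 :: "('g, 'm) monoid_scheme \<Rightarrow> ('v, 'n) monoid_scheme \<Rightarrow> ('g \<Rightarrow> 'v \<Rightarrow> 'v)
    \<Rightarrow> ('g \<Rightarrow> 'v) set monoid" where
  "H1 G V act = Z1 G V act Mod B1 G V act"

definition H1_class :: "('g, 'm) monoid_scheme \<Rightarrow> ('v, 'n) monoid_scheme \<Rightarrow> ('g \<Rightarrow> 'v \<Rightarrow> 'v)
    \<Rightarrow> ('g \<Rightarrow> 'v) \<Rightarrow> ('g \<Rightarrow> 'v) set" where
  "H1_class G V act \<phi> = B1 G V act #>\<^bsub>Z1 G V act\<^esub> \<phi>"

definition mult_group_on :: "'b::ring_1 set \<Rightarrow> 'b monoid" where
  "mult_group_on \<Gamma> = \<lparr>carrier = \<Gamma>, monoid.mult = (*), one = 1\<rparr>"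

text \<open>Divisors are elements of the free abelian group of the library.\<close>

definition div_action ::
    "('b \<Rightarrow> 'c::field^2^2) \<Rightarrow> 'b \<Rightarrow> ('c proj_line \<Rightarrow>\<^sub>0 int) \<Rightarrow> ('c proj_line \<Rightarrow>\<^sub>0 int)" where
  "div_action \<iota> g = frag_extend (\<lambda>P. frag_of (moebius (\<iota> g) P))"


section \<open>The cocycle attached to an embedding\<close>

definition fixed_plus :: "real^2^2 \<Rightarrow> complex proj_line" where
  "fixed_plus M =
     Pt (complex_of_real
       ((M $ 1 $ 1 - M $ 2 $ 2 + sqrt ((M $ 2 $ 2 - M $ 1 $ 1)\<^sup>2 + 4 * M $ 1 $ 2 * M $ 2 $ 1))
        / (2 * M $ 2 $ 1)))"

definition fixed_minus :: "real^2^2 \<Rightarrow> complex proj_line" where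
  "fixed_minus M =
     Pt (complex_of_real
       ((M $ 1 $ 1 - M $ 2 $ 2 - sqrt ((M $ 2 $ 2 - M $ 1 $ 1)\<^sup>2 + 4 * M $ 1 $ 2 * M $ 2 $ 1))
        / (2 * M $ 2 $ 1)))"

text \<open>The parameters below are: the group \<open>\<Gamma>\<close>, the splittings \<open>\<iota>_inf\<close> and \<open>\<iota>_p\<close>, the element
  \<open>\<gamma>_\<psi>\<close>, and its distinguished \<open>\<pp>\<close>-adic fixed point \<open>\<tau>_p\<close>.\<close>

definition orbit_inf :: "'b set \<Rightarrow> ('b \<Rightarrow> real^2^2) \<Rightarrow> 'b \<Rightarrow> complex proj_line set" where
  "orbit_inf \<Gamma> \<iota>_inf \<gamma>_\<psi> = {real_moebius (\<iota>_inf g) (fixed_plus (\<iota>_inf \<gamma>_\<psi>)) | g. g \<in> \<Gamma>}"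

text \<open>The points \<open>w'\<close> and \<open>w\<^sub>p\<close>. The use of a definite description means that independence of the
  element \<open>g\<close> with \<open>w = g \<tau>\<^sub>\<psi>\<^sub>,\<^sub>\<infinity>\<close> is part of what has to be proved about them.\<close>

definition conj_point ::
    "'b set \<Rightarrow> ('b \<Rightarrow> real^2^2) \<Rightarrow> 'b \<Rightarrow> complex proj_line \<Rightarrow> complex proj_line" where
  "conj_point \<Gamma> \<iota>_inf \<gamma>_\<psi> w =
     (THE z. \<exists>g\<in>\<Gamma>. w = real_moebius (\<iota>_inf g) (fixed_plus (\<iota>_inf \<gamma>_\<psi>)) \<and>
                   z = real_moebius (\<iota>_inf g) (fixed_minus (\<iota>_inf \<gamma>_\<psi>)))"

definition padic_point ::
    "'b set \<Rightarrow> ('b \<Rightarrow> real^2^2) \<Rightarrow> ('b \<Rightarrow> 'c::field^2^2) \<Rightarrow> 'b \<Rightarrow> 'c \<Rightarrow> complex proj_line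
      \<Rightarrow> 'c proj_line" where
  "padic_point \<Gamma> \<iota>_inf \<iota>_p \<gamma>_\<psi> \<tau>_p w =
     (THE z. \<exists>g\<in>\<Gamma>. w = real_moebius (\<iota>_inf g) (fixed_plus (\<iota>_inf \<gamma>_\<psi>)) \<and>
                   z = moebius (\<iota>_p g) (Pt \<tau>_p))"

definition delta ::
    "'b set \<Rightarrow> ('b \<Rightarrow> real^2^2) \<Rightarrow> 'b \<Rightarrow> complex proj_line \<Rightarrow> 'b \<Rightarrow> complex proj_line \<Rightarrow> int" where
  "delta \<Gamma> \<iota>_inf \<gamma>_\<psi> x g w =
     signed_intersection x (real_moebius (\<iota>_inf g) x) w (conj_point \<Gamma> \<iota>_inf \<gamma>_\<psi> w)"

definition delta_support ::
    "'b set \<Rightarrow> ('b \<Rightarrow> real^2^2) \<Rightarrow> 'b \<Rightarrow> complex proj_line \<Rightarrow> 'b \<Rightarrow> complex proj_line set" where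
  "delta_support \<Gamma> \<iota>_inf \<gamma>_\<psi> x g = {w \<in> orbit_inf \<Gamma> \<iota>_inf \<gamma>_\<psi>. delta \<Gamma> \<iota>_inf \<gamma>_\<psi> x g w \<noteq> 0}"

text \<open>The sum over the orbit is taken over its support; it is meaningful when the support is finite.\<close>

definition phi ::
    "'b set \<Rightarrow> ('b \<Rightarrow> real^2^2) \<Rightarrow> ('b \<Rightarrow> 'c::field^2^2) \<Rightarrow> 'b \<Rightarrow> 'c \<Rightarrow> complex proj_line
      \<Rightarrow> 'b \<Rightarrow> ('c proj_line \<Rightarrow>\<^sub>0 int)" where
  "phi \<Gamma> \<iota>_inf \<iota>_p \<gamma>_\<psi> \<tau>_p x =
     (\<lambda>g\<in>\<Gamma>. \<Sum>w\<in>delta_support \<Gamma> \<iota>_inf \<gamma>_\<psi> x g.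
        frag_cmul (delta \<Gamma> \<iota>_inf \<gamma>_\<psi> x g w) (frag_of (padic_point \<Gamma> \<iota>_inf \<iota>_p \<gamma>_\<psi> \<tau>_p w)))"

end

theory Submission
  imports Defs "HOL-Computational_Algebra.Fundamental_Theorem_Algebra"
begin

text \<open>Since \<open>w\<close> and \<open>w'\<close> are the boundary points of a complete geodesic, the intersection number
  of \<open>C(a,b)\<close> with \<open>C(w,w')\<close> is \<open>s\<^sub>w(b) - s\<^sub>w(a)\<close>, where \<open>s\<^sub>w\<close> is the indicator function of the open
  half-plane to the right of \<open>C(w,w')\<close>. So the divisors \<open>D(a,b) = \<Sum> (s\<^sub>w(b) - s\<^sub>w(a)) w\<^sub>p\<close> satisfy
  \<open>D(a,b) + D(b,c) = D(a,c)\<close> and \<open>D(g a, g b) = g D(a,b)\<close>, which gives the cocycle relation for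
  \<open>g \<mapsto> D(x, g x)\<close>, and \<open>D(x, g x) - D(y, g y)\<close> is the coboundary of \<open>D(y, x)\<close>.

  The divisors are finite because \<open>w\<close> is determined by the conjugate of \<open>\<gamma>\<^sub>\<psi>\<close> fixing it, and the
  conjugates whose axis separates \<open>a\<close> and \<open>b\<close> have bounded entries at the split real place. The
  reduced norm is positive definite at the other real places, so all coordinates of such a
  conjugate are bounded at all places, and a number field contains only finitely many integers
  with this property. At a cusp the bound holds because a rational binary quadratic form without
  rational zeros takes values bounded away from \<open>0\<close> there.

  The points \<open>w'\<close> and \<open>w\<^sub>p\<close> are well defined because an element of \<open>\<Gamma>\<^sub>0\<close> fixing \<open>\<tau>\<^sub>\<psi>\<^sub>,\<^sub>\<infinity>\<close> commutes with
  \<open>\<gamma>\<^sub>\<psi>\<close>.\<close>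

text \<open>Two obstacles shape the proof. Separation is a statement about geodesics, boundedness of
  a conjugate one about matrix entries. The link is the form A|z|^2 + B Re z + C vanishing on
  C(w,w'). Normalised to discriminant 1 it is the form of the conjugate divided by the difference of
  the eigenvalues of \<gamma>; its sign tells the side, and a sign change between two points of the
  open half-plane bounds A, B and C. The finiteness of integers bounded at all places is derived
  without norms or discriminants. Embeddings of F arise as eigenvalue characters of multiplication
  on additive functions from F to \<complex>. If every embedding makes z smaller than 1, all
  rational coordinates of z^k tend to 0, while integrality bounds their denominators, so some z^k
  vanishes; comparing integer parts then suffices. The convention that points on C(w,w') count as
  left makes additivity exact: every side function is defined on the whole closed half-plane, also
  at points of the geodesic itself.\<close>

section \<open>Matrices of size 2 by entries\<close>

lemma mat2_eq_iff:
  "(A :: 'a^2^2) = B \<longleftrightarrow>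
     A$1$1 = B$1$1 \<and> A$1$2 = B$1$2 \<and> A$2$1 = B$2$1 \<and> A$2$2 = B$2$2"
  by (auto simp: vec_eq_iff forall_2)

lemma mat2_mult_entry:
  fixes A B :: "'a::semiring_1^2^2"
  shows "(A ** B) $ i $ j = A$i$1 * B$1$j + A$i$2 * B$2$j"
  by (simp add: matrix_matrix_mult_def sum_2)

lemma mat_entry2 [simp]:
  "(mat c :: 'a::zero^2^2)$1$1 = c" "(mat c :: 'a^2^2)$1$2 = 0"
  "(mat c :: 'a^2^2)$2$1 = 0" "(mat c :: 'a^2^2)$2$2 = c"
  by (simp_all add: mat_def)

lemma mat_scale_entry [simp]: "mat_scale c M $ i $ j = c * M $ i $ j"
proof -
  have "i = 1 \<or> i = 2" by (rule exhaust_2)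
  then show ?thesis by (auto simp: mat_scale_def mat2_mult_entry)
qed

definition mat2 :: "'a \<Rightarrow> 'a \<Rightarrow> 'a \<Rightarrow> 'a \<Rightarrow> 'a^2^2" where
  "mat2 a b c d = (\<chi> i j. if i = 1 then (if j = 1 then a else b) else (if j = 1 then c else d))"

lemma mat2_entry [simp]:
  "mat2 a b c d $ 1 $ 1 = a" "mat2 a b c d $ 1 $ 2 = b"
  "mat2 a b c d $ 2 $ 1 = c" "mat2 a b c d $ 2 $ 2 = d"
  by (simp_all add: mat2_def)

lemma det_mat2 [simp]: "det (mat2 a b c d :: 'a::comm_ring_1^2^2) = a * d - b * c"
  by (simp add: det_2)

lemma sl2_inverse:
  fixes P :: "'a::field^2^2"
  assumes "det P = 1"
  defines "P' \<equiv> mat2 (P$2$2) (- P$1$2) (- P$2$1) (P$1$1)"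
  shows "det P' = 1" "P ** P' = mat 1" "P' ** P = mat 1"
  using assms by (auto simp: mat2_eq_iff mat2_mult_entry det_2 algebra_simps)

section \<open>Fractional linear transformations\<close>

text \<open>Homogeneous coordinates [x : y]. A matrix acts on them linearly, so composition of
  fractional linear maps needs no case split at the poles.\<close>

definition hom_pt :: "'a::field \<Rightarrow> 'a \<Rightarrow> 'a proj_line" where
  "hom_pt x y = (if y = 0 then Infty else Pt (x / y))"

lemma proj_line_hom_pt: obtains x y where "z = hom_pt x y" "x \<noteq> 0 \<or> y \<noteq> 0"
proof (cases z)
  case (Pt x)
  then show ?thesis using that[of x 1] by (simp add: hom_pt_def)
next
  case Infty
  then show ?thesis using that[of 1 0] by (simp add: hom_pt_def)
qed

lemma moebius_hom_pt:
  assumes "x \<noteq> 0 \<or> y \<noteq> 0"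
  shows "moebius M (hom_pt x y) = hom_pt (M$1$1 * x + M$1$2 * y) (M$2$1 * x + M$2$2 * y)"
proof (cases "y = 0")
  case True
  then show ?thesis using assms by (auto simp: hom_pt_def)
next
  case False
  have "M$2$1 * (x / y) + M$2$2 = (M$2$1 * x + M$2$2 * y) / y"
       "M$1$1 * (x / y) + M$1$2 = (M$1$1 * x + M$1$2 * y) / y"
    using False by (auto simp: field_simps)
  then show ?thesis using False by (auto simp: hom_pt_def)
qed

lemma moebius_mult:
  assumes "det B \<noteq> 0"
  shows "moebius (A ** B) z = moebius A (moebius B z)"
proof -
  obtain x y where z: "z = hom_pt x y" "x \<noteq> 0 \<or> y \<noteq> 0"
    by (rule proj_line_hom_pt)
  \<comment> \<open>The coordinates [0 : 0] would be read as \<open>Infty\<close>, so the image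
    vector must be shown nonzero; the adjugate of \<open>B\<close> recovers \<open>det B\<close>
    times (x, y) from it.\<close>
  have "B$1$1 * x + B$1$2 * y \<noteq> 0 \<or> B$2$1 * x + B$2$2 * y \<noteq> 0"
  proof (rule ccontr)
    assume "\<not> ?thesis"
    then have "B$1$1 * x + B$1$2 * y = 0" "B$2$1 * x + B$2$2 * y = 0" by auto
    moreover have "det B * x = B$2$2 * (B$1$1 * x + B$1$2 * y) - B$1$2 * (B$2$1 * x + B$2$2 * y)"
      "det B * y = B$1$1 * (B$2$1 * x + B$2$2 * y) - B$2$1 * (B$1$1 * x + B$1$2 * y)"
      by (simp_all add: det_2 algebra_simps)
    ultimately have "det B * x = 0" "det B * y = 0" by simp_all
    then show False using assms z(2) by simp
  qed
  then show ?thesis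
    using z(2) by (simp add: z(1) moebius_hom_pt[OF z(2)] moebius_hom_pt mat2_mult_entry)
      (simp add: algebra_simps)
qed

lemma moebius_one [simp]: "moebius (mat 1) z = z"
  by (cases z) auto

definition cmat :: "real^2^2 \<Rightarrow> complex^2^2" where
  "cmat M = (\<chi> i j. complex_of_real (M $ i $ j))"

lemma cmat_entry [simp]: "cmat M $ i $ j = complex_of_real (M $ i $ j)"
  by (simp add: cmat_def)

lemma real_moebius_cmat: "real_moebius M = moebius (cmat M)"
  by (simp add: real_moebius_def cmat_def)

lemma det_cmat: "det (cmat M) = complex_of_real (det M)"
  by (simp add: det_2)

lemma cmat_mult: "cmat (A ** B) = cmat A ** cmat B"
  by (simp add: mat2_eq_iff mat2_mult_entry)

lemma real_moebius_mult:
  assumes "det B \<noteq> 0"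
  shows "real_moebius (A ** B) z = real_moebius A (real_moebius B z)"
  using assms by (simp add: real_moebius_cmat cmat_mult moebius_mult det_cmat)

lemma real_moebius_one [simp]: "real_moebius (mat 1) z = z"
  by (cases z) (auto simp: real_moebius_cmat)

lemma real_moebius_inverse:
  assumes "det P = 1"
  defines "P' \<equiv> mat2 (P$2$2) (- P$1$2) (- P$2$1) (P$1$1)"
  shows "real_moebius P' (real_moebius P z) = z" "real_moebius P (real_moebius P' z) = z"
proof -
  note inv = sl2_inverse[OF assms(1), folded P'_def]
  show "real_moebius P' (real_moebius P z) = z"
    using real_moebius_mult[of P P' z] inv assms(1) by simp
  show "real_moebius P (real_moebius P' z) = z"
    using real_moebius_mult[of P' P z] inv by simp
qed

section \<open>The half-plane with its boundary under SL_2(\<real>)\<close>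

definition closed_half_plane :: "complex proj_line set" where
  "closed_half_plane = insert Infty (Pt ` {z. Im z \<ge> 0})"

lemma Pt_mem_closed_half_plane [simp]: "Pt z \<in> closed_half_plane \<longleftrightarrow> Im z \<ge> 0"
  and Infty_mem_closed_half_plane [simp]: "Infty \<in> closed_half_plane"
  by (auto simp: closed_half_plane_def)

text \<open>Multiplying by the conjugate denominator leaves the determinant times Im z. The entries
  are complex numbers lying in \<real>, the shape that unfolding \<open>real_moebius\<close>
  produces.\<close>

lemma Im_moebius:
  assumes "M21 * z + M22 \<noteq> (0::complex)" "M11 * M22 - M12 * M21 = 1"
    "M11 \<in> \<real>" "M12 \<in> \<real>" "M21 \<in> \<real>" "M22 \<in> \<real>"
  shows "Im ((M11 * z + M12) / (M21 * z + M22)) = Im z / (cmod (M21 * z + M22))\<^sup>2"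
proof -
  from assms(3-6) obtain a b c d where e: "M11 = of_real a" "M12 = of_real b" "M21 = of_real c" "M22 = of_real d"
    by (auto elim!: Reals_cases)
  have "complex_of_real (a * d - b * c) = complex_of_real 1" using assms(2) e by simp
  then have "a * d - b * c = 1" by (simp only: of_real_eq_iff)
  have "a * Im z * (c * Re z + d) - (a * Re z + b) * (c * Im z) = (a * d - b * c) * Im z"
    by (simp add: algebra_simps)
  then have *: "a * Im z * (c * Re z + d) - (a * Re z + b) * (c * Im z) = Im z"
    by (simp only: \<open>a * d - b * c = 1\<close> mult_1)
  show ?thesis
    unfolding Im_divide e cmod_power2 by (simp only: Re_complex_of_real Im_complex_of_real times_complex.sel plus_complex.sel) (simp add: *)
qed

lemma det_eq_one_complex:
  fixes M :: "real^2^2"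
  assumes "det M = 1"
  shows "complex_of_real (M$1$1) * of_real (M$2$2) - of_real (M$1$2) * of_real (M$2$1) = 1"
proof -
  have "complex_of_real (M$1$1 * M$2$2 - M$1$2 * M$2$1) = complex_of_real 1"
    using assms unfolding det_2 by simp
  then show ?thesis by (simp only: of_real_diff of_real_mult of_real_1)
qed

lemma real_moebius_closed_half_plane:
  assumes "det M = 1" "z \<in> closed_half_plane"
  shows "real_moebius M z \<in> closed_half_plane"
proof (cases z)
  case (Pt z')
  have d: "complex_of_real (M$1$1) * of_real (M$2$2) - of_real (M$1$2) * of_real (M$2$1) = 1"
    using assms(1) by (rule det_eq_one_complex)
  show ?thesis using assms(2) Pt
    by (auto simp: real_moebius_cmat Im_moebius[OF _ d])
qed (use assms in \<open>auto simp: real_moebius_cmat\<close>)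

lemma real_moebius_upper_half_plane:
  assumes "det M = 1" "z \<in> upper_half_plane"
  shows "real_moebius M z \<in> upper_half_plane"
proof -
  obtain z' where z': "z = Pt z'" "Im z' > 0" using assms(2) by (auto simp: upper_half_plane_def)
  have d: "complex_of_real (M$1$1) * of_real (M$2$2) - of_real (M$1$2) * of_real (M$2$1) = 1"
    using assms(1) by (rule det_eq_one_complex)
  have nz: "complex_of_real (M$2$1) * z' + complex_of_real (M$2$2) \<noteq> 0"
  proof
    assume h: "complex_of_real (M$2$1) * z' + complex_of_real (M$2$2) = 0"
    then have "Im (complex_of_real (M$2$1) * z' + complex_of_real (M$2$2)) = 0" by simp
    then have "M$2$1 * Im z' = 0" by simp
    then have "M$2$1 = 0" using z' by simp
    then show False using h assms(1) by (simp add: det_2)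
  qed
  then show ?thesis using z'
    by (auto simp: real_moebius_cmat upper_half_plane_def Im_moebius[OF _ d])
qed

section \<open>Geodesics\<close>

lemma geodesic_moebius:
  assumes "det P = 1" "z \<in> geodesic a b"
  shows "real_moebius P z \<in> geodesic (real_moebius P a) (real_moebius P b)"
proof -
  from assms(2) obtain M r s t where *: "det M = 1" "0 \<le> r" "r \<le> s" "s \<le> t"
    "a = real_moebius M (axis_point r)" "z = real_moebius M (axis_point s)"
    "b = real_moebius M (axis_point t)"
    unfolding geodesic_def by blast
  show ?thesis unfolding geodesic_def mem_Collect_eq
    by (rule exI[of _ "P ** M"], rule exI[of _ r], rule exI[of _ s], rule exI[of _ t])
       (use * assms(1) in \<open>simp add: det_mul real_moebius_mult\<close>)
qed

text \<open>The map z \<mapsto> -1/z reverses the imaginary axis. Since \<open>inverse\<close> on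
  \<open>ereal\<close> exchanges 0 and \<infinity>, the two end points are covered as well.\<close>

lemma axis_point_inverse:
  assumes "0 \<le> t"
  shows "real_moebius (mat2 0 (-1) 1 0) (axis_point (inverse t)) = axis_point t"
proof (cases t rule: ereal_cases)
  case (real r)
  show ?thesis
  proof (cases "r = 0")
    case True
    then have "t = 0" using real by (simp add: zero_ereal_def)
    then show ?thesis by (simp add: axis_point_def real_moebius_cmat Complex_eq_0)
  next
    case False
    then show ?thesis using real assms
      by (simp add: axis_point_def real_moebius_cmat complex_eq_iff Re_divide Im_divide power2_eq_square)
         (simp add: field_simps)
  qed
qed (use assms in \<open>simp_all add: axis_point_def real_moebius_cmat zero_complex.code\<close>)

lemma geodesic_sym:
  assumes "z \<in> geodesic a b"
  shows "z \<in> geodesic b a"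
proof -
  let ?S = "mat2 0 (-1) 1 (0::real)"
  from assms obtain M r s t where *: "det M = 1" "0 \<le> r" "r \<le> s" "s \<le> t"
    "a = real_moebius M (axis_point r)" "z = real_moebius M (axis_point s)"
    "b = real_moebius M (axis_point t)"
    unfolding geodesic_def by blast
  have le: "0 \<le> s" "0 \<le> t" using * by order+
  have inv: "0 \<le> inverse t" "inverse t \<le> inverse s" "inverse s \<le> inverse r"
    using * le by (simp_all add: ereal_inverse_antimono ereal_inverse_nonneg_iff)
  have d: "det (M ** ?S) = 1" using * by (simp add: det_mul)
  have m: "real_moebius (M ** ?S) (axis_point (inverse x)) = real_moebius M (axis_point x)" if "0 \<le> x" for x
    using that by (simp add: real_moebius_mult axis_point_inverse)
  show ?thesis unfolding geodesic_def mem_Collect_eq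
    by (rule exI[of _ "M ** ?S"], rule exI[of _ "inverse t"], rule exI[of _ "inverse s"],
        rule exI[of _ "inverse r"]) (use d m inv * le in simp)
qed

lemma imaginary_axis_geodesic:
  "Infty \<in> geodesic (Pt 0) Infty" "y \<ge> 0 \<Longrightarrow> Pt (Complex 0 y) \<in> geodesic (Pt 0) Infty"
proof -
  have *: "axis_point s \<in> geodesic (Pt 0) Infty" if "0 \<le> s" for s
    unfolding geodesic_def mem_Collect_eq
    by (rule exI[of _ "mat 1"], rule exI[of _ 0], rule exI[of _ s], rule exI[of _ \<infinity>])
       (use that in \<open>auto simp: axis_point_def zero_complex.code det_2\<close>)
  show "Infty \<in> geodesic (Pt 0) Infty" using *[of \<infinity>] by (simp add: axis_point_def)
  show "Pt (Complex 0 y) \<in> geodesic (Pt 0) Infty" if "y \<ge> 0"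
    using *[of "ereal y"] that by (simp add: axis_point_def)
qed

lemma vertical_geodesic:
  assumes "Im b \<ge> 0"
  shows "Infty \<in> geodesic (Pt b) Infty"
  unfolding geodesic_def mem_Collect_eq
  by (rule exI[of _ "mat2 1 (Re b) 0 1"], rule exI[of _ "ereal (Im b)"], rule exI[of _ \<infinity>],
      rule exI[of _ \<infinity>])
     (use assms in \<open>auto simp: axis_point_def real_moebius_cmat complex_eq_iff\<close>)

text \<open>The semicircle with end points \<open>p < q\<close> is the image of the imaginary axis under
  \<open>z \<mapsto> (q z + p) / (z + 1)\<close>, and the real part increases along it.\<close>

lemma semicircle_point:
  assumes "p < q" "p \<le> x" "x \<le> q" "y \<ge> 0" "y\<^sup>2 = (x - p) * (q - x)"
  shows "real_moebius (mat2 (q / sqrt (q - p)) (p / sqrt (q - p)) (1 / sqrt (q - p)) (1 / sqrt (q - p)))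
     (axis_point (if x = q then \<infinity> else ereal (sqrt ((x - p) / (q - x))))) = Pt (Complex x y)"
proof (cases "x = q")
  case True
  then show ?thesis using assms by (simp add: axis_point_def real_moebius_cmat complex_eq_iff)
next
  case False
  define s where "s = sqrt ((x - p) / (q - x))"
  define k where "k = sqrt (q - p)"
  have k: "k > 0" using assms by (simp add: k_def)
  have xq: "q - x > 0" using False assms by simp
  have s2: "s\<^sup>2 = (x - p) / (q - x)" using assms False by (simp add: s_def)
  have s0: "s \<ge> 0" using assms by (simp add: s_def)
  \<comment> \<open>Both sides are nonnegative with equal squares. With \<open>s\<close> written as
    y / (q - x) the square root disappears and only polynomial identities remain.\<close>
  have ys: "y = s * (q - x)"
  proof (rule power2_eq_imp_eq)
    show "y\<^sup>2 = (s * (q - x))\<^sup>2" using xq by (simp add: power_mult_distrib s2 assms(5)) (simp add: power2_eq_square)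
  qed (use s0 xq assms in auto)
  have s2': "s * (s * (q - x)) = x - p" using s2 xq by (simp add: power2_eq_square field_simps)
  have "s * y = x - p" using s2' ys by simp
  then have c1: "p = x - s * y" by simp
  have c2: "q * s = y + s * x" using ys by (simp add: algebra_simps)
  have nz: "complex_of_real (1 / k) * Complex 0 s + complex_of_real (1 / k) \<noteq> 0"
    using k by (simp add: complex_eq_iff)
  have "(complex_of_real (q / k) * Complex 0 s + complex_of_real (p / k)) =
     Complex x y * (complex_of_real (1 / k) * Complex 0 s + complex_of_real (1 / k))"
    using k c1 c2 by (simp add: complex_eq_iff field_simps)
  then have "(complex_of_real (q / k) * Complex 0 s + complex_of_real (p / k)) /
     (complex_of_real (1 / k) * Complex 0 s + complex_of_real (1 / k)) = Complex x y"
    using nz by (simp only: nonzero_mult_div_cancel_right[OF nz])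
  then show ?thesis using False nz
    by (simp add: axis_point_def real_moebius_cmat s_def[symmetric] k_def[symmetric])
qed

lemma semicircle_geodesic:
  assumes pq: "p < q"
    and a: "p \<le> Re a" "Im a \<ge> 0" "(Im a)\<^sup>2 = (Re a - p) * (q - Re a)"
    and z: "Re a \<le> Re z" "Im z \<ge> 0" "(Im z)\<^sup>2 = (Re z - p) * (q - Re z)"
    and b: "Re z \<le> Re b" "Re b \<le> q" "Im b \<ge> 0" "(Im b)\<^sup>2 = (Re b - p) * (q - Re b)"
  shows "Pt z \<in> geodesic (Pt a) (Pt b)"
proof -
  define f where "f x = (if x = q then \<infinity> else ereal (sqrt ((x - p) / (q - x))))" for x
  have mono: "f x \<le> f x'" if "p \<le> x" "x \<le> x'" "x' \<le> q" for x x'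
    using that by (auto simp: f_def intro!: frac_le)
  have nonneg: "0 \<le> f x" if "p \<le> x" "x \<le> q" for x
    using that by (auto simp: f_def)
  define k where "k = sqrt (q - p)"
  have k: "k * k = q - p" using pq by (simp add: k_def)
  define M where "M = mat2 (q / k) (p / k) (1 / k) (1 / k)"
  have M: "real_moebius M (axis_point (f (Re w))) = Pt w"
    if "p \<le> Re w" "Re w \<le> q" "Im w \<ge> 0" "(Im w)\<^sup>2 = (Re w - p) * (q - Re w)" for w
    using semicircle_point[OF pq that] by (simp add: M_def k_def f_def)
  have detM: "det M = 1"
    using pq k by (simp add: M_def diff_divide_distrib[symmetric])
  show ?thesis unfolding geodesic_def mem_Collect_eq
    by (rule exI[of _ M], rule exI[of _ "f (Re a)"], rule exI[of _ "f (Re z)"], rule exI[of _ "f (Re b)"])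
       (use M[of a] M[of z] M[of b] detM a z b in \<open>auto intro!: mono nonneg\<close>)
qed

text \<open>The arc lies on a circle centred on the real line, and the real part along it increases
  from \<open>Re a\<close> \<le> 0 to \<open>Re b\<close> > 0, so it passes through 0.\<close>

lemma geodesic_crosses_axis:
  assumes a: "Im a \<ge> 0" "Re a \<le> 0" and b: "Im b \<ge> 0" "Re b > 0"
  shows "geodesic (Pt a) (Pt b) \<inter> geodesic (Pt 0) Infty \<noteq> {}"
proof -
  \<comment> \<open>The centre, from equal distance to a and b; \<open>Re b\<close> >
    \<open>Re a\<close> keeps the denominator nonzero.\<close>
  define c where "c = ((Re b)\<^sup>2 + (Im b)\<^sup>2 - (Re a)\<^sup>2 - (Im a)\<^sup>2) / (2 * (Re b - Re a))"
  have c: "2 * (Re b - Re a) * c = (Re b)\<^sup>2 + (Im b)\<^sup>2 - (Re a)\<^sup>2 - (Im a)\<^sup>2"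
    using a b by (simp add: c_def)
  define \<rho> where "\<rho> = sqrt ((Re a - c)\<^sup>2 + (Im a)\<^sup>2)"
  have r2: "\<rho>\<^sup>2 = (Re a - c)\<^sup>2 + (Im a)\<^sup>2" by (simp add: \<rho>_def)
  have r2b: "\<rho>\<^sup>2 = (Re b - c)\<^sup>2 + (Im b)\<^sup>2"
    unfolding r2 using c by (simp add: power2_eq_square algebra_simps)
  have r0: "\<rho> \<ge> 0" by (simp add: \<rho>_def)
  have ra: "\<bar>Re a - c\<bar> \<le> \<rho>" using r2 r0 by (metis abs_le_square_iff abs_of_nonneg le_add_same_cancel1 zero_le_power2)
  have rb: "\<bar>Re b - c\<bar> \<le> \<rho>" using r2b r0 by (metis abs_le_square_iff abs_of_nonneg le_add_same_cancel1 zero_le_power2)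
  define p q where "p = c - \<rho>" and "q = c + \<rho>"
  have pq: "p \<le> Re a" "Re b \<le> q" using ra rb by (auto simp: p_def q_def)
  then have "p \<le> 0" "q > 0" using a b by auto
  then have pq0: "p * q \<le> 0" by (simp add: mult_nonpos_nonneg)
  \<comment> \<open>As 0 lies between the end points p and q of the diameter, the circle has height
    sqrt (- p q) above 0.\<close>
  define z where "z = Complex 0 (sqrt (- (p * q)))"
  have "Pt z \<in> geodesic (Pt a) (Pt b)"
  proof (rule semicircle_geodesic[of p q])
    show "(Im a)\<^sup>2 = (Re a - p) * (q - Re a)" using r2 by (simp add: p_def q_def power2_eq_square algebra_simps)
    show "(Im b)\<^sup>2 = (Re b - p) * (q - Re b)" using r2b by (simp add: p_def q_def power2_eq_square algebra_simps)
    show "(Im z)\<^sup>2 = (Re z - p) * (q - Re z)" using pq0 by (simp add: z_def)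
  qed (use pq pq0 a b in \<open>auto simp: z_def\<close>)
  moreover have "Pt z \<in> geodesic (Pt 0) Infty"
    using pq0 by (auto simp: z_def intro!: imaginary_axis_geodesic)
  ultimately show ?thesis by blast
qed

text \<open>Two frames with the same end points differ by a matrix fixing 0 and \<infinity>, hence a
  diagonal one of determinant 1. It acts by a positive factor, so the side does not depend on the
  frame.\<close>

lemma right_of_frame:
  assumes P: "det P = 1"
  shows "right_of (real_moebius P (Pt 0)) (real_moebius P Infty) (real_moebius P \<zeta>) \<longleftrightarrow>
    (\<exists>z. \<zeta> = Pt z \<and> Re z > 0)" (is "?L \<longleftrightarrow> ?R")
proof
  assume ?L
  then obtain M \<eta> where M: "det M = 1" "real_moebius P (Pt 0) = real_moebius M (Pt 0)"
    "real_moebius P Infty = real_moebius M Infty" "real_moebius P \<zeta> = real_moebius M (Pt \<eta>)" "Re \<eta> > 0"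
    unfolding right_of_def by blast
  define Q where "Q = mat2 (P$2$2) (- P$1$2) (- P$2$1) (P$1$1)"
  define K where "K = Q ** M"
  have K: "det K = 1" using sl2_inverse[OF P] M by (simp add: K_def Q_def det_mul)
  have Kz: "real_moebius K z = real_moebius Q (real_moebius M z)" for z
    using M by (simp add: K_def real_moebius_mult)
  have "real_moebius K (Pt 0) = Pt 0" "real_moebius K Infty = Infty"
    and zeta: "\<zeta> = real_moebius K (Pt \<eta>)"
    using M(2-4)[symmetric] real_moebius_inverse[OF P] by (simp_all add: Kz Q_def)
  then have K0: "K$1$2 = 0" "K$2$1 = 0"
    by (auto simp: real_moebius_cmat split: if_splits)
  with K have Kd: "K$1$1 * K$2$2 = 1" by (simp add: det_2)
  then have nz: "K$2$2 \<noteq> 0" by auto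
  have "K$1$1 / K$2$2 = (K$1$1)\<^sup>2" using Kd nz by (simp add: field_simps power2_eq_square)
  then have pos: "K$1$1 / K$2$2 > 0" using Kd by (metis mult_eq_0_iff zero_less_power2 zero_neq_one)
  have "\<zeta> = Pt (of_real (K$1$1 / K$2$2) * \<eta>)"
    using zeta K0 nz by (simp add: real_moebius_cmat)
  moreover have "Re (of_real (K$1$1 / K$2$2) * \<eta>) > 0"
    using mult_pos_pos[OF pos M(5)] by (simp only: Re_complex_of_real Im_complex_of_real times_complex.sel)
  ultimately show ?R by blast
next
  assume ?R
  then show ?L using P unfolding right_of_def by blast
qed

text \<open>The emptiness test in the definition of the intersection number is redundant, so that
  intersection numbers with a fixed geodesic are differences of the values of a function.\<close>

lemma signed_intersection_eq:
  assumes P: "det P = 1"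
    and ab: "a \<in> closed_half_plane" "b \<in> closed_half_plane"
  defines "w \<equiv> real_moebius P (Pt 0)" and "w' \<equiv> real_moebius P Infty"
  shows "signed_intersection a b w w' = of_bool (right_of w w' b) - of_bool (right_of w w' a)"
proof -
  have *: "geodesic a b \<inter> geodesic w w' \<noteq> {}"
    if ab: "a \<in> closed_half_plane" "b \<in> closed_half_plane" and b: "right_of w w' b" and a: "\<not> right_of w w' a" for a b
  proof -
    define Q where "Q = mat2 (P$2$2) (- P$1$2) (- P$2$1) (P$1$1)"
    have Q: "det Q = 1" using sl2_inverse[OF P] by (simp add: Q_def)
    have PQ: "real_moebius P (real_moebius Q z) = z" for z
      using real_moebius_inverse[OF P] by (simp add: Q_def)
    define a' b' where "a' = real_moebius Q a" and "b' = real_moebius Q b"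
    have ab': "a' \<in> closed_half_plane" "b' \<in> closed_half_plane"
      using ab Q by (auto simp: a'_def b'_def real_moebius_closed_half_plane)
    have "right_of w w' (real_moebius P b')" "\<not> right_of w w' (real_moebius P a')"
      using a b by (auto simp: a'_def b'_def PQ)
    then obtain z where z: "b' = Pt z" "Re z > 0" and na: "\<not> (\<exists>z. a' = Pt z \<and> Re z > 0)"
      using right_of_frame[OF P] by (auto simp: w_def w'_def)
    have "geodesic a' b' \<inter> geodesic (Pt 0) Infty \<noteq> {}"
    \<comment> \<open>The end on the right is finite, since \<open>right_of\<close> asks for a
      coordinate of the form \<open>Pt\<close>. The other end may be \<open>Infty\<close>, which is
      then itself the common point.\<close>
    proof (cases a')
      case (Pt y)
      then show ?thesis using z na ab' geodesic_crosses_axis[of y z] by auto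
    next
      case Infty
      then have "Infty \<in> geodesic a' b'" using z ab' by (auto intro!: geodesic_sym vertical_geodesic)
      then show ?thesis using imaginary_axis_geodesic by blast
    qed
    then obtain y where "y \<in> geodesic a' b'" "y \<in> geodesic (Pt 0) Infty" by blast
    then have "real_moebius P y \<in> geodesic a b" "real_moebius P y \<in> geodesic w w'"
      using geodesic_moebius[OF P] by (metis PQ a'_def b'_def, metis w_def w'_def)
    then show ?thesis by blast
  qed
  have "geodesic a b \<inter> geodesic w w' \<noteq> {}" if "right_of w w' b \<noteq> right_of w w' a"
    using that *[OF ab] *[OF ab(2,1)] geodesic_sym by blast
  then show ?thesis unfolding signed_intersection_def by auto
qed

text \<open>If N / D is the coordinate of z in the frame \<open>P\<close>, this is the real part of
  N times the conjugate of D, that is |D|^2 Re (N / D). Written A|z|^2 + B Re z + C it has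
  discriminant (det P)^2; at \<open>Infty\<close> the leading coefficient remains.\<close>

fun axis_form :: "real^2^2 \<Rightarrow> complex proj_line \<Rightarrow> real" where
  "axis_form P (Pt z) = - (P$2$1 * P$2$2) * (cmod z)\<^sup>2 + (P$1$1 * P$2$2 + P$1$2 * P$2$1) * Re z - P$1$1 * P$1$2"
| "axis_form P Infty = - (P$2$1 * P$2$2)"

text \<open>The factor |D|^2 is positive except at D = 0. There z is the end point w', which counts
  as left, and the form vanishes.\<close>

lemma right_of_iff_axis_form:
  assumes P: "det P = 1"
  shows "right_of (real_moebius P (Pt 0)) (real_moebius P Infty) z \<longleftrightarrow> axis_form P z > 0"
proof -
  define Q where "Q = mat2 (P$2$2) (- P$1$2) (- P$2$1) (P$1$1)"
  have PQ: "real_moebius P (real_moebius Q z) = z" for z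
    using real_moebius_inverse[OF P] by (simp add: Q_def)
  have "right_of (real_moebius P (Pt 0)) (real_moebius P Infty) z \<longleftrightarrow>
     (\<exists>y. real_moebius Q z = Pt y \<and> Re y > 0)"
    using right_of_frame[OF P, of "real_moebius Q z"] by (simp add: PQ)
  also have "\<dots> \<longleftrightarrow> axis_form P z > 0"
  proof (cases z)
    case Infty
    show ?thesis
    proof (cases "P$2$1 = 0")
      case False
      have "Re (complex_of_real (P$2$2) / - complex_of_real (P$2$1)) = - (P$2$2 / P$2$1)"
        by (simp add: Re_divide power2_eq_square)
      then show ?thesis using Infty False
        by (auto simp: Q_def real_moebius_cmat divide_less_0_iff mult_less_0_iff)
    qed (use Infty in \<open>auto simp: Q_def real_moebius_cmat\<close>)
  next
    case (Pt y)
    define D where "D = complex_of_real (P$1$1) - complex_of_real (P$2$1) * y"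
    define N where "N = complex_of_real (P$2$2) * y - complex_of_real (P$1$2)"
    have *: "axis_form P z = Re N * Re D + Im N * Im D"
      by (simp add: Pt D_def N_def cmod_power2) (simp add: power2_eq_square algebra_simps)
    have m: "real_moebius Q z = (if D = 0 then Infty else Pt (N / D))"
      by (auto simp: Pt Q_def real_moebius_cmat D_def N_def algebra_simps)
    show ?thesis
    proof (cases "D = 0")
      case False
      then have "(cmod D)\<^sup>2 > 0" by simp
      then show ?thesis using False by (simp add: m * Re_divide zero_less_divide_iff cmod_power2)
    qed (simp add: m *)
  qed
  finally show ?thesis .
qed

section \<open>Ring homomorphisms\<close>

context
  fixes f :: "'a::ring_1 \<Rightarrow> 'b::ring_1"
  assumes f: "is_ring_hom f"
begin

lemma ring_hom_one: "f 1 = 1" and ring_hom_add: "f (x + y) = f x + f y"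
  and ring_hom_mult: "f (x * y) = f x * f y"
  using f by (auto simp: is_ring_hom_def)

lemma ring_hom_additive: "Modules.additive f"
  by unfold_locales (rule ring_hom_add)

lemmas ring_hom_zero = additive.zero[OF ring_hom_additive]
  and ring_hom_diff = additive.diff[OF ring_hom_additive]
  and ring_hom_minus = additive.minus[OF ring_hom_additive]
  and ring_hom_sum = additive.sum[OF ring_hom_additive]

lemma ring_hom_of_nat: "f (of_nat n) = of_nat n"
  by (induction n) (simp_all add: ring_hom_zero ring_hom_one ring_hom_add)

lemma ring_hom_of_int: "f (of_int n) = of_int n"
  by (cases n rule: int_diff_cases) (simp add: ring_hom_diff ring_hom_of_nat)

lemma ring_hom_power: "f (x ^ n) = f x ^ n"
  by (induction n) (simp_all add: ring_hom_one ring_hom_mult)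

end

lemma ring_hom_eq_0_iff:
  fixes f :: "'a::field \<Rightarrow> 'b::ring_1"
  assumes "is_ring_hom f"
  shows "f x = 0 \<longleftrightarrow> x = 0"
proof
  assume "f x = 0"
  show "x = 0"
  proof (rule ccontr)
    assume "x \<noteq> 0"
    then have "f 1 = f x * f (inverse x)" using ring_hom_mult[OF assms, of x "inverse x"] by simp
    then show False using \<open>f x = 0\<close> ring_hom_one[OF assms] by simp
  qed
qed (simp add: ring_hom_zero[OF assms])

lemma ring_hom_eq_iff:
  fixes f :: "'a::field \<Rightarrow> 'b::ring_1"
  assumes "is_ring_hom f"
  shows "f x = f y \<longleftrightarrow> x = y"
  using ring_hom_eq_0_iff[OF assms, of "x - y"] by (simp add: ring_hom_diff[OF assms])

lemma ring_hom_of_rat: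
  fixes f :: "'a::field_char_0 \<Rightarrow> 'b::field_char_0"
  assumes "is_ring_hom f"
  shows "f (of_rat r) = of_rat r"
proof (cases r)
  case (Fract a b)
  have "f (of_rat r) * of_int b = f (of_rat r * of_int b)"
    by (simp add: ring_hom_mult[OF assms] ring_hom_of_int[OF assms])
  also have "of_rat r * (of_int b :: 'a) = of_int a"
    using Fract by (simp add: of_rat_rat)
  finally show ?thesis using Fract by (simp add: of_rat_rat ring_hom_of_int[OF assms] field_simps)
qed

section \<open>Almost integral elements\<close>

text \<open>The subgroup generated by \<open>T\<close>. Induction on membership replaces explicit
  integer combinations and reduces bilinear statements to generators.\<close>

inductive_set int_span :: "'a::ab_group_add set \<Rightarrow> 'a set" for T where
  int_span_zero: "0 \<in> int_span T"
| int_span_base: "t \<in> T \<Longrightarrow> t \<in> int_span T"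
| int_span_diff: "x \<in> int_span T \<Longrightarrow> y \<in> int_span T \<Longrightarrow> x - y \<in> int_span T"

lemma int_span_minus: "x \<in> int_span T \<Longrightarrow> - x \<in> int_span T"
  using int_span_diff[OF int_span_zero, of x T] by simp

lemma int_span_add: "x \<in> int_span T \<Longrightarrow> y \<in> int_span T \<Longrightarrow> x + y \<in> int_span T"
  using int_span_diff[of x T "- y"] int_span_minus[of y T] by simp

lemma int_span_sum: "(\<And>i. i \<in> A \<Longrightarrow> g i \<in> int_span T) \<Longrightarrow> (\<Sum>i\<in>A. g i) \<in> int_span T"
  by (induction A rule: infinite_finite_induct) (simp_all add: int_span_zero int_span_add)

lemma int_span_of_nat_mult:
  fixes x :: "'a::ring_1"
  shows "x \<in> int_span T \<Longrightarrow> of_nat n * x \<in> int_span T"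
  by (induction n) (simp_all add: int_span_zero int_span_add distrib_right)

lemma int_span_of_int_mult:
  fixes x :: "'a::ring_1"
  assumes "x \<in> int_span T"
  shows "of_int n * x \<in> int_span T"
  by (cases n rule: int_diff_cases)
     (simp add: left_diff_distrib int_span_diff int_span_of_nat_mult assms)

lemma int_span_mult:
  fixes x :: "'a::ring_1"
  assumes "x \<in> int_span T" "y \<in> int_span S"
  shows "x * y \<in> int_span {t * s | t s. t \<in> T \<and> s \<in> S}"
  using assms(1)
proof induction
  case (int_span_base t)
  from assms(2) show ?case
  proof induction
    case (int_span_base s)
    then show ?case using \<open>t \<in> T\<close> by (intro int_span.int_span_base) auto
  qed (auto simp: int_span_zero right_diff_distrib intro: int_span_diff)
qed (auto simp: int_span_zero left_diff_distrib intro: int_span_diff)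

text \<open>All powers lie in one finitely generated group. This form of integrality passes to sums
  and products by multiplying generating sets pairwise, without an equation for the sum or
  product.\<close>

definition almost_integral :: "'a::comm_ring_1 \<Rightarrow> bool" where
  "almost_integral x \<longleftrightarrow> (\<exists>T. finite T \<and> (\<forall>k. x ^ k \<in> int_span T))"

lemma almost_integral_mult:
  assumes "almost_integral x" "almost_integral y"
  shows "almost_integral (x * y)"
proof -
  from assms obtain T S where *: "finite T" "finite S" "\<And>k. x ^ k \<in> int_span T" "\<And>k. y ^ k \<in> int_span S"
    unfolding almost_integral_def by blast
  have "finite {t * s | t s. t \<in> T \<and> s \<in> S}" using * by (intro finite_image_set2) auto
  moreover have "(x * y) ^ k \<in> int_span {t * s | t s. t \<in> T \<and> s \<in> S}" for k
    unfolding power_mult_distrib using * by (intro int_span_mult)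
  ultimately show ?thesis unfolding almost_integral_def by blast
qed

lemma almost_integral_add:
  assumes "almost_integral x" "almost_integral y"
  shows "almost_integral (x + y)"
proof -
  from assms obtain T S where *: "finite T" "finite S" "\<And>k. x ^ k \<in> int_span T" "\<And>k. y ^ k \<in> int_span S"
    unfolding almost_integral_def by blast
  have "finite {t * s | t s. t \<in> T \<and> s \<in> S}" using * by (intro finite_image_set2) auto
  moreover have "(x + y) ^ k \<in> int_span {t * s | t s. t \<in> T \<and> s \<in> S}" for k
    unfolding binomial_ring mult.assoc using *
    by (intro int_span_sum int_span_of_nat_mult int_span_mult)
  ultimately show ?thesis unfolding almost_integral_def by blast
qed

lemma almost_integral_of_int: "almost_integral (of_int n :: 'a::comm_ring_1)"
proof -
  have "(of_int n :: 'a) ^ k \<in> int_span {1}" for k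
    using int_span_of_int_mult[of 1 "{1::'a}" "n ^ k"] by (simp add: int_span_base)
  then show ?thesis unfolding almost_integral_def by blast
qed

lemma almost_integral_minus: "almost_integral x \<Longrightarrow> almost_integral (- x)"
  using almost_integral_mult[OF almost_integral_of_int[of "-1"], of x] by simp

lemma almost_integral_diff: "almost_integral x \<Longrightarrow> almost_integral y \<Longrightarrow> almost_integral (x - y)"
  using almost_integral_add[of x "- y"] almost_integral_minus[of y] by simp

lemma almost_integral_sum:
  "(\<And>i. i \<in> A \<Longrightarrow> almost_integral (g i)) \<Longrightarrow> almost_integral (\<Sum>i\<in>A. g i)"
  by (induction A rule: infinite_finite_induct)
     (use almost_integral_of_int[of 0] in \<open>simp_all add: almost_integral_add\<close>)

text \<open>The monic relation rewrites x^k with k \<ge> d through exponents i + (k - d) < k, so the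
  first d powers generate all of them.\<close>

lemma almost_integral_power_span:
  assumes d: "x ^ d = (\<Sum>i<d. of_int (c i) * x ^ i)"
  shows "almost_integral x"
proof -
  define T where "T = (\<lambda>i. x ^ i) ` {..<d}"
  have "x ^ k \<in> int_span T" for k
  proof (induction k rule: less_induct)
    case (less k)
    show ?case
    proof (cases "k < d")
      case True
      then show ?thesis by (auto simp: T_def intro: int_span_base)
    next
      case False
      then have "x ^ k = x ^ d * x ^ (k - d)" by (simp add: power_add[symmetric])
      also have "\<dots> = (\<Sum>i<d. of_int (c i) * x ^ (i + (k - d)))"
        by (simp add: d sum_distrib_right power_add mult.assoc)
      also have "\<dots> \<in> int_span T"
        using False by (intro int_span_sum int_span_of_int_mult less.IH) auto
      finally show ?thesis .
    qed
  qed
  moreover have "finite T" by (simp add: T_def)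
  ultimately show ?thesis unfolding almost_integral_def by blast
qed

lemma algebraic_int_imp_almost_integral:
  fixes x :: "'a::field_char_0"
  assumes "algebraic_int x"
  shows "almost_integral x"
proof -
  obtain p where p: "poly (map_poly of_int p) x = 0" "lead_coeff p = 1"
    using assms unfolding algebraic_int_altdef_ipoly by blast
  have "x ^ Polynomial.degree p = (\<Sum>i<Polynomial.degree p. of_int (- poly.coeff p i) * x ^ i)"
    using p by (simp add: poly_altdef degree_map_poly coeff_map_poly lessThan_Suc_atMost[symmetric]
        eq_neg_iff_add_eq_0 sum_negf add.commute)
  then show ?thesis by (rule almost_integral_power_span)
qed

text \<open>Multiplying the equation of y by the (d - 1)-st power of its leading coefficient N makes
  it monic in N y.\<close>

lemma algebraic_imp_almost_integral_multiple:
  fixes y :: "'a::field_char_0"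
  assumes "algebraic y"
  obtains N :: int where "N \<noteq> 0" "almost_integral (of_int N * y)"
proof -
  obtain p where p: "p \<noteq> 0" "poly (map_poly of_int p) y = 0" using algebraicE'[OF assms] by blast
  define d N where "d = Polynomial.degree p" and "N = lead_coeff p"
  have N: "N \<noteq> 0" using p by (simp add: N_def)
  have d: "d \<noteq> 0"
  proof
    assume "d = 0"
    then obtain a where "p = [:a:]" by (metis d_def degree_eq_zeroE)
    then show False using p by (simp add: map_poly_pCons)
  qed
  have 0: "of_int N * y ^ d = - (\<Sum>i<d. of_int (poly.coeff p i) * y ^ i)"
    using p(2) by (simp add: poly_altdef degree_map_poly coeff_map_poly lessThan_Suc_atMost[symmetric]
        eq_neg_iff_add_eq_0 add.commute d_def N_def)
  have "(of_int N * y) ^ d = of_int N ^ (d - 1) * (of_int N * y ^ d)"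
    using d by (cases d) (simp_all add: power_mult_distrib algebra_simps)
  also have "\<dots> = (\<Sum>i<d. of_int (- poly.coeff p i * N ^ (d - 1 - i)) * (of_int N * y) ^ i)"
    unfolding 0 mult_minus_right sum_distrib_left sum_negf[symmetric]
  proof (rule sum.cong[OF refl])
    fix i assume "i \<in> {..<d}"
    then have "d - 1 = (d - 1 - i) + i" by auto
    then have "(of_int N :: 'a) ^ (d - 1) = of_int N ^ (d - 1 - i) * of_int N ^ i"
      by (metis power_add)
    then show "- (of_int N ^ (d - 1) * (of_int (poly.coeff p i) * y ^ i)) =
        of_int (- poly.coeff p i * N ^ (d - 1 - i)) * (of_int N * y) ^ i"
      by (simp add: power_mult_distrib)
  qed
  finally show ?thesis by (rule that[OF N almost_integral_power_span])
qed

section \<open>Additive functions on a number field\<close>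

text \<open>The operator z - \<zeta> on functions from F to \<complex>, where z acts by sending f to
  the function t \<mapsto> f (z t). Its kernel consists of the eigenfunctions for \<zeta>.\<close>

definition twist :: "'f::field \<Rightarrow> complex \<Rightarrow> ('f \<Rightarrow> complex) \<Rightarrow> 'f \<Rightarrow> complex" where
  "twist z \<zeta> f = (\<lambda>t. f (z * t) - \<zeta> * f t)"

lemma additive_of_nat_mult: "Modules.additive f \<Longrightarrow> f (of_nat n * x) = of_nat n * f x"
  by (induction n) (simp_all add: additive.zero additive.add distrib_right)

lemma additive_of_int_mult: "Modules.additive f \<Longrightarrow> f (of_int n * x) = of_int n * f x"
  by (cases n rule: int_diff_cases)
     (simp add: left_diff_distrib additive.diff additive_of_nat_mult)

lemma additive_of_rat_mult:
  fixes x :: "'f::field_char_0"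
  assumes "Modules.additive f"
  shows "f (of_rat r * x) = of_rat r * f x"
proof (cases r)
  case (Fract a b)
  have "of_int b * f (of_rat r * x) = f (of_int b * (of_rat r * x))"
    by (simp add: additive_of_int_mult[OF assms])
  also have "of_int b * (of_rat r * x) = of_int a * x"
    using Fract by (simp add: of_rat_rat)
  also have "f (of_int a * x) = of_int a * f x" by (rule additive_of_int_mult[OF assms])
  finally show ?thesis using Fract by (simp add: of_rat_rat field_simps)
qed

lemma additive_twist: "Modules.additive f \<Longrightarrow> Modules.additive (twist z \<zeta> f)"
  by (simp add: Modules.additive_def twist_def algebra_simps)

lemma additive_fold_twist: "Modules.additive f \<Longrightarrow> Modules.additive (fold (twist z) zs f)"
  by (induction zs arbitrary: f) (simp_all add: additive_twist)

text \<open>Twists by the same z are linear factors of a polynomial in one operator; peeling off a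
  factor shifts the coefficients by one.\<close>

lemma fold_twist_eq_poly:
  "fold (twist z) zs f t =
     (\<Sum>k\<le>length zs. poly.coeff (\<Prod>\<zeta>\<leftarrow>zs. [:- \<zeta>, 1:]) k * f (z ^ k * t))"
proof (induction zs arbitrary: f)
  case (Cons \<zeta> zs)
  define q where "q = (\<Prod>\<zeta>\<leftarrow>zs. [:- \<zeta>, 1:])"
  define n where "n = length zs"
  have "Polynomial.degree q \<le> n"
    unfolding q_def n_def by (induction zs) (auto intro!: degree_diff_le order.trans[OF degree_pCons_le] order.trans[OF degree_smult_le])
  \<comment> \<open>The coefficient of degree n + 1 is 0, so the unshifted sum may stop at
    n.\<close>
  then have q0: "poly.coeff q (Suc n) = 0" by (simp add: coeff_eq_0)
  have c: "poly.coeff ([:- \<zeta>, 1:] * q) k = poly.coeff (pCons 0 q) k - \<zeta> * poly.coeff q k" for k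
    by simp
  have "(\<Sum>k\<le>Suc n. poly.coeff ([:- \<zeta>, 1:] * q) k * f (z ^ k * t)) =
    (\<Sum>k\<le>Suc n. poly.coeff (pCons 0 q) k * f (z ^ k * t)) - (\<Sum>k\<le>Suc n. \<zeta> * poly.coeff q k * f (z ^ k * t))"
    unfolding c by (simp only: left_diff_distrib sum_subtractf)
  also have "(\<Sum>k\<le>Suc n. poly.coeff (pCons 0 q) k * f (z ^ k * t)) = (\<Sum>k\<le>n. poly.coeff q k * f (z ^ Suc k * t))"
    by (subst sum.atMost_Suc_shift) simp
  also have "(\<Sum>k\<le>Suc n. \<zeta> * poly.coeff q k * f (z ^ k * t)) = (\<Sum>k\<le>n. \<zeta> * poly.coeff q k * f (z ^ k * t))"
    using q0 by simp
  also have "(\<Sum>k\<le>n. poly.coeff q k * f (z ^ Suc k * t)) - (\<Sum>k\<le>n. \<zeta> * poly.coeff q k * f (z ^ k * t)) =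
    (\<Sum>k\<le>n. poly.coeff q k * twist z \<zeta> f (z ^ k * t))"
    by (simp add: twist_def sum_subtractf[symmetric] algebra_simps)
  also have "\<dots> = fold (twist z) zs (twist z \<zeta> f) t"
    by (simp add: Cons.IH q_def n_def)
  finally show ?case by (simp add: q_def n_def)
qed simp

text \<open>An integer polynomial vanishing at z, evaluated at the operator z, kills every additive
  function; over \<complex> it is a product of twists. Only a multiset of roots is recorded, because
  their order is chosen later.\<close>

lemma annihilating_twists:
  fixes z :: "'f::field_char_0"
  assumes "algebraic z"
  obtains A :: "complex multiset" where
    "\<And>zs (f :: 'f \<Rightarrow> complex). mset zs = A \<Longrightarrow> Modules.additive f \<Longrightarrow> fold (twist z) zs f = (\<lambda>_. 0)"
proof -
  obtain p where p: "p \<noteq> 0" "poly (map_poly of_int p) z = 0" using algebraicE'[OF assms] by blast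
  define P :: "complex poly" where "P = map_poly of_int p"
  have P: "P \<noteq> 0" "Polynomial.degree P = Polynomial.degree p" using p by (auto simp: P_def map_poly_eq_0_iff degree_map_poly)
  obtain A where A: "size A = Polynomial.degree P" "P = Polynomial.smult (lead_coeff P) (\<Prod>x\<in>#A. [:- x, 1:])"
    using alg_closed_imp_factorization[OF P(1)] by blast
  show ?thesis
  proof (rule that[of A], rule ext)
    fix zs t and f :: "'f \<Rightarrow> complex" assume zs: "mset zs = A" and f: "Modules.additive f"
    have Q: "(\<Prod>\<zeta>\<leftarrow>zs. [:- \<zeta>, 1:]) = (\<Prod>x\<in>#A. [:- x, 1:])"
      by (simp add: zs[symmetric] prod_mset_prod_list[symmetric])
    have len: "length zs = Polynomial.degree p" using A(1) P zs by (metis size_mset)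
    have "lead_coeff P * fold (twist z) zs f t = (\<Sum>k\<le>Polynomial.degree p. poly.coeff P k * f (z ^ k * t))"
      unfolding fold_twist_eq_poly Q len
      by (subst (2) A(2)) (simp add: sum_distrib_left mult.assoc)
    also have "\<dots> = f (\<Sum>k\<le>Polynomial.degree p. of_int (poly.coeff p k) * (z ^ k * t))"
      by (simp add: P_def coeff_map_poly additive.sum[OF f] additive_of_int_mult[OF f])
    also have "(\<Sum>k\<le>Polynomial.degree p. of_int (poly.coeff p k) * (z ^ k * t)) = poly (map_poly of_int p) z * t"
      by (simp add: poly_altdef sum_distrib_right degree_map_poly coeff_map_poly mult.assoc)
    finally show "fold (twist z) zs f t = 0" using p P leading_coeff_neq_0[OF P(1)] by (simp add: additive.zero[OF f])
  qed
qed

text \<open>Just before a composite first becomes zero, a nonzero function is killed by a single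
  operator: this is the source of eigenfunctions.\<close>

lemma fold_first_zero:
  assumes "f \<noteq> (\<lambda>_. 0)" "fold op zs f = (\<lambda>_. 0)"
  obtains xs \<zeta> ys where "zs = xs @ \<zeta> # ys" "fold op xs f \<noteq> (\<lambda>_. 0)" "op \<zeta> (fold op xs f) = (\<lambda>_. 0)"
  using assms
proof (induction zs arbitrary: f thesis)
  case (Cons \<zeta> zs)
  show ?case
  proof (cases "op \<zeta> f = (\<lambda>_. 0)")
    case True
    then show ?thesis using Cons.prems(1)[of "[]" \<zeta> zs] Cons.prems(2) by simp
  next
    case False
    from Cons.prems(3) have "fold op zs (op \<zeta> f) = (\<lambda>_. 0)" by simp
    with False obtain xs \<zeta>' ys where *: "zs = xs @ \<zeta>' # ys" "fold op xs (op \<zeta> f) \<noteq> (\<lambda>_. 0)"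
      "op \<zeta>' (fold op xs (op \<zeta> f)) = (\<lambda>_. 0)"
      using Cons.IH[of "op \<zeta> f"] by blast
    show ?thesis by (rule Cons.prems(1)[of "\<zeta> # xs" \<zeta>' ys]) (use * in auto)
  qed
qed simp

text \<open>Multiplications commute. Twisting by \<open>y\<close> until just before zero therefore
  yields an eigenfunction of \<open>y\<close> and preserves the eigenvalue relations already
  obtained.\<close>

lemma simultaneous_eigenfunction:
  fixes f :: "'f::field_char_0 \<Rightarrow> complex"
  assumes alg: "\<And>y::'f. algebraic y" and T: "finite T"
    and f: "Modules.additive f" "f \<noteq> (\<lambda>_. 0)" "\<And>t. f (z * t) = \<zeta> * f t"
  shows "\<exists>g. Modules.additive g \<and> g \<noteq> (\<lambda>_. 0) \<and> (\<forall>t. g (z * t) = \<zeta> * g t) \<and>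
    (\<forall>y\<in>T. \<exists>l. \<forall>t. g (y * t) = l * g t)"
  using T
proof (induction T)
  case empty
  then show ?case using f by auto
next
  case (insert y T)
  then obtain g where g: "Modules.additive g" "g \<noteq> (\<lambda>_. 0)" "\<And>t. g (z * t) = \<zeta> * g t"
    "\<And>y. y \<in> T \<Longrightarrow> \<exists>l. \<forall>t. g (y * t) = l * g t" by blast
  obtain A :: "complex multiset" where
    A: "\<And>zs (f :: 'f \<Rightarrow> complex). mset zs = A \<Longrightarrow> Modules.additive f \<Longrightarrow> fold (twist y) zs f = (\<lambda>_. 0)"
    using annihilating_twists[OF alg[of y]] by blast
  obtain zs where "mset zs = A" using ex_mset by blast
  then have "fold (twist y) zs g = (\<lambda>_. 0)" using A g(1) by blast
  then obtain xs \<mu> where h: "fold (twist y) xs g \<noteq> (\<lambda>_. 0)" "twist y \<mu> (fold (twist y) xs g) = (\<lambda>_. 0)"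
    using fold_first_zero[OF g(2)] by blast
  define h where "h = fold (twist y) xs g"
  have pres: "fold (twist y) xs g' (x * t) = c * fold (twist y) xs g' t"
    if "\<And>t. g' (x * t) = c * g' t" for x c t and g' :: "'f \<Rightarrow> complex"
    using that
  proof (induction xs arbitrary: g')
    case (Cons a xs)
    have "twist y a g' (x * t) = c * twist y a g' t" for t
      using Cons.prems[of "y * t"] Cons.prems[of t] by (simp add: twist_def algebra_simps)
    then show ?case using Cons.IH[of "twist y a g'"] by simp
  qed simp
  have "h (y * t) = \<mu> * h t" for t
    using fun_cong[OF h(2), of t] by (simp add: twist_def h_def)
  moreover have "\<exists>l. \<forall>t. h (x * t) = l * h t" if "x \<in> T" for x
    using g(4)[OF that] pres unfolding h_def by blast
  moreover have "h (z * t) = \<zeta> * h t" for t unfolding h_def using g(3) by (intro pres)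
  moreover have "Modules.additive h" unfolding h_def by (intro additive_fold_twist g)
  ultimately show ?case using h(1) unfolding h_def by blast
qed

section \<open>Number fields as finite-dimensional rational vector spaces\<close>

lemma number_field_span:
  assumes "is_number_field TYPE('f::field_char_0)"
  obtains T :: "'f::field_char_0 set" where "finite T"
    "\<And>x. \<exists>U c. U \<subseteq> T \<and> x = (\<Sum>t\<in>U. of_rat (c t) * t)"
proof -
  obtain T :: "'f set" where T: "finite T" "span_over \<rat> (*) T = UNIV"
    using assms unfolding is_number_field_def by blast
  show ?thesis
  proof (rule that[OF T(1)])
    fix x
    have "x \<in> span_over \<rat> (*) T" using T by simp
    then obtain U c where U: "finite U" "U \<subseteq> T" "c ` U \<subseteq> \<rat>" "x = (\<Sum>t\<in>U. c t * t)"
      unfolding span_over_def by auto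
    have "\<forall>t\<in>U. \<exists>r. c t = of_rat r" using U(3) by (auto elim!: Rats_cases)
    then obtain r where "\<forall>t\<in>U. c t = of_rat (r t)" by metis
    then show "\<exists>U c. U \<subseteq> T \<and> x = (\<Sum>t\<in>U. of_rat (c t) * t)" using U by (intro exI[of _ U] exI[of _ r]) auto
  qed
qed

interpretation rat_vec: vector_space "\<lambda>r x. of_rat r * x :: 'f::field_char_0"
  by unfold_locales (simp_all add: of_rat_add of_rat_mult algebra_simps)

lemma number_field_basis:
  assumes "is_number_field TYPE('f::field_char_0)"
  obtains B :: "'f::field_char_0 set" where "finite B" "rat_vec.independent B" "rat_vec.span B = UNIV"
proof -
  obtain T :: "'f set" where T: "finite T" "\<And>x. \<exists>U c. U \<subseteq> T \<and> x = (\<Sum>t\<in>U. of_rat (c t) * t)"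
    using number_field_span[OF assms] by blast
  have "x \<in> rat_vec.span T" for x
  proof -
    obtain U c where "U \<subseteq> T" "x = (\<Sum>t\<in>U. of_rat (c t) * t)" using T(2) by blast
    then show ?thesis
      using rat_vec.span_sum[of U "\<lambda>t. of_rat (c t) * t" T]
      by (metis rat_vec.span_base rat_vec.span_scale subsetD)
  qed
  then have sT: "rat_vec.span T = UNIV" by auto
  obtain B where B: "B \<subseteq> T" "rat_vec.independent B" "T \<subseteq> rat_vec.span B"
    by (rule rat_vec.maximal_independent_subset)
  have "rat_vec.span T \<subseteq> rat_vec.span B" using B(3) by (rule rat_vec.span_minimal) simp
  then have "rat_vec.span B = UNIV" using sT by auto
  then show ?thesis using that[of B] B(1,2) finite_subset[OF B(1) T(1)] by blast
qed

lemma number_field_algebraic: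
  assumes "is_number_field TYPE('f::field_char_0)"
  shows "algebraic (y :: 'f)"
proof -
  obtain B :: "'f set" where B: "finite B" "rat_vec.independent B" "rat_vec.span B = UNIV"
    using number_field_basis[OF assms] .
  define n where "n = card B"
  show ?thesis
  \<comment> \<open>If two powers agree, X^j - X^i vanishes at y. Otherwise there are n + 1 distinct
    powers in dimension n, and these are dependent.\<close>
  proof (cases "inj_on (\<lambda>k. y ^ k) {..n}")
    case False
    then obtain i j where "i < j" "y ^ i = y ^ j" unfolding inj_on_def by (metis linorder_neqE_nat)
    then show ?thesis
      by (intro algebraicI[of "Polynomial.monom 1 j - Polynomial.monom 1 i"])
         (auto simp: poly_monom coeff_diff dest!: arg_cong[where f = "\<lambda>p. poly.coeff p j"])
  next
    case True
    define S where "S = (\<lambda>k. y ^ k) ` {..n}"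
    have "card S = Suc n" using True by (simp add: S_def card_image)
    then have "rat_vec.dependent S"
      using rat_vec.independent_span_bound[OF B(1), of S] B(3) by (auto simp: n_def)
    moreover have "finite S" by (simp add: S_def)
    ultimately obtain u v where u: "v \<in> S" "u v \<noteq> 0" "(\<Sum>v\<in>S. of_rat (u v) * v) = 0"
      unfolding rat_vec.dependent_finite[OF \<open>finite S\<close>] by blast
    define p where "p = (\<Sum>k\<le>n. Polynomial.monom (of_rat (u (y ^ k)) :: 'f) k)"
    have cp: "poly.coeff p k = (if k \<le> n then of_rat (u (y ^ k)) else 0)" for k
      by (simp add: p_def coeff_sum)
    obtain k where "v = y ^ k" "k \<le> n" using u(1) by (auto simp: S_def)
    then have "poly.coeff p k \<noteq> 0" using u(2) by (simp add: cp)
    then have "p \<noteq> 0" by auto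
    moreover have "poly p y = (\<Sum>v\<in>S. of_rat (u v) * v)"
      unfolding S_def by (subst sum.reindex[OF True]) (simp add: p_def poly_sum poly_monom)
    ultimately show ?thesis using u(3) by (intro algebraicI'[of p]) (auto simp: cp)
  qed
qed

section \<open>Embeddings as eigenvalue characters\<close>

text \<open>A common eigenfunction for rational generators is one for every multiplication, and
  sending x to its eigenvalue is a ring homomorphism. So every eigenvalue of z is a conjugate of
  z.\<close>

lemma eigenvalue_embedding:
  fixes f :: "'f::field_char_0 \<Rightarrow> complex"
  assumes nf: "is_number_field TYPE('f)"
    and f: "Modules.additive f" "f \<noteq> (\<lambda>_. 0)" "\<And>t. f (z * t) = \<zeta> * f t"
  obtains \<sigma> :: "'f \<Rightarrow> complex" where "is_ring_hom \<sigma>" "\<sigma> z = \<zeta>"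
proof -
  obtain T :: "'f set" where T: "finite T" "\<And>x. \<exists>U c. U \<subseteq> T \<and> x = (\<Sum>t\<in>U. of_rat (c t) * t)"
    using number_field_span[OF nf] by blast
  obtain g where g: "Modules.additive g" "g \<noteq> (\<lambda>_. 0)" "\<And>t. g (z * t) = \<zeta> * g t"
    "\<And>y. y \<in> T \<Longrightarrow> \<exists>l. \<forall>t. g (y * t) = l * g t"
    using simultaneous_eigenfunction[OF number_field_algebraic[OF nf] T(1) f] by blast
  obtain l where l: "\<And>y t. y \<in> T \<Longrightarrow> g (y * t) = l y * g t" using g(4) by metis
  have eig: "\<exists>c. \<forall>t. g (x * t) = c * g t" for x
  proof -
    obtain U c where U: "U \<subseteq> T" "x = (\<Sum>s\<in>U. of_rat (c s) * s)" using T(2) by blast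
    have "g (x * t) = (\<Sum>s\<in>U. of_rat (c s) * l s) * g t" for t
    proof -
      have "g (x * t) = (\<Sum>s\<in>U. of_rat (c s) * g (s * t))"
        by (simp add: U(2) sum_distrib_right additive.sum[OF g(1)] mult.assoc
            additive_of_rat_mult[OF g(1)])
      also have "\<dots> = (\<Sum>s\<in>U. of_rat (c s) * l s) * g t"
        unfolding sum_distrib_right using l U(1) by (intro sum.cong) (auto simp: mult.assoc)
      finally show ?thesis .
    qed
    then show ?thesis by blast
  qed
  then obtain \<sigma> where \<sigma>: "\<And>x t. g (x * t) = \<sigma> x * g t" by metis
  have g1: "g 1 \<noteq> 0"
  proof
    assume "g 1 = 0"
    then have "g = (\<lambda>_. 0)" using \<sigma>[of _ 1] by auto
    then show False using g(2) by simp
  qed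
  have s: "\<sigma> x = g x / g 1" for x using \<sigma>[of x 1] g1 by simp
  have "is_ring_hom \<sigma>" unfolding is_ring_hom_def
    using g1 \<sigma> by (auto simp: s additive.add[OF g(1)] add_divide_distrib)
  moreover have "\<sigma> z = \<zeta>" using g(3)[of 1] g1 by (simp add: s)
  ultimately show ?thesis by (rule that)
qed

lemma recurrence_tendsto_zero:
  fixes s :: "nat \<Rightarrow> complex"
  assumes \<zeta>: "cmod \<zeta> < 1" and e: "(\<lambda>k. s (Suc k) - \<zeta> * s k) \<longlonglongrightarrow> 0"
  shows "s \<longlonglongrightarrow> 0"
proof (rule LIMSEQ_I)
  fix r :: real assume r: "r > 0"
  \<comment> \<open>Chosen so that \<open>r / 2\<close> is the fixed point of x \<mapsto> |\<zeta>|
    x + d.\<close>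
  define d where "d = r * (1 - cmod \<zeta>) / 2"
  have d: "d > 0" using r \<zeta> by (simp add: d_def)
  obtain N where N: "\<And>k. k \<ge> N \<Longrightarrow> cmod (s (Suc k) - \<zeta> * s k) < d"
    using LIMSEQ_D[OF e d] by auto
  have step: "cmod (s (N + k)) \<le> cmod \<zeta> ^ k * cmod (s N) + r / 2" for k
  proof (induction k)
    case (Suc k)
    have "s (N + Suc k) = \<zeta> * s (N + k) + (s (Suc (N + k)) - \<zeta> * s (N + k))" by simp
    then have "cmod (s (N + Suc k)) \<le> cmod \<zeta> * cmod (s (N + k)) + cmod (s (Suc (N + k)) - \<zeta> * s (N + k))"
      by (metis norm_mult norm_triangle_ineq)
    also have "\<dots> \<le> cmod \<zeta> * (cmod \<zeta> ^ k * cmod (s N) + r / 2) + d"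
      using N[of "N + k"] Suc by (intro add_mono mult_left_mono) auto
    also have "\<dots> = cmod \<zeta> ^ Suc k * cmod (s N) + r / 2"
      by (simp add: d_def field_simps)
    finally show ?case .
  qed (use r in simp)
  have "(\<lambda>k. cmod \<zeta> ^ k * cmod (s N)) \<longlonglongrightarrow> 0"
    using \<zeta> by (intro tendsto_mult_left_zero LIMSEQ_power_zero) auto
  then obtain M where M: "\<And>k. k \<ge> M \<Longrightarrow> norm (cmod \<zeta> ^ k * cmod (s N)) < r / 2"
    using LIMSEQ_D[where r = "r / 2"] r by fastforce
  have "cmod (s n - 0) < r" if "n \<ge> N + M" for n
  proof -
    have "M \<le> n - N" using that by simp
    then have "cmod \<zeta> ^ (n - N) * cmod (s N) < r / 2" using M[of "n - N"] by (simp add: abs_mult)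
    then show ?thesis using step[of "n - N"] that by simp
  qed
  then show "\<exists>no. \<forall>n\<ge>no. norm (s n - 0) < r" by blast
qed

text \<open>The annihilating polynomial may have roots that are not conjugates of z. Roots of
  modulus at least 1 are no eigenvalues, by \<open>eigenvalue_embedding\<close>, so their twists are
  injective on additive functions and the small roots alone annihilate f. These are unwound one at a
  time by the recurrence for the sequence f (z^k t).\<close>

lemma additive_powers_tendsto_zero:
  fixes z :: "'f::field_char_0" and f :: "'f \<Rightarrow> complex"
  assumes nf: "is_number_field TYPE('f)"
    and small: "\<And>\<sigma> :: 'f \<Rightarrow> complex. is_ring_hom \<sigma> \<Longrightarrow> cmod (\<sigma> z) < 1"
    and f: "Modules.additive f"
  shows "(\<lambda>k. f (z ^ k * t)) \<longlonglongrightarrow> 0"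
proof -
  obtain A :: "complex multiset" where
    A: "\<And>zs (f :: 'f \<Rightarrow> complex). mset zs = A \<Longrightarrow> Modules.additive f \<Longrightarrow> fold (twist z) zs f = (\<lambda>_. 0)"
    using annihilating_twists[OF number_field_algebraic[OF nf, of z]] by blast
  obtain xs where xs: "mset xs = filter_mset (\<lambda>\<zeta>. cmod \<zeta> < 1) A" using ex_mset by blast
  obtain ys where ys: "mset ys = filter_mset (\<lambda>\<zeta>. \<not> cmod \<zeta> < 1) A" using ex_mset by blast
  have "mset (xs @ ys) = A" by (simp add: xs ys)
  then have 0: "fold (twist z) ys (fold (twist z) xs f) = (\<lambda>_. 0)" using A[of "xs @ ys" f] f by simp
  have large: "g = (\<lambda>_. 0)" if "fold (twist z) zs g = (\<lambda>_. 0)" "Modules.additive g"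
    "\<And>\<zeta>. \<zeta> \<in> set zs \<Longrightarrow> \<not> cmod \<zeta> < 1" for zs and g :: "'f \<Rightarrow> complex"
  proof (rule ccontr)
    assume "g \<noteq> (\<lambda>_. 0)"
    note g = that(2)
    from fold_first_zero[OF \<open>g \<noteq> (\<lambda>_. 0)\<close> that(1)] obtain us \<zeta> vs where *: "zs = us @ \<zeta> # vs"
      "fold (twist z) us g \<noteq> (\<lambda>_. 0)" "twist z \<zeta> (fold (twist z) us g) = (\<lambda>_. 0)" by blast
    have "fold (twist z) us g (z * t) = \<zeta> * fold (twist z) us g t" for t
      using fun_cong[OF *(3), of t] unfolding twist_def by simp
    then obtain \<sigma> :: "'f \<Rightarrow> complex" where "is_ring_hom \<sigma>" "\<sigma> z = \<zeta>"
      using eigenvalue_embedding[OF nf additive_fold_twist[OF g] *(2)] by blast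
    then show False using small that(3)[of \<zeta>] *(1) by auto
  qed
  have ysb: "\<not> cmod \<zeta> < 1" if "\<zeta> \<in> set ys" for \<zeta>
    using that arg_cong[OF ys, of set_mset] by auto
  have xsb: "cmod \<zeta> < 1" if "\<zeta> \<in> set xs" for \<zeta>
    using that arg_cong[OF xs, of set_mset] by auto
  have "fold (twist z) xs f = (\<lambda>_. 0)"
    using large[OF 0 additive_fold_twist[OF f]] ysb by blast
  then have "\<forall>t. (\<lambda>k. f (z ^ k * t)) \<longlonglongrightarrow> 0" using xsb
  proof (induction xs arbitrary: f)
    case (Cons \<zeta> xs)
    have *: "(\<lambda>k. twist z \<zeta> f (z ^ k * t)) \<longlonglongrightarrow> 0" for t
      using Cons.IH[of "twist z \<zeta> f"] Cons.prems by (metis fold_simps(2) list.set_intros(2))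
    show ?case
    proof
      fix t
      have "cmod \<zeta> < 1" by (rule Cons.prems(2)) simp
      then show "(\<lambda>k. f (z ^ k * t)) \<longlonglongrightarrow> 0"
        by (rule recurrence_tendsto_zero) (use *[of t] in \<open>simp add: twist_def mult.assoc\<close>)
    qed
  qed simp
  then show ?thesis by blast
qed

section \<open>Integers with bounded conjugates\<close>

lemma common_denominator:
  assumes "finite S"
  shows "\<exists>N::int. N > 0 \<and> (\<forall>r\<in>S. of_int N * (r::rat) \<in> \<int>)"
  using assms
proof induction
  case (insert r S)
  then obtain N :: int where N: "N > 0" "\<forall>r\<in>S. of_int N * (r::rat) \<in> \<int>" by blast
  obtain a b where r: "r = Fract a b" "b > 0" by (cases r) auto
  have "of_int (N * b) * r = of_int (N * a)" using r by (simp add: Fract_of_int_quotient)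
  then have "of_int (N * b) * r \<in> \<int>" by (simp only: Ints_of_int)
  moreover have "of_int (N * b) * s \<in> \<int>" if "s \<in> S" for s
    using N that Ints_mult[of "of_int b" "of_int N * s"] by (simp add: mult.left_commute mult.commute)
  ultimately show ?case using N r by (intro exI[of _ "N * b"]) auto
qed (auto intro: exI[of _ 1])

text \<open>In a rational basis each coordinate of z^k lies in (1/N)\<int> for a fixed N and tends
  to 0, hence is eventually 0. So a power of z vanishes.\<close>

lemma almost_integral_small_eq_zero:
  fixes z :: "'f::field_char_0"
  assumes nf: "is_number_field TYPE('f)"
    and small: "\<And>\<sigma> :: 'f \<Rightarrow> complex. is_ring_hom \<sigma> \<Longrightarrow> cmod (\<sigma> z) < 1"
    and z: "almost_integral z"
  shows "z = 0"
proof -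
  obtain T where T: "finite T" "\<And>k. z ^ k \<in> int_span T" using z unfolding almost_integral_def by blast
  obtain B :: "'f set" where B: "finite B" "rat_vec.independent B" "rat_vec.span B = UNIV"
    using number_field_basis[OF nf] .
  define r where "r b x = rat_vec.representation B x b" for b x
  have r_add: "r b (x + y) = r b x + r b y" for b x y
    unfolding r_def using B by (simp add: rat_vec.representation_add)
  have r_diff: "r b (x - y) = r b x - r b y" for b x y
    unfolding r_def using B by (simp add: rat_vec.representation_diff)
  have "eventually (\<lambda>k. r b (z ^ k) = 0) sequentially" for b
  proof -
    define f :: "'f \<Rightarrow> complex" where "f x = of_rat (r b x)" for x
    have f: "Modules.additive f" by (simp add: Modules.additive_def f_def r_add of_rat_add)
    obtain N :: int where N: "N > 0" "\<forall>q\<in>r b ` T. of_int N * q \<in> \<int>"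
      using common_denominator[of "r b ` T"] T(1) by blast
    have int: "of_int N * r b x \<in> \<int>" if "x \<in> int_span T" for x
      using that
    proof induction
      case int_span_zero
      then show ?case using r_diff[of b 0 0] by simp
    next
      case (int_span_base t)
      then show ?case using N by blast
    next
      case (int_span_diff x y)
      then show ?case by (simp add: r_diff right_diff_distrib)
    qed
    have "(\<lambda>k. f (z ^ k * 1)) \<longlonglongrightarrow> 0"
      by (rule additive_powers_tendsto_zero[OF nf small f])
    then have "eventually (\<lambda>k. cmod (f (z ^ k)) < 1 / of_int N) sequentially"
      using N by (auto dest!: tendstoD[where e = "1 / of_int N"])
    then show ?thesis
    proof eventually_elim
      case (elim k)
      obtain m where m: "of_int N * r b (z ^ k) = of_int m" using int[OF T(2)[of k]] by (auto elim: Ints_cases)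
      have "of_int N * f (z ^ k) = of_rat (of_int N * r b (z ^ k))" by (simp add: f_def of_rat_mult)
      also have "\<dots> = of_int m" by (simp add: m)
      finally have "cmod (of_int N * f (z ^ k)) = \<bar>of_int m\<bar>" by simp
      moreover have "cmod (of_int N * f (z ^ k)) < 1" using elim N by (simp add: norm_mult field_simps)
      ultimately have "m = 0" by linarith
      then show ?case using m N by simp
    qed
  qed
  then have "eventually (\<lambda>k. \<forall>b\<in>B. r b (z ^ k) = 0) sequentially"
    using B(1) by (auto simp: eventually_ball_finite_distrib)
  then obtain k where k: "\<forall>b\<in>B. r b (z ^ k) = 0" by (auto simp: eventually_sequentially)
  have "z ^ k = (\<Sum>b\<in>B. of_rat (r b (z ^ k)) * b)"
    unfolding r_def using B by (simp add: rat_vec.sum_representation_eq)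
  also have "\<dots> = 0" using k by simp
  finally show ?thesis by simp
qed

text \<open>An embedding is determined by its values on a finite spanning set, and each value is a
  root of a fixed integer polynomial.\<close>

lemma finite_real_embeddings:
  assumes nf: "is_number_field TYPE('f::field_char_0)"
  shows "finite {\<sigma> :: 'f \<Rightarrow> real. is_ring_hom \<sigma>}"
proof -
  obtain T :: "'f set" where T: "finite T" "\<And>x. \<exists>U c. U \<subseteq> T \<and> x = (\<Sum>t\<in>U. of_rat (c t) * t)"
    using number_field_span[OF nf] by blast
  have "\<exists>p. p \<noteq> 0 \<and> poly (map_poly of_int p) t = 0" for t :: 'f
    using number_field_algebraic[OF nf, of t] by (auto elim!: algebraicE')
  then obtain p where p: "\<And>t::'f. p t \<noteq> 0" "\<And>t. poly (map_poly of_int (p t)) t = 0" by metis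
  define X where "X t = {x::real. poly (map_poly of_int (p t)) x = 0}" for t
  have finX: "finite (X t)" for t
    unfolding X_def using p by (intro poly_roots_finite) (simp add: map_poly_eq_0_iff)
  have "(\<lambda>\<sigma>. restrict \<sigma> T) ` {\<sigma> :: 'f \<Rightarrow> real. is_ring_hom \<sigma>} \<subseteq> Pi\<^sub>E T X"
  proof (rule image_subsetI)
    fix \<sigma> :: "'f \<Rightarrow> real" assume "\<sigma> \<in> {\<sigma>. is_ring_hom \<sigma>}"
    then have \<sigma>: "is_ring_hom \<sigma>" by simp
    have "poly (map_poly of_int (p t)) (\<sigma> t) = \<sigma> (poly (map_poly of_int (p t)) t)" for t
      by (simp add: poly_altdef ring_hom_sum[OF \<sigma>] ring_hom_mult[OF \<sigma>] ring_hom_power[OF \<sigma>]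
          degree_map_poly coeff_map_poly ring_hom_of_int[OF \<sigma>])
    then show "restrict \<sigma> T \<in> Pi\<^sub>E T X"
      by (auto simp: X_def p ring_hom_zero[OF \<sigma>])
  qed
  moreover have "finite (Pi\<^sub>E T X)" using T finX by (intro finite_PiE) auto
  ultimately have "finite ((\<lambda>\<sigma>. restrict \<sigma> T) ` {\<sigma> :: 'f \<Rightarrow> real. is_ring_hom \<sigma>})"
    by (rule finite_subset)
  moreover have "inj_on (\<lambda>\<sigma>. restrict \<sigma> T) {\<sigma> :: 'f \<Rightarrow> real. is_ring_hom \<sigma>}"
  proof (rule inj_onI, safe)
    fix \<sigma> \<tau> :: "'f \<Rightarrow> real" assume h: "is_ring_hom \<sigma>" "is_ring_hom \<tau>" "restrict \<sigma> T = restrict \<tau> T"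
    have eq: "\<sigma> t = \<tau> t" if "t \<in> T" for t using fun_cong[OF h(3), of t] that by simp
    show "\<sigma> = \<tau>"
    proof
      fix x
      obtain U c where U: "U \<subseteq> T" "x = (\<Sum>s\<in>U. of_rat (c s) * s)" using T(2) by blast
      show "\<sigma> x = \<tau> x" using U(1) eq
        by (auto simp: U(2) ring_hom_sum h ring_hom_mult ring_hom_of_rat intro!: sum.cong)
    qed
  qed
  ultimately show ?thesis by (rule finite_imageD)
qed

text \<open>Bounded integer parts take finitely many values, and two elements with equal integer
  parts at every embedding differ by an integral element all of whose conjugates are smaller than 1,
  that is by 0.\<close>

lemma finite_bounded_almost_integral:
  assumes nf: "is_number_field TYPE('f::field_char_0)" and tr: "is_totally_real TYPE('f)"
  shows "finite {x::'f. almost_integral x \<and> (\<forall>\<sigma> :: 'f \<Rightarrow> real. is_ring_hom \<sigma> \<longrightarrow> \<bar>\<sigma> x\<bar> \<le> C \<sigma>)}"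
    (is "finite ?S")
proof -
  define H where "H = {\<sigma> :: 'f \<Rightarrow> real. is_ring_hom \<sigma>}"
  define \<Phi> where "\<Phi> x = (\<lambda>\<sigma>\<in>H. \<lfloor>\<sigma> x\<rfloor>)" for x
  have "\<Phi> ` ?S \<subseteq> Pi\<^sub>E H (\<lambda>\<sigma>. {- \<lceil>C \<sigma>\<rceil> - 1..\<lceil>C \<sigma>\<rceil>})"
  proof (rule image_subsetI)
    fix x assume "x \<in> ?S"
    then have x: "\<forall>\<sigma> :: 'f \<Rightarrow> real. is_ring_hom \<sigma> \<longrightarrow> \<bar>\<sigma> x\<bar> \<le> C \<sigma>" by simp
    have "\<lfloor>\<sigma> x\<rfloor> \<in> {- \<lceil>C \<sigma>\<rceil> - 1..\<lceil>C \<sigma>\<rceil>}" if "\<sigma> \<in> H" for \<sigma>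
    proof -
      have "\<bar>\<sigma> x\<bar> \<le> C \<sigma>" using x that by (simp add: H_def)
      then show ?thesis by (simp; linarith)
    qed
    then show "\<Phi> x \<in> Pi\<^sub>E H (\<lambda>\<sigma>. {- \<lceil>C \<sigma>\<rceil> - 1..\<lceil>C \<sigma>\<rceil>})" by (auto simp: \<Phi>_def)
  qed
  moreover have "finite (Pi\<^sub>E H (\<lambda>\<sigma>. {- \<lceil>C \<sigma>\<rceil> - 1..\<lceil>C \<sigma>\<rceil>}))"
    using finite_real_embeddings[OF nf] by (intro finite_PiE) (auto simp: H_def)
  ultimately have "finite (\<Phi> ` ?S)" by (rule finite_subset)
  moreover have "inj_on \<Phi> ?S"
  proof (rule inj_onI)
    fix x y assume x: "x \<in> ?S" and y: "y \<in> ?S" and eq: "\<Phi> x = \<Phi> y"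
    have "x - y = 0"
    proof (rule almost_integral_small_eq_zero[OF nf])
      fix \<sigma> :: "'f \<Rightarrow> complex" assume \<sigma>: "is_ring_hom \<sigma>"
      have real: "\<sigma> t = of_real (Re (\<sigma> t))" for t
        using tr \<sigma> unfolding is_totally_real_def by (metis of_real_Re range_subsetD)
      \<comment> \<open>Total reality turns a complex embedding into a real one, where the integer
        parts are compared.\<close>
      have Re: "is_ring_hom (\<lambda>t. Re (\<sigma> t))"
        unfolding is_ring_hom_def
      proof (intro conjI allI)
        show "Re (\<sigma> (s * t)) = Re (\<sigma> s) * Re (\<sigma> t)" for s t
          using ring_hom_mult[OF \<sigma>, of s t] real[of s] real[of t] by (metis Re_complex_of_real of_real_mult)
      qed (simp_all add: ring_hom_one[OF \<sigma>] ring_hom_add[OF \<sigma>])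
      then have "\<lfloor>Re (\<sigma> x)\<rfloor> = \<lfloor>Re (\<sigma> y)\<rfloor>"
        using fun_cong[OF eq, of "\<lambda>t. Re (\<sigma> t)"] by (simp add: \<Phi>_def H_def)
      then have "\<bar>Re (\<sigma> x) - Re (\<sigma> y)\<bar> < 1" by linarith
      moreover have "\<sigma> (x - y) = of_real (Re (\<sigma> x) - Re (\<sigma> y))"
        using real[of x] real[of y] by (simp add: ring_hom_diff[OF \<sigma>])
      ultimately show "cmod (\<sigma> (x - y)) < 1" by (metis norm_of_real)
    qed (use x y almost_integral_diff in auto)
    then show "x = y" by simp
  qed
  ultimately show ?thesis by (rule finite_imageD)
qed

section \<open>Matrix representations of quaternion algebras\<close>

locale quaternion_frame =
  fixes e :: "'f::field_char_0 \<Rightarrow> 'b::ring_1" and a b :: 'f and i j :: 'b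
  assumes algebra_e: "is_algebra e" and basis: "is_quaternion_basis e a b i j"
begin

lemma hom_e: "is_ring_hom e" and central: "e c * x = x * e c"
  using algebra_e by (auto simp: is_algebra_def)

lemma ab_nz: "a \<noteq> 0" "b \<noteq> 0"
  and relations: "i * i = e a" "j * j = e b" "j * i = - (i * j)"
  using basis by (auto simp: is_quaternion_basis_def)

definition quat :: "'f \<Rightarrow> 'f \<Rightarrow> 'f \<Rightarrow> 'f \<Rightarrow> 'b" where
  "quat t u v w = e t + e u * i + e v * j + e w * (i * j)"

lemma quat_ex: "\<exists>t u v w. x = quat t u v w"
proof -
  have "\<exists>!(t, u, v, w). x = e t + e u * i + e v * j + e w * (i * j)"
    using basis unfolding is_quaternion_basis_def by blast
  then show ?thesis unfolding quat_def by (auto dest!: ex1_implies_ex)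
qed

lemma quat_inject: "quat t u v w = quat t' u' v' w' \<longleftrightarrow> t = t' \<and> u = u' \<and> v = v' \<and> w = w'"
proof
  assume h: "quat t u v w = quat t' u' v' w'"
  have "\<exists>!(r, s, y, z). quat t u v w = e r + e s * i + e y * j + e z * (i * j)"
    using basis unfolding is_quaternion_basis_def by blast
  then have "(t, u, v, w) = (t', u', v', w')"
  proof (rule ex1E)
    fix q assume *: "\<forall>y. (case y of (r, s, y, z) \<Rightarrow> quat t u v w = e r + e s * i + e y * j + e z * (i * j)) \<longrightarrow> y = q"
    have "(t, u, v, w) = q" using * by (auto simp: quat_def)
    moreover have "(t', u', v', w') = q" using * h by (auto simp: quat_def)
    ultimately show ?thesis by simp
  qed
  then show "t = t' \<and> u = u' \<and> v = v' \<and> w = w'" by simp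
qed simp

lemma quat_add: "quat t u v w + quat t' u' v' w' = quat (t + t') (u + u') (v + v') (w + w')"
  by (simp add: quat_def ring_hom_add[OF hom_e] algebra_simps)

lemma quat_scale: "e c * quat t u v w = quat (c * t) (c * u) (c * v) (c * w)"
  by (simp add: quat_def ring_hom_mult[OF hom_e] distrib_left mult.assoc)

lemma quat_zero: "quat 0 0 0 0 = 0"
  by (simp add: quat_def ring_hom_zero[OF hom_e])

lemma quat_mult: "quat t u v w * quat t' u' v' w' =
  quat (t * t' + a * u * u' + b * v * v' - a * b * w * w') (t * u' + u * t' - b * v * w' + b * w * v')
    (t * v' + v * t' + a * u * w' - a * w * u') (t * w' + w * t' + u * v' - v * u')"
proof -
  have r: "i * (i * x) = e a * x" "j * (j * x) = e b * x" "j * (i * x) = - (i * (j * x))" for x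
    by (simp_all add: relations mult.assoc[symmetric])
  have c: "i * e c = e c * i" "j * e c = e c * j" "i * (e c * x) = e c * (i * x)" "j * (e c * x) = e c * (j * x)" for c x
    by (simp_all add: central[symmetric] mult.assoc[symmetric])
  have m: "e c * e d = e (c * d)" "e c * (e d * x) = e (c * d) * x" for c d x
    by (simp_all add: ring_hom_mult[OF hom_e] mult.assoc[symmetric])
  show ?thesis
    unfolding quat_def
    by (simp add: distrib_left distrib_right mult.assoc r relations c m ring_hom_add[OF hom_e]
        ring_hom_diff[OF hom_e] left_diff_distrib)
       (simp add: mult.commute mult.left_commute)
qed

text \<open>Exchanging i and j permutes coordinates and changes the sign of the last one, so
  statements about \<open>a\<close> transfer to \<open>b\<close>.\<close>

lemma swap: "quaternion_frame e b a j i"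
proof
  show "is_algebra e" by (rule algebra_e)
  have s: "e t + e u * j + e v * i + e w * (j * i) = quat t v u (- w)" for t u v w
    by (simp add: quat_def relations ring_hom_minus[OF hom_e])
  have "\<exists>!(t, u, v, w). x = quat t v u (- w)" for x
  proof -
    obtain t u v w where x: "x = quat t u v w" using quat_ex by blast
    show ?thesis by (rule ex1I[of _ "(t, v, u, - w)"]) (auto simp: x quat_inject)
  qed
  then show "is_quaternion_basis e b a j i"
    unfolding is_quaternion_basis_def s using ab_nz relations by simp
qed

end

section \<open>Quaternion coordinates read off from matrices\<close>

text \<open>Let I and J be traceless with entries p, q, r and p', q', r', K = I J and X = T + U I +
  V J + W K. The right-hand sides of the first four identities are the traces of X, I X, J X, K X,
  and the last identity computes det X. The hypothesis says tr (I J) = 0, that is, I and J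
  anticommute.\<close>

lemma anticommuting_matrix_identities:
  fixes p q r p' q' r' T U V W :: "'l::comm_ring_1"
  assumes rel: "q' * r + 2 * p * p' + q * r' = 0"
  defines "X11 \<equiv> T + U * p + V * p' + W * (p * p' + q * r')" and "X12 \<equiv> U * q + V * q' + W * (p * q' - q * p')"
    and "X21 \<equiv> U * r + V * r' + W * (r * p' - p * r')" and "X22 \<equiv> T - U * p - V * p' + W * (r * q' + p * p')"
  shows "2 * T = X11 + X22"
    "2 * (p * p + q * r) * U = p * X11 + q * X21 + r * X12 - p * X22"
    "2 * (p' * p' + q' * r') * V = p' * X11 + q' * X21 + r' * X12 - p' * X22"
    "- (2 * (p * p + q * r) * (p' * p' + q' * r')) * W =
       (p * p' + q * r') * X11 + (p * q' - q * p') * X21 + (r * p' - p * r') * X12 + (r * q' + p * p') * X22"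
    "X11 * X22 - X12 * X21 = T * T - (p * p + q * r) * (U * U) - (p' * p' + q' * r') * (V * V)
       + (p * p + q * r) * (p' * p' + q' * r') * (W * W)"
proof -
  define H where "H = q' * r + 2 * p * p' + q * r'"
  \<comment> \<open>Each identity holds modulo \<open>H\<close>; the cofactor is given explicitly in
    every case.\<close>
  have eq: "x = y" if "x - y = c * H" for x y c using that rel by (simp add: H_def)
  note X = assms(2-) H_def
  show "2 * T = X11 + X22"
    by (rule eq[of _ _ "- W"]) (simp add: X algebra_simps)
  show "2 * (p * p + q * r) * U = p * X11 + q * X21 + r * X12 - p * X22"
    by (rule eq[of _ _ "- V"]) (simp add: X algebra_simps)
  show "2 * (p' * p' + q' * r') * V = p' * X11 + q' * X21 + r' * X12 - p' * X22"
    by (rule eq[of _ _ "- U"]) (simp add: X algebra_simps)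
  show "- (2 * (p * p + q * r) * (p' * p' + q' * r')) * W =
       (p * p' + q * r') * X11 + (p * q' - q * p') * X21 + (r * p' - p * r') * X12 + (r * q' + p * p') * X22"
    by (rule eq[of _ _ "- (T + W * H)"]) (simp add: X algebra_simps)
  show "X11 * X22 - X12 * X21 = T * T - (p * p + q * r) * (U * U) - (p' * p' + q' * r') * (V * V)
       + (p * p + q * r) * (p' * p' + q' * r') * (W * W)"
    by (rule eq[of _ _ "T * W - U * V"]) (simp add: X algebra_simps)
qed

text \<open>One treatment for both splittings: \<sigma> will be \<open>v_inf\<close> for
  \<open>\<iota>_inf\<close> and the embedding through K for \<open>\<iota>_p\<close>.\<close>

locale quaternion_matrices = quaternion_frame e a b i j
  for e :: "'f::field_char_0 \<Rightarrow> 'b::ring_1" and a b i j +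
  fixes \<sigma> :: "'f \<Rightarrow> 'l::field_char_0" and \<iota> :: "'b \<Rightarrow> 'l^2^2"
  assumes hom_\<sigma>: "is_ring_hom \<sigma>" and hom_\<iota>: "is_mat_hom \<iota>" and scalar: "\<iota> (e c) = mat (\<sigma> c)"
begin

lemma rep_add: "\<iota> (x + y) = \<iota> x + \<iota> y"
  and rep_mult: "\<iota> (x * y) = \<iota> x ** \<iota> y"
  using hom_\<iota> by (auto simp: is_mat_hom_def)

lemma rep_minus: "\<iota> (- x) = - \<iota> x"
  using rep_add[of x "- x"] rep_add[of 0 0] by (simp add: eq_neg_iff_add_eq_0 add.commute)

text \<open>If A anticommutes with C and C^2 is a nonzero scalar c, cyclicity of the trace gives c
  tr A = tr (C A C) = - c tr A. So both generators are traceless, and the rest is read off from the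
  relations.\<close>

lemma frame_entries:
  defines "I \<equiv> \<iota> i" and "J \<equiv> \<iota> j"
  shows "I$2$2 = - I$1$1" "J$2$2 = - J$1$1"
    "\<sigma> a = I$1$1 * I$1$1 + I$1$2 * I$2$1" "\<sigma> b = J$1$1 * J$1$1 + J$1$2 * J$2$1"
    "J$1$2 * I$2$1 + 2 * I$1$1 * J$1$1 + I$1$2 * J$2$1 = 0"
proof -
  have II: "I ** I = mat (\<sigma> a)" and JJ: "J ** J = mat (\<sigma> b)" and JI: "J ** I = - (I ** J)"
    unfolding I_def J_def rep_mult[symmetric] relations by (simp_all add: scalar rep_minus)
  have nz: "\<sigma> a \<noteq> 0" "\<sigma> b \<noteq> 0" using ab_nz ring_hom_eq_0_iff[OF hom_\<sigma>] by auto
  have tr0: "trace A = 0" if "A ** C = - (C ** A)" "C ** C = mat c" "c \<noteq> 0" for A C :: "'l^2^2" and c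
  proof -
    have s: "trace (mat c ** A) = c * trace A" for A :: "'l^2^2"
      by (simp add: trace_def sum_2 mat2_mult_entry algebra_simps)
    have "c * trace A = trace (C ** (C ** A))" by (simp add: matrix_mul_assoc that s)
    also have "\<dots> = trace ((C ** A) ** C)" by (rule trace_mul_sym)
    also have "\<dots> = trace (C ** (A ** C))" by (simp add: matrix_mul_assoc)
    also have "\<dots> = - trace (C ** (C ** A))"
      unfolding that(1) by (simp add: trace_def sum_2 mat2_mult_entry algebra_simps)
    also have "trace (C ** (C ** A)) = c * trace A" by (simp add: matrix_mul_assoc that s)
    finally have "c * trace A = - (c * trace A)" .
    then have "2 * (c * trace A) = 0" by (metis add.right_inverse mult_2)
    then show ?thesis using that by simp
  qed
  have "I ** J = - (J ** I)" using JI by simp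
  then have "trace I = 0" by (rule tr0[OF _ JJ nz(2)])
  then show I22: "I$2$2 = - I$1$1" by (simp add: trace_def sum_2 eq_neg_iff_add_eq_0 add.commute)
  have "trace J = 0" by (rule tr0[OF JI II nz(1)])
  then show J22: "J$2$2 = - J$1$1" by (simp add: trace_def sum_2 eq_neg_iff_add_eq_0 add.commute)
  show "\<sigma> a = I$1$1 * I$1$1 + I$1$2 * I$2$1" "\<sigma> b = J$1$1 * J$1$1 + J$1$2 * J$2$1"
    using II JJ by (auto simp: mat2_eq_iff mat2_mult_entry)
  have "J$1$1 * I$1$1 + J$1$2 * I$2$1 = - (I$1$1 * J$1$1 + I$1$2 * J$2$1)"
    using JI by (auto simp: mat2_eq_iff mat2_mult_entry)
  then have "J$1$1 * I$1$1 + J$1$2 * I$2$1 + (I$1$1 * J$1$1 + I$1$2 * J$2$1) = 0"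
    by (simp only: eq_neg_iff_add_eq_0)
  then show "J$1$2 * I$2$1 + 2 * I$1$1 * J$1$1 + I$1$2 * J$2$1 = 0"
    by (simp add: algebra_simps)
qed

lemma rep_quat_entries:
  defines "I \<equiv> \<iota> i" and "J \<equiv> \<iota> j"
  shows "\<iota> (quat t u v w) $ m $ n =
    mat (\<sigma> t) $ m $ n + \<sigma> u * I $ m $ n + \<sigma> v * J $ m $ n + \<sigma> w * (I$m$1 * J$1$n + I$m$2 * J$2$n)"
proof -
  have s: "(mat c ** A) $ m $ n = c * A $ m $ n" for c and A :: "'l^2^2"
    using mat_scale_entry[of c A] by (simp add: mat_scale_def)
  show ?thesis
    unfolding quat_def rep_add rep_mult scalar by (simp add: s I_def J_def mat2_mult_entry[of "\<iota> i"])
qed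

lemma rep_quat_matrix:
  fixes t u v w
  defines "X \<equiv> \<iota> (quat t u v w)" and "I \<equiv> \<iota> i" and "J \<equiv> \<iota> j"
  defines "p \<equiv> I$1$1" and "q \<equiv> I$1$2" and "r \<equiv> I$2$1" and "p' \<equiv> J$1$1" and "q' \<equiv> J$1$2" and "r' \<equiv> J$2$1"
  shows "X$1$1 = \<sigma> t + \<sigma> u * p + \<sigma> v * p' + \<sigma> w * (p * p' + q * r')"
    "X$1$2 = \<sigma> u * q + \<sigma> v * q' + \<sigma> w * (p * q' - q * p')"
    "X$2$1 = \<sigma> u * r + \<sigma> v * r' + \<sigma> w * (r * p' - p * r')"
    "X$2$2 = \<sigma> t - \<sigma> u * p - \<sigma> v * p' + \<sigma> w * (r * q' + p * p')"
  unfolding assms rep_quat_entries by (simp_all add: frame_entries)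

text \<open>The trace pairing is diagonal on 1, i, j, ij with values 2, 2a, 2b, -2ab. Coordinates
  are thus linear in the matrix entries, which transfers bounds and proportionality.\<close>

lemma coordinate_traces:
  fixes x t u v w
  assumes x: "x = quat t u v w"
  defines "X \<equiv> \<iota> x" and "I \<equiv> \<iota> i" and "J \<equiv> \<iota> j" and "K \<equiv> \<iota> (i * j)"
  shows "2 * \<sigma> t = X$1$1 + X$2$2"
    "2 * \<sigma> a * \<sigma> u = I$1$1 * X$1$1 + I$1$2 * X$2$1 + I$2$1 * X$1$2 + I$2$2 * X$2$2"
    "2 * \<sigma> b * \<sigma> v = J$1$1 * X$1$1 + J$1$2 * X$2$1 + J$2$1 * X$1$2 + J$2$2 * X$2$2"
    "- (2 * \<sigma> a * \<sigma> b) * \<sigma> w = K$1$1 * X$1$1 + K$1$2 * X$2$1 + K$2$1 * X$1$2 + K$2$2 * X$2$2"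
  using anticommuting_matrix_identities(1-4)[OF frame_entries(5),
      where T = "\<sigma> t" and U = "\<sigma> u" and V = "\<sigma> v" and W = "\<sigma> w"]
  unfolding assms rep_mult mat2_mult_entry frame_entries(1-4) rep_quat_matrix
  by simp_all

lemma det_rep: "det (\<iota> (quat t u v w)) = \<sigma> (t\<^sup>2 - a * u\<^sup>2 - b * v\<^sup>2 + a * b * w\<^sup>2)"
  using anticommuting_matrix_identities(5)[OF frame_entries(5),
      where T = "\<sigma> t" and U = "\<sigma> u" and V = "\<sigma> v" and W = "\<sigma> w"]
  unfolding det_2 power2_eq_square rep_quat_matrix ring_hom_add[OF hom_\<sigma>] ring_hom_diff[OF hom_\<sigma>]
    ring_hom_mult[OF hom_\<sigma>] frame_entries(3,4) .

text \<open>The factor \<open>r\<close> is a quotient of corresponding coordinates, so it comes from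
  F although it is only given in the larger field.\<close>

lemma rep_proportional:
  assumes x: "x \<noteq> 0" and y: "\<And>m n. \<iota> y $ m $ n = r * \<iota> x $ m $ n"
  shows "\<exists>c. y = e c * x"
proof -
  obtain t u v w where x': "x = quat t u v w" using quat_ex by blast
  obtain t' u' v' w' where y': "y = quat t' u' v' w'" using quat_ex by blast
  have nz: "\<sigma> a \<noteq> 0" "\<sigma> b \<noteq> 0" using ab_nz ring_hom_eq_0_iff[OF hom_\<sigma>] by auto
  note ct = coordinate_traces[OF x'] coordinate_traces[OF y', unfolded y]
  have "2 * \<sigma> t' = r * (2 * \<sigma> t)" "2 * \<sigma> a * \<sigma> u' = r * (2 * \<sigma> a * \<sigma> u)"
    "2 * \<sigma> b * \<sigma> v' = r * (2 * \<sigma> b * \<sigma> v)" "- (2 * \<sigma> a * \<sigma> b) * \<sigma> w' = r * (- (2 * \<sigma> a * \<sigma> b) * \<sigma> w)"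
    unfolding ct by (simp_all add: algebra_simps)
  then have s: "\<sigma> t' = r * \<sigma> t" "\<sigma> u' = r * \<sigma> u" "\<sigma> v' = r * \<sigma> v" "\<sigma> w' = r * \<sigma> w"
    using nz by simp_all
  obtain c where c: "\<sigma> c = r"
  proof -
    have "t \<noteq> 0 \<or> u \<noteq> 0 \<or> v \<noteq> 0 \<or> w \<noteq> 0" using x x' quat_zero by auto
    moreover have "\<exists>c. \<sigma> c = r" if "\<sigma> z' = r * \<sigma> z" "z \<noteq> 0" for z z'
    proof
      have "\<sigma> (z' / z) * \<sigma> z = \<sigma> z'" using that(2) by (simp add: ring_hom_mult[OF hom_\<sigma>, symmetric])
      then show "\<sigma> (z' / z) = r" using that ring_hom_eq_0_iff[OF hom_\<sigma>, of z] by simp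
    qed
    ultimately show ?thesis using s that by blast
  qed
  have "t' = c * t" "u' = c * u" "v' = c * v" "w' = c * w"
    using s unfolding c[symmetric] by (simp_all add: ring_hom_mult[OF hom_\<sigma>, symmetric] ring_hom_eq_iff[OF hom_\<sigma>])
  then show ?thesis by (auto simp: x' y' quat_scale)
qed

lemma rep_eq_0: assumes "\<iota> x = 0" shows "x = 0"
proof -
  obtain t u v w where x: "x = quat t u v w" using quat_ex by blast
  have nz: "\<sigma> a \<noteq> 0" "\<sigma> b \<noteq> 0" using ab_nz ring_hom_eq_0_iff[OF hom_\<sigma>] by auto
  have "\<sigma> t = 0" "\<sigma> u = 0" "\<sigma> v = 0" "\<sigma> w = 0"
    using coordinate_traces[OF x] assms nz by simp_all
  then show ?thesis by (simp add: x ring_hom_eq_0_iff[OF hom_\<sigma>] quat_zero)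
qed

end

section \<open>The reduced norm and real places\<close>

lemma quaternion_frame_ex:
  assumes "is_quaternion_algebra e"
  obtains a b i j where "quaternion_frame e a b i j"
  using assms unfolding is_quaternion_algebra_def quaternion_frame_def by blast

lemma quaternion_matrices_ex:
  assumes "is_quaternion_algebra e" "is_ring_hom \<sigma>" "is_mat_hom \<iota>" "\<And>c. \<iota> (e c) = mat (\<sigma> c)"
  obtains a b i j where "quaternion_matrices e a b i j \<sigma> \<iota>"
  using assms quaternion_frame_ex[OF assms(1)]
  unfolding quaternion_matrices_def quaternion_matrices_axioms_def by metis

text \<open>Every candidate in the definite description has image \<open>det (\<iota> x)\<close>,
  and \<sigma> is injective; so the candidate is unique, whichever quaternion basis computes
  it.\<close>

lemma reduced_norm_det:
  fixes \<sigma> :: "'f::field_char_0 \<Rightarrow> 'l::field_char_0"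
  assumes qa: "is_quaternion_algebra e" and \<sigma>: "is_ring_hom \<sigma>" and \<iota>: "is_mat_hom \<iota>" "\<And>c. \<iota> (e c) = mat (\<sigma> c)"
  shows "\<sigma> (reduced_norm e x) = det (\<iota> x)"
proof -
  define P where "P n \<longleftrightarrow> (\<exists>a b i j t u v w. is_quaternion_basis e a b i j \<and>
        x = e t + e u * i + e v * j + e w * (i * j) \<and>
        n = t\<^sup>2 - a * u\<^sup>2 - b * v\<^sup>2 + a * b * w\<^sup>2)" for n
  have det: "\<sigma> n = det (\<iota> x)" if "P n" for n
  proof -
    from that obtain a b i j t u v w where *: "is_quaternion_basis e a b i j"
        "x = e t + e u * i + e v * j + e w * (i * j)"
        "n = t\<^sup>2 - a * u\<^sup>2 - b * v\<^sup>2 + a * b * w\<^sup>2" unfolding P_def by blast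
    interpret quaternion_matrices e a b i j \<sigma> \<iota>
      using qa * \<sigma> \<iota> by unfold_locales (auto simp: is_quaternion_algebra_def)
    show ?thesis using det_rep[of t u v w] * by (simp add: quat_def)
  qed
  obtain a b i j where "quaternion_frame e a b i j" using quaternion_frame_ex[OF qa] .
  then interpret quaternion_frame e a b i j .
  obtain t u v w where "x = quat t u v w" using quat_ex by blast
  then have "\<exists>n. P n" unfolding P_def quat_def using basis by blast
  moreover have "n = m" if "P n" "P m" for n m
    using that det[of n] det[of m] ring_hom_eq_iff[OF \<sigma>, of n m] by simp
  ultimately have "P (THE n. P n)" using theI'[of P] by blast
  moreover have "reduced_norm e x = (THE n. P n)" unfolding reduced_norm_def P_def ..
  ultimately show ?thesis using det by simp
qed

lemma (in quaternion_frame) positive_imp_split: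
  fixes \<sigma> :: "'f \<Rightarrow> real"
  assumes \<sigma>: "is_ring_hom \<sigma>" and pos: "\<sigma> a > 0"
  shows "is_split_real e \<sigma>"
proof -
  define s where "s = sqrt (\<sigma> a)"
  have s: "s * s = \<sigma> a" "s \<noteq> 0" using pos by (auto simp: s_def)
  have b: "\<sigma> b \<noteq> 0" using ab_nz ring_hom_eq_0_iff[OF \<sigma>] by auto
  obtain ct cu cv cw where c: "\<And>x. x = quat (ct x) (cu x) (cv x) (cw x)" using quat_ex by metis
  have cq: "ct (quat t u v w) = t" "cu (quat t u v w) = u" "cv (quat t u v w) = v" "cw (quat t u v w) = w" for t u v w
    using c[of "quat t u v w"] by (simp_all add: quat_inject)
  \<comment> \<open>The images are i \<mapsto> diag(s, -s) and j \<mapsto> the antidiagonal matrix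
    with entries \<sigma> b and 1; the relations hold because s^2 = \<sigma> a.\<close>
  define m where "m t u v w = mat2 (t + u * s) (\<sigma> b * (v + w * s)) (v - w * s) (t - u * s)" for t u v w :: real
  define \<iota> where "\<iota> x = m (\<sigma> (ct x)) (\<sigma> (cu x)) (\<sigma> (cv x)) (\<sigma> (cw x))" for x
  have \<iota>: "\<iota> (quat t u v w) = m (\<sigma> t) (\<sigma> u) (\<sigma> v) (\<sigma> w)" for t u v w
    by (simp add: \<iota>_def cq)
  have e: "e t = quat t 0 0 0" for t by (simp add: quat_def ring_hom_zero[OF hom_e])
  note hs = ring_hom_add[OF \<sigma>] ring_hom_mult[OF \<sigma>] ring_hom_diff[OF \<sigma>] ring_hom_zero[OF \<sigma>] ring_hom_one[OF \<sigma>]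
  have scal: "\<iota> (e t) = mat (\<sigma> t)" for t
    unfolding e \<iota> by (simp add: m_def mat2_eq_iff hs)
  have "is_mat_hom \<iota>" unfolding is_mat_hom_def
  proof (intro conjI allI)
    show "\<iota> 1 = mat 1" using scal[of 1] by (simp add: hs ring_hom_one[OF hom_e])
    fix x y
    obtain t u v w where x: "x = quat t u v w" using quat_ex by blast
    obtain t' u' v' w' where y: "y = quat t' u' v' w'" using quat_ex by blast
    show "\<iota> (x + y) = \<iota> x + \<iota> y"
      unfolding x y quat_add \<iota> by (simp add: m_def mat2_eq_iff hs algebra_simps)
    show "\<iota> (x * y) = \<iota> x ** \<iota> y"
      unfolding x y quat_mult \<iota> by (simp add: m_def mat2_eq_iff mat2_mult_entry hs s(1)[symmetric] algebra_simps)
  qed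
  moreover have "M \<in> span_over UNIV mat_scale (range \<iota>)" for M :: "real^2^2"
  proof -
    define E where "E = [m 1 0 0 0, m 0 1 0 0, m 0 0 1 0, m 0 0 0 1]"
    have d: "distinct E" using s b by (auto simp: E_def m_def mat2_eq_iff)
    have "set E \<subseteq> range \<iota>"
    proof
      fix X assume "X \<in> set E"
      then have "X \<in> {\<iota> (quat 1 0 0 0), \<iota> (quat 0 1 0 0), \<iota> (quat 0 0 1 0), \<iota> (quat 0 0 0 1)}"
        by (auto simp: E_def \<iota> hs)
      then show "X \<in> range \<iota>" by blast
    qed
    define c where "c X = (if X = m 1 0 0 0 then (M$1$1 + M$2$2) / 2
      else if X = m 0 1 0 0 then (M$1$1 - M$2$2) / (2 * s)
      else if X = m 0 0 1 0 then (M$1$2 / \<sigma> b + M$2$1) / 2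
      else (M$1$2 / \<sigma> b - M$2$1) / (2 * s))" for X
    have "(\<Sum>X\<in>set E. mat_scale (c X) X) = sum_list (map (\<lambda>X. mat_scale (c X) X) E)"
      using d by (simp add: sum_list_distinct_conv_sum_set)
    also have "\<dots> = M"
    proof -
      have "c (m 1 0 0 0) = (M$1$1 + M$2$2) / 2" "c (m 0 1 0 0) = (M$1$1 - M$2$2) / (2 * s)"
        "c (m 0 0 1 0) = (M$1$2 / \<sigma> b + M$2$1) / 2" "c (m 0 0 0 1) = (M$1$2 / \<sigma> b - M$2$1) / (2 * s)"
        using d by (auto simp: c_def E_def)
      then show ?thesis using s b by (simp add: E_def mat2_eq_iff) (simp add: m_def field_simps)
    qed
    finally show ?thesis using \<open>set E \<subseteq> range \<iota>\<close> unfolding span_over_def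
      by (intro CollectI exI[of _ "set E"] exI[of _ c]) auto
  qed
  ultimately have "is_splitting e UNIV \<sigma> \<iota>"
    using scal unfolding is_splitting_def by (auto simp: mat2_over_def)
  then show ?thesis unfolding is_split_real_def by blast
qed

text \<open>The second sign follows from the first by exchanging i and j. Together they make the
  norm form positive definite at this place.\<close>

lemma (in quaternion_frame) not_split_negative:
  fixes \<sigma> :: "'f \<Rightarrow> real"
  assumes \<sigma>: "is_ring_hom \<sigma>" and "\<not> is_split_real e \<sigma>"
  shows "\<sigma> a < 0" "\<sigma> b < 0"
proof -
  have nz: "\<sigma> a \<noteq> 0" "\<sigma> b \<noteq> 0" using ab_nz ring_hom_eq_0_iff[OF \<sigma>] by auto
  show "\<sigma> a < 0" using positive_imp_split[OF \<sigma>] assms(2) nz by force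
  show "\<sigma> b < 0" using quaternion_frame.positive_imp_split[OF swap \<sigma>] assms(2) nz by force
qed

section \<open>Finiteness of bounded sets in an order\<close>

text \<open>The order is generated by finitely many elements over the integers of F, so the product
  of their denominators under \<kappa> serves all of it.\<close>

lemma order_coordinates_almost_integral:
  fixes e :: "'f::field_char_0 \<Rightarrow> 'b::ring_1"
  assumes nf: "is_number_field TYPE('f)" and R: "is_order e R"
    and \<kappa>: "\<And>x y. \<kappa> (x + y) = \<kappa> x + \<kappa> y" "\<And>c x. \<kappa> (e c * x) = c * \<kappa> x"
  obtains N :: int where "N \<noteq> 0" "\<And>x. x \<in> R \<Longrightarrow> almost_integral (of_int N * \<kappa> x)"
proof -
  obtain T where T: "finite T" "R = span_over (integers_of TYPE('f)) (\<lambda>c x. e c * x) T"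
    using R unfolding is_order_def by blast
  have "\<forall>x. \<exists>N::int. N \<noteq> 0 \<and> almost_integral (of_int N * \<kappa> x)"
    using algebraic_imp_almost_integral_multiple[OF number_field_algebraic[OF nf]] by blast
  then obtain N :: "'b \<Rightarrow> int" where N: "\<And>x. N x \<noteq> 0" "\<And>x. almost_integral (of_int (N x) * \<kappa> x)"
    by metis
  define M where "M = (\<Prod>x\<in>T. N x)"
  have M: "almost_integral (of_int M * \<kappa> x)" if "x \<in> T" for x
  proof -
    have "M = (\<Prod>y\<in>T - {x}. N y) * N x" unfolding M_def using T(1) that by (simp add: prod.remove mult.commute)
    then have "of_int M * \<kappa> x = of_int (\<Prod>y\<in>T - {x}. N y) * (of_int (N x) * \<kappa> x)" by (simp add: mult.assoc)
    then show ?thesis using N by (simp only: almost_integral_mult almost_integral_of_int)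
  qed
  have sum: "\<kappa> (\<Sum>x\<in>U. g x) = (\<Sum>x\<in>U. \<kappa> (g x))" for U and g :: "'b \<Rightarrow> 'b"
  proof (induction U rule: infinite_finite_induct)
    case empty
    then show ?case using \<kappa>(1)[of 0 0] by simp
  qed (use \<kappa>(1)[of 0 0] in \<open>simp_all add: \<kappa>(1)\<close>)
  show ?thesis
  proof (rule that[of M])
    show "M \<noteq> 0" using N T by (simp add: M_def)
    fix x assume "x \<in> R"
    then obtain U c where U: "U \<subseteq> T" "c ` U \<subseteq> integers_of TYPE('f)" "x = (\<Sum>y\<in>U. e (c y) * y)"
      unfolding T(2) span_over_def by blast
    have "of_int M * \<kappa> x = (\<Sum>y\<in>U. c y * (of_int M * \<kappa> y))"
      by (simp add: U(3) sum \<kappa>(2) sum_distrib_left algebra_simps)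
    also have "almost_integral \<dots>"
    proof (rule almost_integral_sum)
      fix y assume "y \<in> U"
      then have "algebraic_int (c y)" "y \<in> T" using U by (auto simp: integers_of_def)
      then show "almost_integral (c y * (of_int M * \<kappa> y))"
        by (intro almost_integral_mult[of "c y"] algebraic_int_imp_almost_integral M)
    qed
    finally show "almost_integral (of_int M * \<kappa> x)" .
  qed
qed

text \<open>At the real places where the algebra is ramified the norm form is positive definite, so there
  the reduced norm alone bounds the coordinates.\<close>

theorem finite_bounded_in_order:
  fixes e :: "'f::field_char_0 \<Rightarrow> 'b::ring_1" and \<iota> :: "'b \<Rightarrow> real^2^2"
  assumes nf: "is_number_field TYPE('f)" and tr: "is_totally_real TYPE('f)"
    and qa: "is_quaternion_algebra e" and split: "{\<sigma>. is_ring_hom \<sigma> \<and> is_split_real e \<sigma>} = {v}"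
    and \<iota>: "is_mat_hom \<iota>" "\<And>c. \<iota> (e c) = mat (v c)" and R: "is_order e R"
  shows "finite {x \<in> R. reduced_norm e x = \<nu> \<and> (\<forall>m n. \<bar>\<iota> x $ m $ n\<bar> \<le> C)}" (is "finite ?S")
proof -
  have v: "is_ring_hom v" using split by blast
  obtain a b i j where "quaternion_matrices e a b i j v \<iota>" using quaternion_matrices_ex[OF qa v \<iota>] .
  then interpret quaternion_matrices e a b i j v \<iota> .
  obtain ct cu cv cw where c: "\<And>x. x = quat (ct x) (cu x) (cv x) (cw x)" using quat_ex by metis
  \<comment> \<open>Indexing the coordinates lets one map into a product of four finite sets finish
    the argument.\<close>
  define \<kappa> where "\<kappa> k = [ct, cu, cv, cw] ! k" for k :: nat
  have \<kappa>4: "\<kappa> 0 = ct" "\<kappa> 1 = cu" "\<kappa> 2 = cv" "\<kappa> 3 = cw" by (simp_all add: \<kappa>_def)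
  have k4: "k = 0 \<or> k = 1 \<or> k = 2 \<or> k = 3" if "k < 4" for k :: nat using that by auto
  have add: "\<kappa> k (x + y) = \<kappa> k x + \<kappa> k y" if "k < 4" for k x y
  proof -
    have "quat (ct (x + y)) (cu (x + y)) (cv (x + y)) (cw (x + y)) =
      quat (ct x + ct y) (cu x + cu y) (cv x + cv y) (cw x + cw y)"
      by (simp only: c[symmetric] quat_add[symmetric])
    then show ?thesis using k4[OF that] by (auto simp: quat_inject \<kappa>_def)
  qed
  have scale: "\<kappa> k (e d * x) = d * \<kappa> k x" if "k < 4" for k x d
  proof -
    have "quat (ct (e d * x)) (cu (e d * x)) (cv (e d * x)) (cw (e d * x)) =
      quat (d * ct x) (d * cu x) (d * cv x) (d * cw x)"
      by (simp only: c[symmetric] quat_scale[symmetric])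
    then show ?thesis using k4[OF that] by (auto simp: quat_inject \<kappa>_def)
  qed
  have "\<exists>N::int. N \<noteq> 0 \<and> (\<forall>x\<in>R. almost_integral (of_int N * \<kappa> k x))" if "k < 4" for k
    using order_coordinates_almost_integral[OF nf R add[OF that] scale[OF that]] by metis
  then obtain N :: "nat \<Rightarrow> int" where N: "\<And>k. k < 4 \<Longrightarrow> N k \<noteq> 0"
    "\<And>k x. k < 4 \<Longrightarrow> x \<in> R \<Longrightarrow> almost_integral (of_int (N k) * \<kappa> k x)" by metis
  have bounded: "\<exists>M. \<forall>x\<in>?S. \<bar>\<sigma> (\<kappa> k x)\<bar> \<le> M" if \<sigma>: "is_ring_hom \<sigma>" and k: "k < 4" for \<sigma> :: "'f \<Rightarrow> real" and k
  proof (cases "\<sigma> = v")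
    case True
    have nz: "v a \<noteq> 0" "v b \<noteq> 0" using ab_nz ring_hom_eq_0_iff[OF v] by auto
    have lin: "\<exists>M. \<forall>x\<in>?S. \<bar>f x\<bar> \<le> M"
      if "d \<noteq> 0" "\<And>x. d * f x = A$1$1 * \<iota> x$1$1 + A$1$2 * \<iota> x$2$1 + A$2$1 * \<iota> x$1$2 + A$2$2 * \<iota> x$2$2"
      for d and f :: "'b \<Rightarrow> real" and A :: "real^2^2"
    proof (intro exI ballI)
      fix x assume x: "x \<in> ?S"
      have le: "\<bar>r * \<iota> x $ m $ n\<bar> \<le> \<bar>r\<bar> * C" for r m n
        using x by (simp add: abs_mult mult_left_mono)
      have "\<bar>d\<bar> * \<bar>f x\<bar> = \<bar>A$1$1 * \<iota> x$1$1 + A$1$2 * \<iota> x$2$1 + A$2$1 * \<iota> x$1$2 + A$2$2 * \<iota> x$2$2\<bar>"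
        by (simp only: abs_mult[symmetric] that(2))
      also have "\<dots> \<le> (\<bar>A$1$1\<bar> + \<bar>A$1$2\<bar> + \<bar>A$2$1\<bar> + \<bar>A$2$2\<bar>) * C"
        unfolding distrib_right by (intro abs_triangle_ineq[THEN order_trans] add_mono le)
      finally show "\<bar>f x\<bar> \<le> (\<bar>A$1$1\<bar> + \<bar>A$1$2\<bar> + \<bar>A$2$1\<bar> + \<bar>A$2$2\<bar>) * C / \<bar>d\<bar>"
        using that(1) by (simp add: field_simps)
    qed
    note ct = coordinate_traces[OF c]
    have "\<exists>M. \<forall>x\<in>?S. \<bar>v (ct x)\<bar> \<le> M" by (rule lin[of 2 _ "mat 1"]) (simp_all add: ct)
    moreover have "\<exists>M. \<forall>x\<in>?S. \<bar>v (cu x)\<bar> \<le> M"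
      by (rule lin[of "2 * v a" _ "\<iota> i"]) (simp_all only: ct nz mult_eq_0_iff, simp_all)
    moreover have "\<exists>M. \<forall>x\<in>?S. \<bar>v (cv x)\<bar> \<le> M"
      by (rule lin[of "2 * v b" _ "\<iota> j"]) (simp_all only: ct nz mult_eq_0_iff, simp_all)
    moreover have "\<exists>M. \<forall>x\<in>?S. \<bar>v (cw x)\<bar> \<le> M"
      by (rule lin[of "- (2 * v a * v b)" _ "\<iota> (i * j)"]) (simp_all only: ct nz mult_eq_0_iff neg_equal_0_iff_equal, simp_all)
    ultimately show ?thesis unfolding True by - (insert k4[OF k], elim disjE, simp_all only: \<kappa>4)
  next
    case False
    then have "\<not> is_split_real e \<sigma>" using split \<sigma> by auto
    then have neg: "\<sigma> a < 0" "\<sigma> b < 0" using not_split_negative[OF \<sigma>] by auto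
    define s where "s x = (\<sigma> (ct x))\<^sup>2 + (- \<sigma> a) * (\<sigma> (cu x))\<^sup>2 + (- \<sigma> b) * (\<sigma> (cv x))\<^sup>2
      + (\<sigma> a * \<sigma> b) * (\<sigma> (cw x))\<^sup>2" for x
    have s: "s x = \<sigma> \<nu>" if "x \<in> ?S" for x
    proof -
      \<comment> \<open>The norm is computed through \<open>v\<close>; injectivity of
        \<open>v\<close> gives an identity in F, to which the other place \<sigma> can be
        applied.\<close>
      have "v (reduced_norm e x) = v ((ct x)\<^sup>2 - a * (cu x)\<^sup>2 - b * (cv x)\<^sup>2 + a * b * (cw x)\<^sup>2)"
        using reduced_norm_det[OF qa v \<iota>, of x] det_rep[of "ct x" "cu x" "cv x" "cw x", folded c] by simp
      then have "\<nu> = (ct x)\<^sup>2 - a * (cu x)\<^sup>2 - b * (cv x)\<^sup>2 + a * b * (cw x)\<^sup>2"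
        using that by (simp add: ring_hom_eq_iff[OF v])
      then show ?thesis
        by (simp add: s_def ring_hom_add[OF \<sigma>] ring_hom_diff[OF \<sigma>] ring_hom_mult[OF \<sigma>] ring_hom_power[OF \<sigma>])
    qed
    have pos: "- \<sigma> a > 0" "- \<sigma> b > 0" "\<sigma> a * \<sigma> b > 0" using neg by (auto simp: mult_neg_neg)
    have nonneg: "(\<sigma> (ct x))\<^sup>2 \<ge> 0" "(- \<sigma> a) * (\<sigma> (cu x))\<^sup>2 \<ge> 0" "(- \<sigma> b) * (\<sigma> (cv x))\<^sup>2 \<ge> 0"
      "(\<sigma> a * \<sigma> b) * (\<sigma> (cw x))\<^sup>2 \<ge> 0" for x
      by (rule zero_le_power2 mult_nonneg_nonneg[OF less_imp_le[OF pos(1)]]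
          mult_nonneg_nonneg[OF less_imp_le[OF pos(2)]] mult_nonneg_nonneg[OF less_imp_le[OF pos(3)]])+
    have sle: "(\<sigma> (ct x))\<^sup>2 \<le> s x" "(- \<sigma> a) * (\<sigma> (cu x))\<^sup>2 \<le> s x"
      "(- \<sigma> b) * (\<sigma> (cv x))\<^sup>2 \<le> s x" "(\<sigma> a * \<sigma> b) * (\<sigma> (cw x))\<^sup>2 \<le> s x" for x
      using nonneg[of x] unfolding s_def by linarith+
    have quad: "\<exists>M. \<forall>x\<in>?S. \<bar>f x\<bar> \<le> M" if "d > 0" "\<And>x. d * (f x)\<^sup>2 \<le> s x" for d and f :: "'b \<Rightarrow> real"
    proof (intro exI ballI)
      fix x assume "x \<in> ?S"
      then have "d * (f x)\<^sup>2 \<le> \<sigma> \<nu>" using that(2)[of x] s by simp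
      then have "(f x)\<^sup>2 \<le> \<sigma> \<nu> / d" using that(1) by (simp add: field_simps)
      moreover have "\<bar>f x\<bar> \<le> 1 + (f x)\<^sup>2"
        using zero_le_power2[of "\<bar>f x\<bar> - 1"] zero_le_power2[of "f x"] unfolding power2_diff power2_abs one_power2 mult_1_right by linarith
      ultimately show "\<bar>f x\<bar> \<le> 1 + \<sigma> \<nu> / d" by linarith
    qed
    have "\<exists>M. \<forall>x\<in>?S. \<bar>\<sigma> (ct x)\<bar> \<le> M" by (rule quad[of 1]) (simp, unfold mult_1, rule sle)
    moreover have "\<exists>M. \<forall>x\<in>?S. \<bar>\<sigma> (cu x)\<bar> \<le> M"
      by (rule quad[OF pos(1)]) (rule sle)
    moreover have "\<exists>M. \<forall>x\<in>?S. \<bar>\<sigma> (cv x)\<bar> \<le> M"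
      by (rule quad[OF pos(2)]) (rule sle)
    moreover have "\<exists>M. \<forall>x\<in>?S. \<bar>\<sigma> (cw x)\<bar> \<le> M"
      by (rule quad[OF pos(3)]) (rule sle)
    ultimately show ?thesis by - (insert k4[OF k], elim disjE, simp_all only: \<kappa>4)
  qed
  define M where "M \<sigma> k = (SOME M. \<forall>x\<in>?S. \<bar>\<sigma> (\<kappa> k x)\<bar> \<le> M)" for \<sigma> :: "'f \<Rightarrow> real" and k
  have M: "\<bar>\<sigma> (\<kappa> k x)\<bar> \<le> M \<sigma> k" if "is_ring_hom \<sigma>" "k < 4" "x \<in> ?S" for \<sigma> :: "'f \<Rightarrow> real" and k x
    using someI_ex[OF bounded[OF that(1,2)]] that(3) unfolding M_def by blast
  define D where "D k = {z::'f. almost_integral z \<and>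
    (\<forall>\<sigma> :: 'f \<Rightarrow> real. is_ring_hom \<sigma> \<longrightarrow> \<bar>\<sigma> z\<bar> \<le> \<bar>of_int (N k)\<bar> * M \<sigma> k)}" for k
  define \<Phi> where "\<Phi> x = (\<lambda>k\<in>{..<4}. of_int (N k) * \<kappa> k x)" for x
  have "\<Phi> ` ?S \<subseteq> Pi\<^sub>E {..<4} D"
  proof (rule image_subsetI)
    fix x assume x: "x \<in> ?S"
    have "of_int (N k) * \<kappa> k x \<in> D k" if k: "k < 4" for k
      unfolding D_def using N(2)[OF k] x M[OF _ k x]
      by (auto simp: ring_hom_mult ring_hom_of_int abs_mult intro!: mult_left_mono)
    then show "\<Phi> x \<in> Pi\<^sub>E {..<4} D" by (auto simp: \<Phi>_def)
  qed
  moreover have "finite (Pi\<^sub>E {..<4} D)"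
    unfolding D_def by (intro finite_PiE finite_bounded_almost_integral nf tr) auto
  ultimately have "finite (\<Phi> ` ?S)" by (rule finite_subset)
  moreover have "inj_on \<Phi> ?S"
  proof (rule inj_onI)
    fix x y assume eq: "\<Phi> x = \<Phi> y"
    have "\<kappa> k x = \<kappa> k y" if "k < 4" for k
      using fun_cong[OF eq, of k] N(1)[OF that] that by (simp add: \<Phi>_def)
    from this[of 0] this[of 1] this[of 2] this[of 3]
    have "ct x = ct y" "cu x = cu y" "cv x = cv y" "cw x = cw y" by (simp_all add: \<kappa>_def)
    then show "x = y" using c[of x] c[of y] by simp
  qed
  ultimately show ?thesis by (rule finite_imageD)
qed

section \<open>Binary quadratic forms of discriminant one\<close>

text \<open>Up to sign, A + C is sinh of the distance from i to the geodesic of the form, and h / y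
  is cosh of the distance from i to x + iy. A geodesic separating the two points is no farther from
  i than the second point.\<close>

lemma binary_form_bound_interior:
  fixes x y :: real
  assumes y: "y > 0"
  obtains K where "\<And>A B C. B\<^sup>2 - 4 * A * C = 1 \<Longrightarrow>
    (A + C > 0) \<noteq> (A * (x\<^sup>2 + y\<^sup>2) + B * x + C > 0) \<Longrightarrow> \<bar>A\<bar> \<le> K \<and> \<bar>B\<bar> \<le> K \<and> \<bar>C\<bar> \<le> (K::real)"
proof -
  define h where "h = (x\<^sup>2 + y\<^sup>2 + 1) / 2"
  have h: "h > 0" using y unfolding h_def by (simp add: add_nonneg_pos)
  define k where "k = (x\<^sup>2 + y\<^sup>2 - 1) / 2"
  define K where "K = 1 + (h / y)\<^sup>2 + h / y"
  show ?thesis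
  proof (rule that[of K])
    fix A B C :: real
    assume disc: "B\<^sup>2 - 4 * A * C = 1" and sep: "(A + C > 0) \<noteq> (A * (x\<^sup>2 + y\<^sup>2) + B * x + C > 0)"
    \<comment> \<open>Discriminant 1 becomes the hyperboloid d^2 + B^2 = 1 + s^2, and the value at x
      + iy becomes s h + L. Cauchy-Schwarz for (d, B) and (k, x) bounds L.\<close>
    define s d L where "s = A + C" and "d = A - C" and "L = d * k + B * x"
    have q: "A * (x\<^sup>2 + y\<^sup>2) + B * x + C = s * h + L"
      by (simp add: s_def d_def L_def h_def k_def field_simps)
    have dB: "d\<^sup>2 + B\<^sup>2 = 1 + s\<^sup>2" using disc by (simp add: s_def d_def power2_eq_square algebra_simps)
    have kx: "k\<^sup>2 + x\<^sup>2 = h\<^sup>2 - y\<^sup>2" by (simp add: h_def k_def power2_eq_square field_simps)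
    have "L\<^sup>2 + (d * x - B * k)\<^sup>2 = (d\<^sup>2 + B\<^sup>2) * (k\<^sup>2 + x\<^sup>2)"
      by (simp add: L_def power2_eq_square algebra_simps)
    then have L: "L\<^sup>2 \<le> (1 + s\<^sup>2) * (h\<^sup>2 - y\<^sup>2)"
      using zero_le_power2[of "d * x - B * k"] unfolding dB kx by linarith
    have "\<bar>s * h\<bar> \<le> \<bar>L\<bar>"
    proof (cases "s > 0")
      case True
      then have "s * h + L \<le> 0" using sep q by (simp add: s_def)
      moreover have "s * h > 0" using True h by simp
      ultimately show ?thesis by linarith
    next
      case False
      then have "s * h + L > 0" using sep q by (simp add: s_def)
      moreover have "s * h \<le> 0" using False h by (simp add: mult_nonpos_nonneg)
      ultimately show ?thesis by linarith
    qed
    then have "(s * h)\<^sup>2 \<le> L\<^sup>2" by (simp add: abs_le_square_iff)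
    with L have "s\<^sup>2 * h\<^sup>2 \<le> (1 + s\<^sup>2) * (h\<^sup>2 - y\<^sup>2)" by (simp add: power_mult_distrib)
    then have "s\<^sup>2 * y\<^sup>2 \<le> h\<^sup>2 - y\<^sup>2" by (simp add: algebra_simps)
    then have "(s * y)\<^sup>2 \<le> h\<^sup>2" using zero_le_power2[of y] unfolding power_mult_distrib by linarith
    then have "\<bar>s * y\<bar> \<le> h" using h by (metis abs_le_square_iff abs_of_pos)
    then have s: "\<bar>s\<bar> \<le> h / y" using y by (simp add: abs_mult field_simps)
    then have "s\<^sup>2 \<le> (h / y)\<^sup>2" by (metis abs_ge_zero power2_abs power_mono)
    then have dB': "d\<^sup>2 \<le> 1 + (h / y)\<^sup>2" "B\<^sup>2 \<le> 1 + (h / y)\<^sup>2"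
      using dB zero_le_power2[of d] zero_le_power2[of B] by linarith+
    have sq: "\<bar>r\<bar> \<le> 1 + (h / y)\<^sup>2" if "r\<^sup>2 \<le> 1 + (h / y)\<^sup>2" for r :: real
    proof -
      have "2 * \<bar>r\<bar> \<le> r\<^sup>2 + 1"
        using zero_le_power2[of "\<bar>r\<bar> - 1"] unfolding power2_diff power2_abs one_power2 mult_1_right by linarith
      then show ?thesis using that zero_le_power2[of "h / y"] by linarith
    qed
    have "h / y > 0" using h y by simp
    then show "\<bar>A\<bar> \<le> K \<and> \<bar>B\<bar> \<le> K \<and> \<bar>C\<bar> \<le> K"
      using sq[OF dB'(1)] sq[OF dB'(2)] s unfolding K_def s_def d_def by linarith
  qed
qed

text \<open>The values \<open>E\<close> at r and \<open>A + E\<close> at r + i satisfy E (A + E)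
  \<le> 0, so discriminant 1 of the form translated by r bounds \<open>E\<close> and the middle
  coefficient. The leading coefficient is controlled by 4|A||E| \<le> 1 once \<open>E\<close> stays
  away from 0.\<close>

lemma binary_form_bound_cusp:
  fixes r \<epsilon> :: real
  assumes \<epsilon>: "\<epsilon> > 0"
  obtains K where "\<And>A B C. B\<^sup>2 - 4 * A * C = 1 \<Longrightarrow>
    (A * (r\<^sup>2 + 1) + B * r + C > 0) \<noteq> (A * r\<^sup>2 + B * r + C > 0) \<Longrightarrow> \<epsilon> \<le> \<bar>A * r\<^sup>2 + B * r + C\<bar> \<Longrightarrow>
    \<bar>A\<bar> \<le> K \<and> \<bar>B\<bar> \<le> K \<and> \<bar>C\<bar> \<le> (K::real)"
proof -
  \<comment> \<open>\<open>a\<close> comes from 4|A|\<epsilon> \<le> 1, and \<open>b\<close> from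
    undoing the translation, B = B' - 2 A r.\<close>
  define a b where "a = 1 / (4 * \<epsilon>)" and "b = 1 + 2 * a * \<bar>r\<bar>"
  have a: "a > 0" using \<epsilon> by (simp add: a_def)
  then have b: "b > 0" unfolding b_def by (simp add: add_pos_nonneg)
  define K where "K = a + b + (1 + a * r\<^sup>2 + b * \<bar>r\<bar>)"
  show ?thesis
  proof (rule that[of K])
    fix A B C :: real
    assume disc: "B\<^sup>2 - 4 * A * C = 1"
      and sep: "(A * (r\<^sup>2 + 1) + B * r + C > 0) \<noteq> (A * r\<^sup>2 + B * r + C > 0)"
      and big: "\<epsilon> \<le> \<bar>A * r\<^sup>2 + B * r + C\<bar>"
    define E B' where "E = A * r\<^sup>2 + B * r + C" and "B' = B + 2 * A * r"
    have d: "B'\<^sup>2 - 4 * A * E = 1" using disc by (simp add: E_def B'_def power2_eq_square algebra_simps)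
    have e: "A * (r\<^sup>2 + 1) + B * r + C = A + E" by (simp add: E_def algebra_simps)
    have "(A + E > 0) \<noteq> (E > 0)" using sep unfolding e E_def[symmetric] .
    then have "E * (A + E) \<le> 0" by (auto simp: mult_le_0_iff)
    then have *: "4 * E\<^sup>2 + B'\<^sup>2 \<le> 1" using d by (simp add: power2_eq_square algebra_simps)
    then have "E\<^sup>2 \<le> 1" "B'\<^sup>2 \<le> 1" using zero_le_power2[of E] zero_le_power2[of B'] by linarith+
    then have E1: "\<bar>E\<bar> \<le> 1" and B1: "\<bar>B'\<bar> \<le> 1" by (simp_all add: abs_square_le_1)
    have "B'\<^sup>2 - 1 = 4 * A * E" using d by simp
    then have "4 * \<bar>A\<bar> * \<bar>E\<bar> = \<bar>B'\<^sup>2 - 1\<bar>" by (simp add: abs_mult)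
    also have "\<dots> \<le> 1" using \<open>B'\<^sup>2 \<le> 1\<close> zero_le_power2[of B'] by linarith
    finally have "4 * \<bar>A\<bar> * \<bar>E\<bar> \<le> 1" .
    moreover have "\<bar>A\<bar> * \<epsilon> \<le> \<bar>A\<bar> * \<bar>E\<bar>" using big by (intro mult_left_mono) (auto simp: E_def)
    ultimately have "\<bar>A\<bar> * (4 * \<epsilon>) \<le> 1" by linarith
    then have A: "\<bar>A\<bar> \<le> a" using \<epsilon> by (simp add: a_def field_simps)
    have "\<bar>A * r\<bar> \<le> a * \<bar>r\<bar>" using A by (simp add: abs_mult mult_right_mono)
    then have B: "\<bar>B\<bar> \<le> b" using B1 unfolding B'_def b_def by linarith
    have "\<bar>A * r\<^sup>2\<bar> \<le> a * r\<^sup>2" "\<bar>B * r\<bar> \<le> b * \<bar>r\<bar>" using A B by (simp_all add: abs_mult mult_right_mono)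
    then have C: "\<bar>C\<bar> \<le> 1 + a * r\<^sup>2 + b * \<bar>r\<bar>" using E1 unfolding E_def by linarith
    have "0 \<le> 1 + a * r\<^sup>2 + b * \<bar>r\<bar>" using a b by simp
    then show "\<bar>A\<bar> \<le> K \<and> \<bar>B\<bar> \<le> K \<and> \<bar>C\<bar> \<le> K" using A B C a b unfolding K_def by linarith
  qed
qed

section \<open>Fixed points of commuting matrices\<close>

text \<open>A matrix commuting with M preserves its eigenspaces, and the eigenspace of (z, 1) is a
  line because M is not scalar.\<close>

lemma moebius_commuting_fixed:
  fixes X M :: "'a::field^2^2"
  assumes comm: "X ** M = M ** X" and det: "det X \<noteq> 0"
    and eigen: "M$1$1 * z + M$1$2 = l * z" "M$2$1 * z + M$2$2 = l"
    and nonscalar: "\<And>r. M \<noteq> mat r"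
  shows "moebius X (Pt z) = Pt z"
proof -
  define p q where "p = X$1$1 * z + X$1$2" and "q = X$2$1 * z + X$2$2"
  have c: "X$1$1 * M$1$1 + X$1$2 * M$2$1 = M$1$1 * X$1$1 + M$1$2 * X$2$1"
    "X$1$1 * M$1$2 + X$1$2 * M$2$2 = M$1$1 * X$1$2 + M$1$2 * X$2$2"
    "X$2$1 * M$1$1 + X$2$2 * M$2$1 = M$2$1 * X$1$1 + M$2$2 * X$2$1"
    "X$2$1 * M$1$2 + X$2$2 * M$2$2 = M$2$1 * X$1$2 + M$2$2 * X$2$2"
    using comm unfolding mat2_eq_iff mat2_mult_entry by auto
  have "M$1$1 * p + M$1$2 * q =
      (M$1$1 * X$1$1 + M$1$2 * X$2$1) * z + (M$1$1 * X$1$2 + M$1$2 * X$2$2)"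
    by (simp add: p_def q_def algebra_simps)
  also have "\<dots> = X$1$1 * (M$1$1 * z + M$1$2) + X$1$2 * (M$2$1 * z + M$2$2)"
    unfolding c[symmetric] by (simp add: algebra_simps)
  also have "\<dots> = l * p" unfolding eigen by (simp add: p_def algebra_simps)
  finally have e1: "M$1$1 * p + M$1$2 * q = l * p" .
  have "M$2$1 * p + M$2$2 * q =
      (M$2$1 * X$1$1 + M$2$2 * X$2$1) * z + (M$2$1 * X$1$2 + M$2$2 * X$2$2)"
    by (simp add: p_def q_def algebra_simps)
  also have "\<dots> = X$2$1 * (M$1$1 * z + M$1$2) + X$2$2 * (M$2$1 * z + M$2$2)"
    unfolding c[symmetric] by (simp add: algebra_simps)
  also have "\<dots> = l * q" unfolding eigen by (simp add: q_def algebra_simps)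
  finally have e2: "M$2$1 * p + M$2$2 * q = l * q" .
  have M12: "M$1$2 = l * z - M$1$1 * z" and M22: "M$2$2 = l - M$2$1 * z"
    using eigen by (simp_all add: algebra_simps)
  have z1: "(M$1$1 - l) * (p - q * z) = 0" using e1 unfolding M12 by (simp add: algebra_simps)
  have z2: "M$2$1 * (p - q * z) = 0" using e2 unfolding M22 by (simp add: algebra_simps)
  have p: "p = q * z"
  proof (rule ccontr)
    assume "p \<noteq> q * z"
    then have "M$1$1 = l" "M$2$1 = 0" using z1 z2 by auto
    then have "M = mat l" using M12 M22 by (simp add: mat2_eq_iff)
    then show False using nonscalar by blast
  qed
  have "q \<noteq> 0"
  proof
    assume q0: "q = 0"
    then have "X$1$2 = - X$1$1 * z" "X$2$2 = - X$2$1 * z"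
      using p by (simp_all add: p_def q_def eq_neg_iff_add_eq_0 add.commute)
    then have "det X = 0" by (simp add: det_2)
    then show False using det by simp
  qed
  then show ?thesis using p by (simp add: p_def q_def)
qed

section \<open>The ring of integers of the completion\<close>

locale nonarch_embedding =
  fixes v :: "'c::field \<Rightarrow> real" and j :: "'f::field \<Rightarrow> 'c"
  assumes nonarch: "is_nonarch_abs v" and hom_j: "is_ring_hom j"
begin

lemma abs_nonneg: "0 \<le> v x" and abs_eq_0_iff: "v x = 0 \<longleftrightarrow> x = 0" and abs_mult_v: "v (x * y) = v x * v y"
  and abs_add_le: "v (x + y) \<le> max (v x) (v y)"
  using nonarch by (auto simp: is_nonarch_abs_def)

lemma abs_one: "v 1 = 1"
  using abs_mult_v[of 1 1] abs_eq_0_iff[of 1] by simp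

lemma abs_minus: "v (- x) = v x"
proof -
  have "v (-1) * v (-1) = 1" using abs_mult_v[of "-1" "-1"] abs_one by simp
  then have "(v (-1))\<^sup>2 = 1" by (simp add: power2_eq_square)
  then have "v (-1) = 1" using abs_nonneg[of "-1"] by (simp add: power2_eq_1_iff)
  then show ?thesis using abs_mult_v[of "-1" x] by simp
qed

lemma abs_diff_le: "v (x - y) \<le> max (v x) (v y)"
  using abs_add_le[of x "- y"] by (simp add: abs_minus)

text \<open>Among x, y and x - y the largest absolute value is attained at least twice.\<close>

lemma abs_eq_of_close: assumes "v (x - y) < v x" shows "v y = v x"
  using abs_diff_le[of x "x - y"] abs_add_le[of y "x - y"] assms by (simp add: max_def split: if_splits)

lemma abs_divide: "y \<noteq> 0 \<Longrightarrow> v (x / y) = v x / v y"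
  using abs_mult_v[of "x / y" y] abs_eq_0_iff[of y] by (simp add: field_simps)

lemma completionI_range: "j x \<in> completion_in v j"
proof -
  have "v (j x - j x) < \<epsilon>" if "\<epsilon> > 0" for \<epsilon> using abs_eq_0_iff[of 0] that by simp
  then show ?thesis unfolding completion_in_def abs_closure_def by blast
qed

lemma completion_approx:
  assumes "z \<in> completion_in v j" "\<epsilon> > 0"
  obtains x where "v (z - j x) < \<epsilon>"
  using assms unfolding completion_in_def abs_closure_def by auto

lemma completionI: "(\<And>\<epsilon>. \<epsilon> > 0 \<Longrightarrow> \<exists>x. v (z - j x) < \<epsilon>) \<Longrightarrow> z \<in> completion_in v j"
  unfolding completion_in_def abs_closure_def by auto

lemma completion_diff:
  assumes "y \<in> completion_in v j" "z \<in> completion_in v j"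
  shows "y - z \<in> completion_in v j"
proof (rule completionI)
  fix \<epsilon> :: real assume \<epsilon>: "\<epsilon> > 0"
  obtain a b where ab: "v (y - j a) < \<epsilon>" "v (z - j b) < \<epsilon>"
    using completion_approx[OF assms(1) \<epsilon>] completion_approx[OF assms(2) \<epsilon>] by metis
  have e: "y - z - j (a - b) = (y - j a) - (z - j b)" by (simp add: ring_hom_diff[OF hom_j])
  have "v (y - z - j (a - b)) < \<epsilon>" unfolding e using abs_diff_le[of "y - j a" "z - j b"] ab by linarith
  then show "\<exists>x. v (y - z - j x) < \<epsilon>" by blast
qed

lemma completion_mult:
  assumes "y \<in> completion_in v j" "z \<in> completion_in v j"
  shows "y * z \<in> completion_in v j"
proof (rule completionI)
  fix \<epsilon> :: real assume \<epsilon>: "\<epsilon> > 0"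
  \<comment> \<open>The bound \<delta> \<le> 1 keeps the absolute value of j b below that of z plus
    1; the denominator then absorbs both error terms.\<close>
  define \<delta> where "\<delta> = min 1 (\<epsilon> / (1 + v y + v z))"
  have pos: "1 + v y + v z > 0" using abs_nonneg[of y] abs_nonneg[of z] by simp
  have \<delta>: "\<delta> > 0" "\<delta> \<le> 1" "\<delta> * (1 + v y + v z) \<le> \<epsilon>"
    using \<epsilon> pos mult_right_mono[of \<delta> "\<epsilon> / (1 + v y + v z)" "1 + v y + v z"] by (auto simp: \<delta>_def)
  obtain a b where ab: "v (y - j a) < \<delta>" "v (z - j b) < \<delta>"
    using completion_approx[OF assms(1) \<delta>(1)] completion_approx[OF assms(2) \<delta>(1)] by metis
  have "v (j b) \<le> max (v z) (v (z - j b))" using abs_diff_le[of z "z - j b"] by simp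
  then have jb: "v (j b) \<le> v z + 1" using ab \<delta> abs_nonneg[of z] by auto
  have e: "y * z - j (a * b) = y * (z - j b) + (y - j a) * j b"
    by (simp add: ring_hom_mult[OF hom_j] algebra_simps)
  have "v (y * z - j (a * b)) \<le> max (v (y * (z - j b))) (v ((y - j a) * j b))"
    unfolding e by (rule abs_add_le)
  moreover have "v (y * (z - j b)) < \<epsilon>"
  proof -
    have "v (y * (z - j b)) \<le> v y * \<delta>" using ab abs_nonneg[of y] by (simp add: abs_mult_v mult_left_mono)
    also have "\<dots> < (1 + v y + v z) * \<delta>" using \<delta>(1) abs_nonneg[of z] by (intro mult_strict_right_mono) auto
    finally show ?thesis using \<delta>(3) by (simp add: mult.commute)
  qed
  moreover have "v ((y - j a) * j b) < \<epsilon>"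
  proof -
    have "v ((y - j a) * j b) \<le> v (y - j a) * (1 + v y + v z)" unfolding abs_mult_v
      using jb abs_nonneg[of y] abs_nonneg[of "y - j a"] by (intro mult_left_mono) linarith+
    also have "\<dots> < \<delta> * (1 + v y + v z)" using ab pos by (intro mult_strict_right_mono)
    finally show ?thesis using \<delta>(3) by simp
  qed
  ultimately show "\<exists>x. v (y * z - j x) < \<epsilon>" by (intro exI[of _ "a * b"]) auto
qed

text \<open>Approximation within 1 forces the approximant to have absolute value 1 too, and
  inversion preserves distances between such elements.\<close>

lemma completion_inverse:
  assumes "z \<in> completion_in v j" "v z = 1"
  shows "inverse z \<in> completion_in v j"
proof (rule completionI)
  fix \<epsilon> :: real assume \<epsilon>: "\<epsilon> > 0"
  have z0: "z \<noteq> 0" using assms(2) abs_eq_0_iff[of z] by auto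
  have "min 1 \<epsilon> > 0" using \<epsilon> by simp
  then obtain a where a: "v (z - j a) < min 1 \<epsilon>" by (rule completion_approx[OF assms(1)])
  then have ja: "v (j a) = 1" using abs_eq_of_close[of z "j a"] assms(2) by simp
  then have j0: "j a \<noteq> 0" using abs_eq_0_iff[of "j a"] by auto
  then have "a \<noteq> 0" using ring_hom_zero[OF hom_j] by auto
  then have "j (inverse a) * j a = 1" by (simp add: ring_hom_mult[OF hom_j, symmetric] ring_hom_one[OF hom_j])
  then have "j (inverse a) = 1 / j a" using j0 by (simp add: eq_divide_eq)
  then have e: "inverse z - j (inverse a) = - ((z - j a) / (z * j a))"
    using z0 j0 by (simp add: field_simps)
  have "z * j a \<noteq> 0" using z0 j0 by simp
  then have "v (inverse z - j (inverse a)) = v (z - j a)"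
    unfolding e abs_minus by (subst abs_divide) (simp_all add: abs_mult_v ja assms(2))
  then show "\<exists>x. v (inverse z - j x) < \<epsilon>" using a by (intro exI[of _ "inverse a"]) simp
qed

abbreviation "Z \<equiv> completion_integers_in v j"

lemma Z_abs: "x \<in> Z \<Longrightarrow> v x \<le> 1" and Z_completion: "x \<in> Z \<Longrightarrow> x \<in> completion_in v j"
  by (auto simp: completion_integers_in_def)

lemma Z_one: "1 \<in> Z" and Z_zero: "0 \<in> Z"
  using completionI_range[of 1] completionI_range[of 0] abs_one abs_eq_0_iff[of 0]
  by (auto simp: completion_integers_in_def ring_hom_one[OF hom_j] ring_hom_zero[OF hom_j])

lemma Z_diff: "x \<in> Z \<Longrightarrow> y \<in> Z \<Longrightarrow> x - y \<in> Z"
  using abs_diff_le[of x y] completion_diff[of x y] by (auto simp: completion_integers_in_def)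

lemma Z_mult: "x \<in> Z \<Longrightarrow> y \<in> Z \<Longrightarrow> x * y \<in> Z"
  using completion_mult[of x y] abs_nonneg[of x] abs_nonneg[of y]
  by (auto simp: completion_integers_in_def abs_mult_v mult_le_one)

text \<open>If \<open>(c, d)\<close> is a row of a matrix in \<open>SL\<^sub>2\<close> over the integers, then \<open>c\<close> or \<open>d\<close> is a unit. In the
  first case \<open>c z + d = c (z - t)\<close> with \<open>t = - d / c\<close> integral, in the second case
  \<open>|c z| < 1 = |d|\<close>.\<close>

lemma abs_primitive_form:
  assumes Z: "a \<in> Z" "b \<in> Z" "c \<in> Z" "d \<in> Z" and det: "a * d - b * c = 1"
    and z: "v z \<le> 1" "\<And>t. t \<in> Z \<Longrightarrow> v (z - t) \<ge> 1"
  shows "v (c * z + d) = 1"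
proof -
  have le: "v (c * z + d) \<le> 1"
    using abs_add_le[of "c * z" d] Z_abs[OF Z(3)] Z_abs[OF Z(4)] z(1) abs_nonneg[of c] abs_nonneg[of z]
      mult_le_one[of "v c" "v z"] by (simp add: abs_mult_v)
  show ?thesis
  proof (cases "v c = 1")
    case True
    then have c0: "c \<noteq> 0" using abs_eq_0_iff[of c] by auto
    have inv: "inverse c \<in> Z"
      using completion_inverse[OF Z_completion[OF Z(3)] True] abs_divide[OF c0, of 1] True abs_one
      by (simp add: completion_integers_in_def inverse_eq_divide)
    have t: "0 - d * inverse c \<in> Z" by (intro Z_diff Z_mult Z_zero Z inv)
    have "c * z + d = c * (z - (0 - d * inverse c))" using c0 by (simp add: field_simps)
    then have "v (c * z + d) = v (z - (0 - d * inverse c))" using True by (simp add: abs_mult_v)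
    then show ?thesis using z(2)[OF t] le by simp
  next
    case False
    then have c1: "v c < 1" using Z_abs[OF Z(3)] by simp
    have "v (b * c) < 1"
      using mult_left_le_one_le[OF abs_nonneg[of c] abs_nonneg[of b] Z_abs[OF Z(2)]] c1
      by (simp add: abs_mult_v)
    moreover have "1 \<le> max (v (a * d)) (v (b * c))" using abs_diff_le[of "a * d" "b * c"] det abs_one by simp
    ultimately have "1 \<le> v a * v d" by (simp add: abs_mult_v max_def split: if_splits)
    moreover have "v a * v d \<le> v d" using Z_abs[OF Z(1)] abs_nonneg[of a] abs_nonneg[of d] by (simp add: mult_left_le_one_le)
    ultimately have d1: "v d = 1" using Z_abs[OF Z(4)] by linarith
    have "v (c * z) < 1"
      using mult_right_le_one_le[OF abs_nonneg[of c] abs_nonneg[of z] z(1)] c1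
      by (simp add: abs_mult_v)
    then have "v (d + c * z) = v d"
      using d1 by (intro abs_eq_of_close) (simp add: abs_minus)
    then show ?thesis using d1 by (simp add: add.commute)
  qed
qed

text \<open>For integral t, M z - t is a quotient of two primitive linear forms in z, and each has
  absolute value 1 on the affinoid. So the image is at distance exactly 1 from every t, and t = 0
  gives its absolute value.\<close>

lemma standard_affinoid_stable:
  assumes M: "M \<in> mat2_over Z" and det: "det M = 1" and P: "P \<in> standard_affinoid v Z"
  shows "moebius M P \<in> standard_affinoid v Z"
proof -
  obtain z where z: "P = Pt z" "v z \<le> 1" "\<And>t. t \<in> Z \<Longrightarrow> v (z - t) \<ge> 1"
    using P by (auto simp: standard_affinoid_def)
  have e: "M $ i $ j \<in> Z" for i j using M by (simp add: mat2_over_def)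
  have d: "M$1$1 * M$2$2 - M$1$2 * M$2$1 = 1" using det by (simp add: det_2)
  have den: "v (M$2$1 * z + M$2$2) = 1"
    by (rule abs_primitive_form[OF e e e e d z(2,3)])
  have nz: "M$2$1 * z + M$2$2 \<noteq> 0"
  proof
    assume h: "M$2$1 * z + M$2$2 = 0"
    show False using den abs_eq_0_iff[of 0] unfolding h by simp
  qed
  have num: "v (M$1$1 * z + M$1$2 - t * (M$2$1 * z + M$2$2)) = 1" if t: "t \<in> Z" for t
  proof -
    \<comment> \<open>The numerator is the form of the second row of another determinant 1 matrix,
      with rows -(c, d) and (a - t c, b - t d).\<close>
    have "(0 - M$2$1) * (M$1$2 - t * M$2$2) - (0 - M$2$2) * (M$1$1 - t * M$2$1) = 1"
      using d by (simp add: algebra_simps)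
    note d' = this
    have Zs: "0 - M$2$1 \<in> Z" "0 - M$2$2 \<in> Z" "M$1$1 - t * M$2$1 \<in> Z" "M$1$2 - t * M$2$2 \<in> Z"
      by (rule Z_diff[OF Z_zero e] Z_diff[OF e Z_mult[OF t e]])+
    have *: "v ((M$1$1 - t * M$2$1) * z + (M$1$2 - t * M$2$2)) = 1"
      by (rule abs_primitive_form[OF Zs d' z(2,3)])
    have "M$1$1 * z + M$1$2 - t * (M$2$1 * z + M$2$2) = (M$1$1 - t * M$2$1) * z + (M$1$2 - t * M$2$2)"
      by (simp add: algebra_simps)
    then show ?thesis using * by (simp only:)
  qed
  define y where "y = (M$1$1 * z + M$1$2) / (M$2$1 * z + M$2$2)"
  have yt: "v (y - t) = 1" if "t \<in> Z" for t
  proof -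
    have "y - t = (M$1$1 * z + M$1$2 - t * (M$2$1 * z + M$2$2)) / (M$2$1 * z + M$2$2)"
      using nz by (simp add: y_def diff_divide_distrib)
    then show ?thesis using num[OF that] den nz by (simp add: abs_divide)
  qed
  have "moebius M P = Pt y" using nz by (simp add: z(1) y_def)
  then show ?thesis using yt yt[OF Z_zero] by (auto simp: standard_affinoid_def)
qed

end

lemma span_over_base:
  assumes "1 \<in> A" "x \<in> T" "sc 1 x = x"
  shows "x \<in> span_over A sc T"
  unfolding span_over_def mem_Collect_eq
  by (rule exI[of _ "{x}"], rule exI[of _ "\<lambda>_. 1"]) (use assms in auto)

section \<open>Orbits of the end points of the axis\<close>

locale embedding_cocycle =
  fixes eB :: "'f::field_char_0 \<Rightarrow> 'b::ring_1" and eK :: "'f \<Rightarrow> 'k::field_char_0"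
    and v_inf :: "'f \<Rightarrow> real" and absp :: "'c::field_char_0 \<Rightarrow> real" and jp :: "'k \<Rightarrow> 'c"
    and \<iota>_p :: "'b \<Rightarrow> 'c^2^2" and \<iota>_inf :: "'b \<Rightarrow> real^2^2" and R :: "'b set"
    and \<psi> :: "'k \<Rightarrow> 'b" and u :: 'k and \<tau>_p :: 'c
  assumes F: "is_number_field TYPE('f)" "is_totally_real TYPE('f)"
    and B: "is_quaternion_algebra eB" "{\<sigma>. is_ring_hom \<sigma> \<and> is_split_real eB \<sigma>} = {v_inf}"
    and absp: "is_nonarch_abs absp"
    and K: "is_ring_hom eK" "\<exists>\<rho> :: 'k \<Rightarrow> real. is_ring_hom \<rho> \<and> \<rho> \<circ> eK = v_inf"
    and jp: "is_ring_hom jp"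
    and \<iota>_p: "is_mat_hom \<iota>_p" "\<And>c. \<iota>_p (eB c) = mat (jp (eK c))"
    and \<iota>_inf: "is_mat_hom \<iota>_inf" "\<And>c. \<iota>_inf (eB c) = mat (v_inf c)"
    and M2Q: "is_M2Q TYPE('b) \<Longrightarrow> range \<iota>_inf = mat2_over \<rat>"
    and R: "is_order eB R" "\<And>x. x \<in> R \<Longrightarrow> \<iota>_p x \<in> mat2_over (completion_integers_in absp (jp \<circ> eK))"
    and \<psi>: "is_ring_hom \<psi>" "\<And>c. \<psi> (eK c) = eB c" "\<psi> u \<in> R"
    and c_nonzero: "\<iota>_inf (\<psi> u) $ 2 $ 1 \<noteq> 0"
    and \<tau>_p: "\<iota>_p (\<psi> u) *v vector [\<tau>_p, 1] = jp u *s vector [\<tau>_p, 1]"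
      "Pt \<tau>_p \<in> standard_affinoid absp (completion_integers_in absp (jp \<circ> eK))"
begin

definition "\<Gamma> = norm_one_units eB R"
definition "\<gamma> = \<psi> u"
definition "A0 = standard_affinoid absp (completion_integers_in absp (jp \<circ> eK))"

lemma v_inf: "is_ring_hom v_inf"
  using B(2) by blast

lemma hom_p: "is_ring_hom (\<lambda>c. jp (eK c))"
  using jp K(1) by (auto simp: is_ring_hom_def)

lemma inf_mult: "\<iota>_inf (x * y) = \<iota>_inf x ** \<iota>_inf y" and inf_one: "\<iota>_inf 1 = mat 1"
  and inf_add: "\<iota>_inf (x + y) = \<iota>_inf x + \<iota>_inf y"
  using \<iota>_inf(1) by (auto simp: is_mat_hom_def)

lemma p_mult: "\<iota>_p (x * y) = \<iota>_p x ** \<iota>_p y" and p_one: "\<iota>_p 1 = mat 1"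
  using \<iota>_p(1) by (auto simp: is_mat_hom_def)

lemma norm_det_inf: "v_inf (reduced_norm eB x) = det (\<iota>_inf x)"
  by (rule reduced_norm_det[OF B(1) v_inf \<iota>_inf])

lemma norm_det_p: "jp (eK (reduced_norm eB x)) = det (\<iota>_p x)"
  by (rule reduced_norm_det[OF B(1) hom_p \<iota>_p])

lemma inf_diff: "\<iota>_inf (x - y) = \<iota>_inf x - \<iota>_inf y"
  using inf_add[of "x - y" y] by (simp add: algebra_simps)

lemma inf_proportional:
  assumes "x \<noteq> 0" "\<And>m n. \<iota>_inf y $ m $ n = r * \<iota>_inf x $ m $ n"
  shows "\<exists>c. y = eB c * x"
proof -
  obtain a b i j where "quaternion_matrices eB a b i j v_inf \<iota>_inf"
    using quaternion_matrices_ex[OF B(1) v_inf \<iota>_inf] .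
  then show ?thesis using assms by (rule quaternion_matrices.rep_proportional)
qed

lemma inf_eq_0: assumes "\<iota>_inf x = 0" shows "x = 0"
proof -
  obtain a b i j where "quaternion_matrices eB a b i j v_inf \<iota>_inf"
    using quaternion_matrices_ex[OF B(1) v_inf \<iota>_inf] .
  then show ?thesis using assms by (rule quaternion_matrices.rep_eq_0)
qed

lemma p_proportional:
  assumes "x \<noteq> 0" "\<And>m n. \<iota>_p y $ m $ n = r * \<iota>_p x $ m $ n"
  shows "\<exists>c. y = eB c * x"
proof -
  obtain a b i j where "quaternion_matrices eB a b i j (\<lambda>c. jp (eK c)) \<iota>_p"
    using quaternion_matrices_ex[OF B(1) hom_p \<iota>_p] .
  then show ?thesis using assms by (rule quaternion_matrices.rep_proportional)
qed

text \<open>The reduced trace comes from F; with the reduced norm it yields the quadratic equation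
  of \<gamma> over F.\<close>

lemma trace_coordinate: "\<exists>T. v_inf T = \<iota>_inf x $ 1 $ 1 + \<iota>_inf x $ 2 $ 2"
proof -
  obtain a b i j where "quaternion_matrices eB a b i j v_inf \<iota>_inf"
    using quaternion_matrices_ex[OF B(1) v_inf \<iota>_inf] .
  then interpret quaternion_matrices eB a b i j v_inf \<iota>_inf .
  obtain t u' v w where x: "x = quat t u' v w" using quat_ex by blast
  have "v_inf (2 * t) = \<iota>_inf x $ 1 $ 1 + \<iota>_inf x $ 2 $ 2"
    using coordinate_traces(1)[OF x] ring_hom_of_nat[OF v_inf, of 2] by (simp add: ring_hom_mult[OF v_inf])
  then show ?thesis ..
qed

lemma u_not_scalar: "u \<noteq> eK c"
  using c_nonzero \<psi>(2)[of c] \<iota>_inf(2)[of c] by auto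

text \<open>The difference of \<gamma> and a scalar is the image of a nonzero element of the field
  K, hence invertible even if B has zero divisors.\<close>

lemma \<gamma>_minus_scalar_cancel:
  assumes "\<gamma> * x = eB c * x"
  shows "x = 0"
proof -
  have "u - eK c \<noteq> 0" using u_not_scalar by simp
  then have "\<psi> (inverse (u - eK c)) * \<psi> (u - eK c) = 1"
    by (simp add: ring_hom_mult[OF \<psi>(1), symmetric] ring_hom_one[OF \<psi>(1)])
  moreover have "\<psi> (u - eK c) * x = 0"
    using assms by (simp add: ring_hom_diff[OF \<psi>(1)] \<psi>(2) \<gamma>_def left_diff_distrib)
  ultimately show ?thesis by (metis mult.assoc mult_1 mult_zero_right)
qed

section \<open>The norm one group\<close>

lemma R_mult: "x \<in> R \<Longrightarrow> y \<in> R \<Longrightarrow> x * y \<in> R"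
proof -
  have "subring R (ring_on UNIV)" using R(1) by (simp add: is_order_def)
  then have "submonoid R (ring_on UNIV)" by (rule subring.axioms(2))
  then show "x \<in> R \<Longrightarrow> y \<in> R \<Longrightarrow> x * y \<in> R"
    using submonoid.m_closed[of R "ring_on UNIV" x y]
    by (auto simp: ring_on_def)
qed

lemma \<Gamma>_iff: "g \<in> \<Gamma> \<longleftrightarrow> g \<in> R \<and> (\<exists>h\<in>R. h * g = 1 \<and> g * h = 1) \<and> reduced_norm eB g = 1"
  by (auto simp: \<Gamma>_def norm_one_units_def Units_def ring_on_def)

lemma \<Gamma>_R: "g \<in> \<Gamma> \<Longrightarrow> g \<in> R" by (simp add: \<Gamma>_iff)

lemma det_inf: "g \<in> \<Gamma> \<Longrightarrow> det (\<iota>_inf g) = 1"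
  using norm_det_inf[of g] by (simp add: \<Gamma>_iff ring_hom_one[OF v_inf])

lemma det_p: "g \<in> \<Gamma> \<Longrightarrow> det (\<iota>_p g) = 1"
  using norm_det_p[of g] ring_hom_one[OF hom_p] by (simp add: \<Gamma>_iff)

lemma norm_mult: "reduced_norm eB (x * y) = reduced_norm eB x * reduced_norm eB y"
proof -
  have "v_inf (reduced_norm eB (x * y)) = v_inf (reduced_norm eB x * reduced_norm eB y)"
    by (simp add: norm_det_inf ring_hom_mult[OF v_inf] inf_mult det_mul)
  then show ?thesis by (simp add: ring_hom_eq_iff[OF v_inf])
qed

lemma norm_one: "reduced_norm eB 1 = 1"
  using norm_det_inf[of 1] ring_hom_eq_iff[OF v_inf, of "reduced_norm eB 1" 1]
  by (simp add: inf_one ring_hom_one[OF v_inf])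

lemma \<Gamma>_mult: assumes "g \<in> \<Gamma>" "h \<in> \<Gamma>" shows "g * h \<in> \<Gamma>"
proof -
  obtain g' h' where *: "g' \<in> R" "g' * g = 1" "g * g' = 1" "h' \<in> R" "h' * h = 1" "h * h' = 1"
    using assms by (auto simp: \<Gamma>_iff)
  have "(h' * g') * (g * h) = h' * (g' * g) * h" by (simp add: mult.assoc)
  moreover have "(g * h) * (h' * g') = g * (h * h') * g'" by (simp add: mult.assoc)
  ultimately have "(h' * g') * (g * h) = 1 \<and> (g * h) * (h' * g') = 1" using * by simp
  then show ?thesis using assms R_mult[OF *(4,1)] by (auto simp: \<Gamma>_iff R_mult norm_mult)
qed

lemma \<Gamma>_inverse:
  assumes "g \<in> \<Gamma>" obtains h where "h \<in> \<Gamma>" "h * g = 1" "g * h = 1"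
proof -
  obtain h where h: "h \<in> R" "h * g = 1" "g * h = 1" using assms by (auto simp: \<Gamma>_iff)
  have "reduced_norm eB h = 1" using norm_mult[of h g] h norm_one assms by (simp add: \<Gamma>_iff)
  then show ?thesis using that[of h] h \<Gamma>_R[OF assms] by (auto simp: \<Gamma>_iff)
qed

lemma \<Gamma>_right_inverse:
  assumes "g \<in> \<Gamma>" "g * h = 1"
  shows "h \<in> \<Gamma>" "h * g = 1"
proof -
  obtain h' where h': "h' \<in> \<Gamma>" "h' * g = 1" using assms(1) by (rule \<Gamma>_inverse)
  have "h = (h' * g) * h" using h' by simp
  also have "\<dots> = h'" by (simp only: mult.assoc assms(2) mult_1_right)
  finally show "h \<in> \<Gamma>" "h * g = 1" using h' by simp_all
qed

definition act :: "'b \<Rightarrow> complex proj_line \<Rightarrow> complex proj_line" where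
  "act g = real_moebius (\<iota>_inf g)"

definition act_p :: "'b \<Rightarrow> 'c proj_line \<Rightarrow> 'c proj_line" where
  "act_p g = moebius (\<iota>_p g)"

lemma act_mult: "h \<in> \<Gamma> \<Longrightarrow> act (g * h) z = act g (act h z)"
  by (simp add: act_def inf_mult real_moebius_mult det_inf)

lemma act_p_mult: "h \<in> \<Gamma> \<Longrightarrow> act_p (g * h) z = act_p g (act_p h z)"
  by (simp add: act_p_def p_mult moebius_mult det_p)

lemma act_one: "act 1 z = z"
  by (simp add: act_def inf_one)

lemma act_p_A0: "g \<in> \<Gamma> \<Longrightarrow> P \<in> A0 \<Longrightarrow> act_p g P \<in> A0"
proof -
  interpret nonarch_embedding absp "jp \<circ> eK"
    using absp hom_p by unfold_locales (simp_all add: comp_def)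
  show "g \<in> \<Gamma> \<Longrightarrow> P \<in> A0 \<Longrightarrow> act_p g P \<in> A0"
    using standard_affinoid_stable[OF R(2) det_p] \<Gamma>_R by (simp add: act_p_def A0_def)
qed

section \<open>Fixed points\<close>

abbreviation "M \<equiv> \<iota>_inf \<gamma>"

definition "disc = (M$2$2 - M$1$1)\<^sup>2 + 4 * M$1$2 * M$2$1"
definition "x_plus = (M$1$1 - M$2$2 + sqrt disc) / (2 * M$2$1)"
definition "x_minus = (M$1$1 - M$2$2 - sqrt disc) / (2 * M$2$1)"
definition "\<tau> = fixed_plus M"
definition "\<tau>' = fixed_minus M"
definition "s = sqrt disc"
text \<open>The eigenvalues of M on the vectors (x, 1) for its two fixed points x, read off from the
  second row.\<close>

definition "l_plus = M$2$1 * x_plus + M$2$2"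
definition "l_minus = M$2$1 * x_minus + M$2$2"

lemma c_nz: "M$2$1 \<noteq> 0"
  using c_nonzero by (simp add: \<gamma>_def)

lemma \<tau>_eq: "\<tau> = Pt (of_real x_plus)" and \<tau>'_eq: "\<tau>' = Pt (of_real x_minus)"
  by (simp_all add: \<tau>_def \<tau>'_def fixed_plus_def fixed_minus_def x_plus_def x_minus_def disc_def)

text \<open>A real place of \<open>K\<close> above \<open>v_inf\<close> sends \<open>u\<close> to an eigenvalue of \<open>M\<close>, so the eigenvalues are
  real; they are distinct because \<open>u\<close> does not lie in \<open>F\<close>.\<close>

lemma disc_pos: "disc > 0"
proof -
  obtain \<rho> :: "'k \<Rightarrow> real" where \<rho>: "is_ring_hom \<rho>" "\<And>c. \<rho> (eK c) = v_inf c"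
    using K(2) by (metis comp_apply)
  obtain T where T: "v_inf T = M$1$1 + M$2$2" using trace_coordinate by blast
  define n where "n = reduced_norm eB \<gamma>"
  have n: "v_inf n = M$1$1 * M$2$2 - M$1$2 * M$2$1" using norm_det_inf[of \<gamma>] by (simp add: n_def det_2)
  \<comment> \<open>Cayley-Hamilton for M has coefficients in F. Injectivity of
    \<open>\<iota>_inf\<close> and \<psi> pulls it back to an equation of u over F, to which \<rho>
    applies.\<close>
  have "\<iota>_inf (\<gamma> * \<gamma> - eB T * \<gamma> + eB n) = 0"
    by (simp add: inf_add inf_diff inf_mult \<iota>_inf(2) mat2_eq_iff mat2_mult_entry T n algebra_simps)
  then have "\<gamma> * \<gamma> - eB T * \<gamma> + eB n = 0" by (rule inf_eq_0)
  then have "\<psi> (u * u - eK T * u + eK n) = 0"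
    by (simp add: ring_hom_add[OF \<psi>(1)] ring_hom_diff[OF \<psi>(1)] ring_hom_mult[OF \<psi>(1)] \<psi>(2) \<gamma>_def)
  then have "u * u - eK T * u + eK n = 0" by (simp add: ring_hom_eq_0_iff[OF \<psi>(1)])
  then have "\<rho> (u * u - eK T * u + eK n) = 0" by (simp add: ring_hom_zero[OF \<rho>(1)])
  then have q: "\<rho> u * \<rho> u - v_inf T * \<rho> u + v_inf n = 0"
    by (simp add: ring_hom_add[OF \<rho>(1)] ring_hom_diff[OF \<rho>(1)] ring_hom_mult[OF \<rho>(1)] \<rho>(2))
  have "disc = (v_inf T)\<^sup>2 - 4 * v_inf n"
    unfolding T n disc_def by (simp add: power2_eq_square algebra_simps)
  also have "\<dots> = (2 * \<rho> u - v_inf T)\<^sup>2"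
    using q by (simp add: power2_eq_square algebra_simps)
  finally have d: "disc = (2 * \<rho> u - v_inf T)\<^sup>2" .
  have "2 * \<rho> u - v_inf T \<noteq> 0"
  proof
    assume "2 * \<rho> u - v_inf T = 0"
    then have "\<rho> (2 * u - eK T) = 0"
      using ring_hom_of_nat[OF \<rho>(1), of 2]
      by (simp add: ring_hom_diff[OF \<rho>(1)] ring_hom_mult[OF \<rho>(1)] \<rho>(2))
    then have "2 * u = eK T" by (simp add: ring_hom_eq_0_iff[OF \<rho>(1)])
    moreover have "2 * eK (T / 2) = eK T"
      using ring_hom_mult[OF K(1), of 2 "T / 2"] ring_hom_of_nat[OF K(1), of 2] by simp
    ultimately have "2 * u = 2 * eK (T / 2)" by simp
    then show False using u_not_scalar[of "T / 2"] by simp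
  qed
  then show ?thesis unfolding d by simp
qed

lemma s_pos: "s > 0" and s_square: "s * s = disc"
  using disc_pos by (auto simp: s_def)

lemma eigen_plus: "M$1$1 * x_plus + M$1$2 = l_plus * x_plus"
  and eigen_minus: "M$1$1 * x_minus + M$1$2 = l_minus * x_minus"
  and l_diff: "l_plus - l_minus = s" and x_diff: "x_plus - x_minus = s / M$2$1"
proof -
  have p: "2 * M$2$1 * x_plus = M$1$1 - M$2$2 + s" and m: "2 * M$2$1 * x_minus = M$1$1 - M$2$2 - s"
    using c_nz by (simp_all add: x_plus_def x_minus_def s_def)
  have *: "M$1$1 * x + M$1$2 = (M$2$1 * x + M$2$2) * x"
    if h: "2 * M$2$1 * x = M$1$1 - M$2$2 + t" "t * t = disc" for x t
  proof -
    have t: "t = 2 * M$2$1 * x - M$1$1 + M$2$2" using h(1) by simp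
    have "4 * M$2$1 * ((M$2$1 * x + M$2$2) * x - (M$1$1 * x + M$1$2)) = t * t - disc"
      unfolding t disc_def by (simp add: power2_eq_square algebra_simps)
    then show ?thesis using c_nz h(2) by simp
  qed
  show "M$1$1 * x_plus + M$1$2 = l_plus * x_plus"
    unfolding l_plus_def by (rule *[OF p s_square])
  show "M$1$1 * x_minus + M$1$2 = l_minus * x_minus"
    unfolding l_minus_def by (rule *[of _ "- s"]) (use m s_square in simp_all)
  show "l_plus - l_minus = s" using p m by (simp add: l_plus_def l_minus_def)
  show "x_plus - x_minus = s / M$2$1" using p m c_nz by (simp add: field_simps)
qed

lemma M_nonscalar: "M \<noteq> mat r"
  using c_nz by (auto simp: mat2_eq_iff)

text \<open>Here q = 1 / (x_plus - x_minus), which gives \<open>P0\<close> determinant 1. Its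
  columns are eigenvectors of M, ordered so that 0 goes to \<tau> and \<infinity> to the other fixed
  point.\<close>

definition "q = M$2$1 / s"
definition "P0 = mat2 (- (q * x_minus)) x_plus (- q) 1"

lemma det_P0: "det P0 = 1"
proof -
  have "det P0 = q * (x_plus - x_minus)" by (simp add: P0_def algebra_simps)
  then show ?thesis using s_pos c_nz by (simp add: x_diff q_def)
qed

lemma P0_zero: "real_moebius P0 (Pt 0) = \<tau>" and P0_infinity: "real_moebius P0 Infty = \<tau>'"
  using s_pos c_nz by (simp_all add: real_moebius_cmat P0_def \<tau>_eq \<tau>'_eq q_def)

lemma M_P0: "M ** P0 = P0 ** mat2 l_minus 0 0 l_plus"
proof -
  have "M$1$1 * - (q * x_minus) + M$1$2 * - q = - (q * (M$1$1 * x_minus + M$1$2))"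
    by (simp add: algebra_simps)
  then have 1: "M$1$1 * - (q * x_minus) + M$1$2 * - q = - (q * x_minus) * l_minus"
    unfolding eigen_minus by (simp add: algebra_simps)
  have 2: "M$2$1 * - (q * x_minus) + M$2$2 * - q = - q * l_minus"
    by (simp add: l_minus_def algebra_simps)
  show ?thesis using 1 2 eigen_plus
    by (simp add: mat2_eq_iff mat2_mult_entry P0_def) (simp add: l_plus_def algebra_simps)
qed

definition "frame g = \<iota>_inf g ** P0"

lemma det_frame: "g \<in> \<Gamma> \<Longrightarrow> det (frame g) = 1"
  by (simp add: frame_def det_mul det_inf det_P0)

lemma frame_zero: "real_moebius (frame g) (Pt 0) = act g \<tau>"
  and frame_infinity: "real_moebius (frame g) Infty = act g \<tau>'"
  by (simp_all add: frame_def real_moebius_mult det_P0 P0_zero P0_infinity act_def)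

text \<open>The conjugate of \<gamma> is P diag(l_minus, l_plus) P^-1. Apart from l_minus on the
  diagonal, its entries are s times the products occurring in the axis form of P.\<close>

lemma conjugate_entries:
  assumes "g \<in> \<Gamma>" "g * h = 1"
  defines "P \<equiv> frame g" and "N \<equiv> \<iota>_inf (g * \<gamma> * h)"
  shows "N$1$1 = l_minus - s * (P$1$2 * P$2$1)" "N$1$2 = s * (P$1$1 * P$1$2)"
    "N$2$1 = - s * (P$2$1 * P$2$2)" "N$2$2 = l_minus + s * (P$1$1 * P$2$2)"
proof -
  have hg: "h * g = 1"
    by (rule \<Gamma>_right_inverse(2)[OF assms(1,2)])
  define Q where "Q = mat2 (P$2$2) (- P$1$2) (- P$2$1) (P$1$1)"
  have PQ: "P ** Q = mat 1" unfolding Q_def by (rule sl2_inverse(2)) (simp add: P_def det_frame assms(1))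
  have "N ** P = \<iota>_inf (g * \<gamma> * h * g) ** P0"
    by (simp add: N_def P_def frame_def inf_mult matrix_mul_assoc)
  also have "g * \<gamma> * h * g = g * \<gamma>" by (simp add: mult.assoc hg)
  also have "\<iota>_inf (g * \<gamma>) ** P0 = \<iota>_inf g ** (M ** P0)" by (simp add: inf_mult matrix_mul_assoc)
  also have "\<dots> = P ** mat2 l_minus 0 0 l_plus" by (simp add: M_P0 P_def frame_def matrix_mul_assoc)
  finally have "N ** (P ** Q) = P ** mat2 l_minus 0 0 l_plus ** Q" by (simp add: matrix_mul_assoc)
  then have N: "N = P ** mat2 l_minus 0 0 l_plus ** Q" by (simp add: PQ)
  have d: "P$1$1 * P$2$2 = 1 + P$1$2 * P$2$1"
    using det_frame[OF assms(1)] by (simp add: P_def det_2)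
  have l: "l_plus = l_minus + s" using l_diff by simp
  have "N$1$1 = P$1$1 * P$2$2 * l_minus - P$1$2 * P$2$1 * l_plus"
    by (simp add: N mat2_mult_entry Q_def algebra_simps)
  then show "N$1$1 = l_minus - s * (P$1$2 * P$2$1)" unfolding d l by (simp add: algebra_simps)
  have "N$2$2 = (1 + P$1$2 * P$2$1 - 1) * (- l_minus) + P$1$1 * P$2$2 * l_plus"
    by (simp add: N mat2_mult_entry Q_def algebra_simps)
  then show "N$2$2 = l_minus + s * (P$1$1 * P$2$2)"
    unfolding d[symmetric] l by (simp add: algebra_simps)
  show "N$1$2 = s * (P$1$1 * P$1$2)" "N$2$1 = - s * (P$2$1 * P$2$2)"
    unfolding N by (simp_all add: mat2_mult_entry Q_def l algebra_simps)
qed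

text \<open>If \<open>k\<close> fixes \<open>\<tau>\<close>, the commutator of \<open>k\<close> and \<open>\<gamma>\<close> is nilpotent with image the eigenline of \<open>\<tau>\<close>,
  so \<open>\<gamma>\<close> multiplies it by a real scalar. Such a scalar must come from \<open>F\<close>, and \<open>u\<close> does not.\<close>

lemma stabilizer_commutes:
  assumes k: "k \<in> \<Gamma>" and fixed: "act k \<tau> = \<tau>"
  shows "k * \<gamma> = \<gamma> * k"
proof -
  define X x where "X = \<iota>_inf k" and "x = x_plus"
  define n where "n = k * \<gamma> - \<gamma> * k"
  define y where "y = X$2$1 * x + X$2$2"
  have "real_moebius X (Pt (of_real x)) = Pt (of_real x)"
    using fixed by (simp add: act_def X_def \<tau>_eq x_def)
  then have "complex_of_real (X$2$1) * of_real x + of_real (X$2$2) \<noteq> 0"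
    and q: "(complex_of_real (X$1$1) * of_real x + of_real (X$1$2)) / (of_real (X$2$1) * of_real x + of_real (X$2$2)) = of_real x"
    by (auto simp: real_moebius_cmat split: if_splits)
  then have "complex_of_real (X$1$1) * of_real x + of_real (X$1$2) = of_real x * (of_real (X$2$1) * of_real x + of_real (X$2$2))"
    by (simp add: field_simps)
  then have "complex_of_real (X$1$1 * x + X$1$2) = of_real (x * y)" by (simp add: y_def)
  then have Xv: "X$1$1 * x + X$1$2 = x * y" by (simp only: of_real_eq_iff)
  define E where "E = \<iota>_inf n"
  have E: "E$1$1 = X$1$2 * M$2$1 - M$1$2 * X$2$1" "E$2$2 = X$2$1 * M$1$2 - M$2$1 * X$1$2"
    "E$1$2 = X$1$1 * M$1$2 + X$1$2 * M$2$2 - (M$1$1 * X$1$2 + M$1$2 * X$2$2)"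
    "E$2$1 = X$2$1 * M$1$1 + X$2$2 * M$2$1 - (M$2$1 * X$1$1 + M$2$2 * X$2$1)"
    by (simp_all add: E_def n_def inf_diff inf_mult mat2_mult_entry X_def[symmetric])
  have X12: "X$1$2 = x * y - X$1$1 * x" and X22: "X$2$2 = y - X$2$1 * x"
    using Xv by (simp_all add: y_def)
  have M12: "M$1$2 = l_plus * x - M$1$1 * x" and M22: "M$2$2 = l_plus - M$2$1 * x"
    using eigen_plus by (simp_all add: x_def l_plus_def)
  \<comment> \<open>Both columns of \<open>E\<close> are multiples of the eigenvector (x, 1), so M
    acts on \<open>E\<close> by the scalar l_plus.\<close>
  have E21: "E$1$1 = x * E$2$1" "E$1$2 = - x * E$1$1" "E$2$2 = - x * E$2$1"
    unfolding E X12 X22 M12 M22 by (simp_all add: algebra_simps)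
  have "\<iota>_inf (\<gamma> * n) $ m $ j = l_plus * \<iota>_inf n $ m $ j" for m j
  proof -
    have e: "(M ** E) $ 1 $ 1 = l_plus * E$1$1" "(M ** E) $ 1 $ 2 = l_plus * E$1$2"
      "(M ** E) $ 2 $ 1 = l_plus * E$2$1" "(M ** E) $ 2 $ 2 = l_plus * E$2$2"
      unfolding mat2_mult_entry E21 M12 M22 by (simp_all add: algebra_simps)
    have "m = 1 \<or> m = 2" "j = 1 \<or> j = 2" by (rule exhaust_2)+
    then show ?thesis using e by (auto simp: inf_mult E_def)
  qed
  then have "n = 0 \<or> (\<exists>c. \<gamma> * n = eB c * n)" using inf_proportional[of n "\<gamma> * n" l_plus] by blast
  then have "n = 0" using \<gamma>_minus_scalar_cancel by blast
  then show ?thesis by (simp add: n_def)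
qed

lemma commuting_fixes:
  assumes k: "k \<in> \<Gamma>" and comm: "k * \<gamma> = \<gamma> * k"
  shows "act k \<tau> = \<tau>" "act k \<tau>' = \<tau>'" "act_p k (Pt \<tau>_p) = Pt \<tau>_p"
proof -
  have c: "\<iota>_inf k ** M = M ** \<iota>_inf k" by (simp add: inf_mult[symmetric] comm)
  have cc: "cmat (\<iota>_inf k) ** cmat M = cmat M ** cmat (\<iota>_inf k)" by (simp add: cmat_mult[symmetric] c)
  have d: "det (cmat (\<iota>_inf k)) \<noteq> 0" by (simp add: det_cmat det_inf k)
  have ns: "cmat M \<noteq> mat r" for r
    using c_nz by (auto simp: mat2_eq_iff)
  have "moebius (cmat (\<iota>_inf k)) (Pt (of_real x_plus)) = Pt (of_real x_plus)"
    by (rule moebius_commuting_fixed[OF cc d, where l = "of_real l_plus"])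
       (use ns eigen_plus in \<open>simp_all add: l_plus_def flip: of_real_mult of_real_add\<close>)
  then show "act k \<tau> = \<tau>" by (simp add: act_def real_moebius_cmat \<tau>_eq)
  have "moebius (cmat (\<iota>_inf k)) (Pt (of_real x_minus)) = Pt (of_real x_minus)"
    by (rule moebius_commuting_fixed[OF cc d, where l = "of_real l_minus"])
       (use ns eigen_minus in \<open>simp_all add: l_minus_def flip: of_real_mult of_real_add\<close>)
  then show "act k \<tau>' = \<tau>'" by (simp add: act_def real_moebius_cmat \<tau>'_eq)
  show "act_p k (Pt \<tau>_p) = Pt \<tau>_p" unfolding act_p_def
  proof (rule moebius_commuting_fixed[where M = "\<iota>_p \<gamma>" and l = "jp u"])
    show "\<iota>_p k ** \<iota>_p \<gamma> = \<iota>_p \<gamma> ** \<iota>_p k" by (simp add: p_mult[symmetric] comm)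
    show "det (\<iota>_p k) \<noteq> 0" by (simp add: det_p k)
    have "(\<iota>_p \<gamma> *v vector [\<tau>_p, 1]) $ i = jp u * vector [\<tau>_p, 1] $ i" for i :: 2
      using \<tau>_p(1) by (simp add: \<gamma>_def)
    from this[of 1] this[of 2] show "\<iota>_p \<gamma> $ 1 $ 1 * \<tau>_p + \<iota>_p \<gamma> $ 1 $ 2 = jp u * \<tau>_p"
      "\<iota>_p \<gamma> $ 2 $ 1 * \<tau>_p + \<iota>_p \<gamma> $ 2 $ 2 = jp u"
      by (simp_all add: matrix_vector_mult_def sum_2)
    show "\<iota>_p \<gamma> \<noteq> mat r" for r
    proof
      assume h: "\<iota>_p \<gamma> = mat r"
      \<comment> \<open>A scalar image would place \<gamma> in F, against the nonzero lower left
        entry of M.\<close>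
      have "\<iota>_p \<gamma> $ m $ n = r * \<iota>_p 1 $ m $ n" for m n by (simp add: h p_one mat_def)
      then obtain c where "\<gamma> = eB c * 1" using p_proportional[of 1 \<gamma> r] by auto
      then show False using M_nonscalar[of "v_inf c"] \<iota>_inf(2)[of c] by simp
    qed
  qed
qed

section \<open>Orbit points and the conjugates fixing them\<close>

text \<open>With k = h^-1 g, the points agree when k fixes \<tau>, the conjugates agree when k
  commutes with \<gamma>, and these conditions are equivalent. The first claim recovers w from a
  conjugate; the other two make the definite descriptions of w' and w_p meaningful.\<close>

lemma conjugates_eq_iff:
  assumes g: "g \<in> \<Gamma>" "g * g' = 1" and h: "h \<in> \<Gamma>" "h * h' = 1"
  shows "act g \<tau> = act h \<tau> \<longleftrightarrow> g * \<gamma> * g' = h * \<gamma> * h'"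
    and "act g \<tau> = act h \<tau> \<Longrightarrow> act g \<tau>' = act h \<tau>'"
    and "act g \<tau> = act h \<tau> \<Longrightarrow> act_p g (Pt \<tau>_p) = act_p h (Pt \<tau>_p)"
proof -
  note g' = \<Gamma>_right_inverse[OF g] and h' = \<Gamma>_right_inverse[OF h]
  define k where "k = h' * g"
  have k: "k \<in> \<Gamma>" unfolding k_def by (intro \<Gamma>_mult h' g)
  have hk: "g = h * k" by (simp add: k_def mult.assoc[symmetric] h)
  have fixed: "act k \<tau> = \<tau>" if "act g \<tau> = act h \<tau>"
  proof -
    have "act k \<tau> = act h' (act h \<tau>)" using that g by (simp add: k_def act_mult)
    also have "\<dots> = act (h' * h) \<tau>" using h by (simp add: act_mult)
    finally show ?thesis by (simp add: h' act_one)
  qed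
  have kg: "k * g' = h'" by (simp add: k_def mult.assoc g)
  have comm_iff: "g * \<gamma> * g' = h * \<gamma> * h' \<longleftrightarrow> k * \<gamma> = \<gamma> * k"
  proof
    assume "k * \<gamma> = \<gamma> * k"
    then have "h * (k * \<gamma>) * g' = h * \<gamma> * (k * g')" by (simp add: mult.assoc)
    then show "g * \<gamma> * g' = h * \<gamma> * h'" by (simp add: kg hk mult.assoc)
  next
    assume "g * \<gamma> * g' = h * \<gamma> * h'"
    then have "h' * (g * \<gamma> * g') * g = h' * (h * \<gamma> * h') * g" by simp
    moreover have "h' * (g * \<gamma> * g') * g = k * \<gamma> * (g' * g)" by (simp add: k_def mult.assoc)
    moreover have "h' * (h * \<gamma> * h') * g = (h' * h) * \<gamma> * k" by (simp add: k_def mult.assoc)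
    ultimately show "k * \<gamma> = \<gamma> * k" using g' h' by simp
  qed
  show iff: "act g \<tau> = act h \<tau> \<longleftrightarrow> g * \<gamma> * g' = h * \<gamma> * h'"
  proof
    assume "act g \<tau> = act h \<tau>"
    then show "g * \<gamma> * g' = h * \<gamma> * h'" using comm_iff fixed stabilizer_commutes[OF k] by blast
  next
    assume "g * \<gamma> * g' = h * \<gamma> * h'"
    then have "act k \<tau> = \<tau>" using comm_iff commuting_fixes(1)[OF k] by blast
    then show "act g \<tau> = act h \<tau>" unfolding hk by (simp add: act_mult k)
  qed
  assume "act g \<tau> = act h \<tau>"
  then have c: "k * \<gamma> = \<gamma> * k" using fixed stabilizer_commutes[OF k] by blast
  show "act g \<tau>' = act h \<tau>'" unfolding hk using commuting_fixes(2)[OF k c] by (simp add: act_mult k)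
  show "act_p g (Pt \<tau>_p) = act_p h (Pt \<tau>_p)"
    unfolding hk using commuting_fixes(3)[OF k c] by (simp add: act_p_mult k)
qed

definition "orbit = orbit_inf \<Gamma> \<iota>_inf \<gamma>"
definition "conj_pt = conj_point \<Gamma> \<iota>_inf \<gamma>"
definition "p_pt = padic_point \<Gamma> \<iota>_inf \<iota>_p \<gamma> \<tau>_p"

lemma orbitE: assumes "w \<in> orbit" obtains g where "g \<in> \<Gamma>" "w = act g \<tau>"
  using assms by (auto simp: orbit_def orbit_inf_def act_def \<tau>_def)

lemma orbitI: "g \<in> \<Gamma> \<Longrightarrow> act g \<tau> \<in> orbit"
  by (auto simp: orbit_def orbit_inf_def act_def \<tau>_def)

lemma conj_pt_act: assumes "g \<in> \<Gamma>" shows "conj_pt (act g \<tau>) = act g \<tau>'"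
proof -
  have "conj_pt (act g \<tau>) = (THE z. \<exists>h\<in>\<Gamma>. act g \<tau> = act h \<tau> \<and> z = act h \<tau>')"
    by (simp add: conj_pt_def conj_point_def act_def \<tau>_def \<tau>'_def)
  also have "\<dots> = act g \<tau>'"
  proof (rule the_equality)
    show "\<exists>h\<in>\<Gamma>. act g \<tau> = act h \<tau> \<and> act g \<tau>' = act h \<tau>'" using assms by blast
    fix z assume "\<exists>h\<in>\<Gamma>. act g \<tau> = act h \<tau> \<and> z = act h \<tau>'"
    then obtain h where h: "h \<in> \<Gamma>" "act g \<tau> = act h \<tau>" "z = act h \<tau>'" by blast
    obtain g' where g': "g * g' = 1" using \<Gamma>_inverse[OF assms] by blast
    obtain h' where h': "h * h' = 1" using \<Gamma>_inverse[OF h(1)] by blast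
    show "z = act g \<tau>'" using conjugates_eq_iff(2)[OF assms g' h(1) h' h(2)] h(3) by simp
  qed
  finally show ?thesis .
qed

lemma p_pt_act: assumes "g \<in> \<Gamma>" shows "p_pt (act g \<tau>) = act_p g (Pt \<tau>_p)"
proof -
  have "p_pt (act g \<tau>) = (THE z. \<exists>h\<in>\<Gamma>. act g \<tau> = act h \<tau> \<and> z = act_p h (Pt \<tau>_p))"
    by (simp add: p_pt_def padic_point_def act_def act_p_def \<tau>_def)
  also have "\<dots> = act_p g (Pt \<tau>_p)"
  proof (rule the_equality)
    show "\<exists>h\<in>\<Gamma>. act g \<tau> = act h \<tau> \<and> act_p g (Pt \<tau>_p) = act_p h (Pt \<tau>_p)" using assms by blast
    fix z assume "\<exists>h\<in>\<Gamma>. act g \<tau> = act h \<tau> \<and> z = act_p h (Pt \<tau>_p)"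
    then obtain h where h: "h \<in> \<Gamma>" "act g \<tau> = act h \<tau>" "z = act_p h (Pt \<tau>_p)" by blast
    obtain g' where g': "g * g' = 1" using \<Gamma>_inverse[OF assms] by blast
    obtain h' where h': "h * h' = 1" using \<Gamma>_inverse[OF h(1)] by blast
    show "z = act_p g (Pt \<tau>_p)" using conjugates_eq_iff(3)[OF assms g' h(1) h' h(2)] h(3) by simp
  qed
  finally show ?thesis .
qed

end

context embedding_cocycle
begin

section \<open>Sides of a geodesic of the orbit\<close>

definition right :: "complex proj_line \<Rightarrow> complex proj_line \<Rightarrow> bool" where
  "right w = right_of w (conj_pt w)"

lemma right_act_iff_axis_form: "g \<in> \<Gamma> \<Longrightarrow> right (act g \<tau>) z \<longleftrightarrow> axis_form (frame g) z > 0"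
  using right_of_iff_axis_form[OF det_frame, of g z]
  by (simp add: right_def conj_pt_act frame_zero frame_infinity)

text \<open>Frames are equivariant: moving the point and the geodesic by g leaves the coordinate
  \<zeta> in the frame unchanged.\<close>

lemma right_translate:
  assumes g: "g \<in> \<Gamma>" and w: "w \<in> orbit"
  shows "right (act g w) (act g z) \<longleftrightarrow> right w z"
proof -
  obtain h where h: "h \<in> \<Gamma>" "w = act h \<tau>" using w by (rule orbitE)
  have gh: "g * h \<in> \<Gamma>" using g h by (intro \<Gamma>_mult)
  have w': "act g w = act (g * h) \<tau>" by (simp add: h act_mult)
  obtain \<zeta> where z: "z = real_moebius (frame h) \<zeta>"
    using real_moebius_inverse(2)[OF det_frame[OF h(1)], of z] by metis
  have "act g z = real_moebius (frame (g * h)) \<zeta>"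
    using real_moebius_mult[of "frame h" "\<iota>_inf g" \<zeta>] det_frame[OF h(1)]
    by (simp add: z act_def frame_def inf_mult matrix_mul_assoc)
  then have "right (act g w) (act g z) \<longleftrightarrow> (\<exists>y. \<zeta> = Pt y \<and> Re y > 0)"
    using right_of_frame[OF det_frame[OF gh], of \<zeta>]
    by (simp only: right_def w' conj_pt_act[OF gh] frame_zero frame_infinity)
  also have "\<dots> \<longleftrightarrow> right w z"
    using right_of_frame[OF det_frame[OF h(1)], of \<zeta>]
    by (simp only: right_def h(2) conj_pt_act[OF h(1)] frame_zero frame_infinity z)
  finally show ?thesis .
qed

lemma act_orbit: assumes "g \<in> \<Gamma>" "w \<in> orbit" shows "act g w \<in> orbit"
proof -
  obtain h where h: "h \<in> \<Gamma>" "w = act h \<tau>" using assms(2) by (rule orbitE)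
  then show ?thesis using orbitI[OF \<Gamma>_mult[OF assms(1) h(1)]] by (simp add: act_mult)
qed

lemma act_inverse: "h \<in> \<Gamma> \<Longrightarrow> g * h = 1 \<Longrightarrow> act g (act h z) = z"
  using act_mult[of h g z] by (simp add: act_one)

definition "\<H> = extended_half_plane TYPE('b)"

lemma H_closed_half_plane: "x \<in> \<H> \<Longrightarrow> x \<in> closed_half_plane"
proof -
  have "Im z = 0" if "z \<in> \<rat>" for z
    using that by (auto elim!: Rats_cases' simp: Im_divide)
  then show "x \<in> \<H> \<Longrightarrow> x \<in> closed_half_plane"
    by (auto simp: \<H>_def extended_half_plane_def upper_half_plane_def split: if_splits)
qed

lemma act_H: assumes g: "g \<in> \<Gamma>" and x: "x \<in> \<H>" shows "act g x \<in> \<H>"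
proof (cases "x \<in> upper_half_plane")
  case True
  then show ?thesis using real_moebius_upper_half_plane[OF det_inf[OF g]]
    by (simp add: act_def \<H>_def extended_half_plane_def)
next
  case False
  then have Q: "is_M2Q TYPE('b)" and x': "x \<in> Pt ` \<rat> \<union> {Infty}"
    using x by (auto simp: \<H>_def extended_half_plane_def split: if_splits)
  have "is_ring_hom complex_of_real" by (simp add: is_ring_hom_def)
  then have of_real: "complex_of_real r \<in> \<rat>" if "r \<in> \<rat>" for r
    using that by (auto elim!: Rats_cases simp: ring_hom_of_rat)
  have "\<iota>_inf g \<in> mat2_over \<rat>" using M2Q[OF Q] by blast
  then have e: "cmat (\<iota>_inf g) $ i $ j \<in> \<rat>" for i j by (simp add: mat2_over_def of_real)
  have i: "(if b then Infty else Pt r) \<in> Pt ` \<rat> \<union> {Infty}" if "r \<in> \<rat>" for b and r :: complex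
    using that by auto
  consider y where "x = Pt y" "y \<in> \<rat>" | "x = Infty" using x' by blast
  then have "act g x \<in> Pt ` \<rat> \<union> {Infty}"
    unfolding act_def real_moebius_cmat
    by cases (simp_all only: moebius.simps, (intro i Rats_divide Rats_add Rats_mult e; assumption)+)
  then show ?thesis using Q by (auto simp: \<H>_def extended_half_plane_def)
qed

lemma delta_eq:
  assumes w: "w \<in> orbit" and x: "x \<in> \<H>" and g: "g \<in> \<Gamma>"
  shows "delta \<Gamma> \<iota>_inf \<gamma> x g w = of_bool (right w (act g x)) - of_bool (right w x)"
proof -
  obtain h where h: "h \<in> \<Gamma>" "w = act h \<tau>" using w by (rule orbitE)
  show ?thesis
    using signed_intersection_eq[OF det_frame[OF h(1)] H_closed_half_plane[OF x] H_closed_half_plane[OF act_H[OF g x]]]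
    unfolding frame_zero frame_infinity h(2)[symmetric] conj_pt_act[OF h(1), symmetric]
    unfolding h(2)[symmetric]
    by (simp add: delta_def right_def conj_pt_def act_def)
qed

section \<open>Finiteness of intersections\<close>

text \<open>The coefficients of \<open>axis_form (frame g)\<close>. Times \<open>s\<close> they are
  the lower left entry, the lower right minus the upper left entry, and minus the upper right entry
  of the conjugate of \<gamma> by g.\<close>

definition "form_A g = - (frame g$2$1 * frame g$2$2)"
definition "form_B g = frame g$1$1 * frame g$2$2 + frame g$1$2 * frame g$2$1"
definition "form_C g = - (frame g$1$1 * frame g$1$2)"
lemmas form_defs = form_A_def form_B_def form_C_def

definition bounded_form :: "real \<Rightarrow> 'b \<Rightarrow> bool" where
  "bounded_form C g \<longleftrightarrow> \<bar>form_A g\<bar> \<le> C \<and> \<bar>form_B g\<bar> \<le> C \<and> \<bar>form_C g\<bar> \<le> C"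

lemma finite_bounded_forms:
  "finite {w. \<exists>g\<in>\<Gamma>. w = act g \<tau> \<and> bounded_form C g}"
    (is "finite ?W")
proof -
  define good where "good w g g' \<longleftrightarrow> g \<in> \<Gamma> \<and> g * g' = 1 \<and> w = act g \<tau> \<and> bounded_form C g"
    for w g g'
  have "\<forall>w\<in>?W. \<exists>g g'. good w g g'" unfolding good_def using \<Gamma>_inverse by blast
  from bchoice[OF this] obtain G where "\<forall>w\<in>?W. \<exists>g'. good w (G w) g'" ..
  from bchoice[OF this] obtain G' where "\<forall>w\<in>?W. good w (G w) (G' w)" ..
  then have G: "\<And>w. w \<in> ?W \<Longrightarrow> good w (G w) (G' w)" by (rule bspec)
  define N where "N w = G w * \<gamma> * G' w" for w
  \<comment> \<open>The products P11 P22 and P12 P21 differ by 1 and their sum is at most C in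
    absolute value, so each is at most C + 1; off the diagonal C suffices.\<close>
  define C' where "C' = \<bar>l_minus\<bar> + s * (C + 1)"
  have "N ` ?W \<subseteq> {x \<in> R. reduced_norm eB x = reduced_norm eB \<gamma> \<and> (\<forall>m n. \<bar>\<iota>_inf x $ m $ n\<bar> \<le> C')}"
  proof (rule image_subsetI)
    fix w assume "w \<in> ?W"
    then have g: "good w (G w) (G' w)" by (rule G)
    define P where "P = frame (G w)"
    have gG: "G w \<in> \<Gamma>" "G w * G' w = 1" using g by (auto simp: good_def)
    note g'G = \<Gamma>_right_inverse(1)[OF gG]
    have "N w \<in> R" unfolding N_def using gG g'G \<psi>(3) by (intro R_mult) (auto simp: \<Gamma>_R \<gamma>_def)
    moreover have "reduced_norm eB (N w) = reduced_norm eB \<gamma>"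
      using gG g'G by (simp add: N_def norm_mult \<Gamma>_iff)
    moreover have "\<bar>\<iota>_inf (N w) $ m $ n\<bar> \<le> C'" for m n
    proof -
      have d: "P$1$1 * P$2$2 - P$1$2 * P$2$1 = 1" using det_frame[OF gG(1)] by (simp add: P_def det_2)
      have b: "\<bar>P$2$1 * P$2$2\<bar> \<le> C" "\<bar>P$1$1 * P$2$2 + P$1$2 * P$2$1\<bar> \<le> C" "\<bar>P$1$1 * P$1$2\<bar> \<le> C"
        using g by (simp_all add: good_def bounded_form_def form_defs P_def)
      then have b': "\<bar>P$1$1 * P$2$2\<bar> \<le> C + 1" "\<bar>P$1$2 * P$2$1\<bar> \<le> C + 1" using d by linarith+
      have sm: "\<bar>s * r\<bar> \<le> s * (C + 1)" if "\<bar>r\<bar> \<le> C + 1" for r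
        using that s_pos by (simp add: abs_mult)
      note e = conjugate_entries[OF gG, folded N_def P_def]
      have "\<bar>\<iota>_inf (N w) $ 1 $ 1\<bar> \<le> C'" unfolding e C'_def using sm[OF b'(2)] by linarith
      moreover have "\<bar>\<iota>_inf (N w) $ 2 $ 2\<bar> \<le> C'" unfolding e C'_def using sm[OF b'(1)] by linarith
      moreover have "\<bar>\<iota>_inf (N w) $ 1 $ 2\<bar> \<le> C'" unfolding e C'_def using sm[of "P$1$1 * P$1$2"] b(3) by linarith
      moreover have "\<bar>\<iota>_inf (N w) $ 2 $ 1\<bar> \<le> C'" unfolding e C'_def using sm[of "P$2$1 * P$2$2"] b(1) by simp
      moreover have "m = 1 \<or> m = 2" "n = 1 \<or> n = 2" by (rule exhaust_2)+
      ultimately show ?thesis by auto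
    qed
    ultimately show "N w \<in> {x \<in> R. reduced_norm eB x = reduced_norm eB \<gamma> \<and> (\<forall>m n. \<bar>\<iota>_inf x $ m $ n\<bar> \<le> C')}"
      by blast
  qed
  moreover have "finite {x \<in> R. reduced_norm eB x = reduced_norm eB \<gamma> \<and> (\<forall>m n. \<bar>\<iota>_inf x $ m $ n\<bar> \<le> C')}"
    by (rule finite_bounded_in_order[OF F B \<iota>_inf R(1)])
  ultimately have "finite (N ` ?W)" by (rule finite_subset)
  moreover have "inj_on N ?W"
  proof (rule inj_onI)
    fix w w' assume "w \<in> ?W" "w' \<in> ?W" and eq: "N w = N w'"
    then have g: "good w (G w) (G' w)" "good w' (G w') (G' w')" by (auto intro: G)
    then have "act (G w) \<tau> = act (G w') \<tau>"
      using conjugates_eq_iff(1)[of "G w" "G' w" "G w'" "G' w'"] eq by (simp add: good_def N_def)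
    then show "w = w'" using g by (simp add: good_def)
  qed
  ultimately show ?thesis by (rule finite_imageD)
qed

lemma form_disc:
  assumes "g \<in> \<Gamma>"
  shows "(form_B g)\<^sup>2 - 4 * form_A g * form_C g = 1"
proof -
  have "(form_B g)\<^sup>2 - 4 * form_A g * form_C g = (det (frame g))\<^sup>2"
    by (simp add: form_defs det_2 power2_eq_square algebra_simps)
  then show ?thesis by (simp add: det_frame assms)
qed

lemma axis_form_point:
  "axis_form (frame g) (Pt (Complex x y)) = form_A g * (x\<^sup>2 + y\<^sup>2) + form_B g * x + form_C g"
  by (simp add: cmod_power2 form_defs)

lemma axis_form_infinity: "axis_form (frame g) Infty = form_A g"
  by (simp add: form_defs)

definition separating :: "complex proj_line \<Rightarrow> complex proj_line \<Rightarrow> complex proj_line set" where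
  "separating a b = {w \<in> orbit. right w a \<noteq> right w b}"

lemma finite_separating_of_bound:
  assumes "\<And>g. g \<in> \<Gamma> \<Longrightarrow> (axis_form (frame g) a > 0) \<noteq> (axis_form (frame g) b > 0) \<Longrightarrow>
    bounded_form C g"
  shows "finite (separating a b)"
proof (rule finite_subset[OF _ finite_bounded_forms[of C]])
  show "separating a b \<subseteq> {w. \<exists>g\<in>\<Gamma>. w = act g \<tau> \<and> bounded_form C g}"
  proof
    fix w assume "w \<in> separating a b"
    then have w: "w \<in> orbit" "right w a \<noteq> right w b" by (auto simp: separating_def)
    obtain g where g: "g \<in> \<Gamma>" "w = act g \<tau>" using w(1) by (rule orbitE)
    have "(axis_form (frame g) a > 0) \<noteq> (axis_form (frame g) b > 0)"
      using w(2) by (simp add: g right_act_iff_axis_form)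
    from assms[OF g(1) this] g
    show "w \<in> {w. \<exists>g\<in>\<Gamma>. w = act g \<tau> \<and> bounded_form C g}"
      by blast
  qed
qed

lemma finite_separating_trans:
  "finite (separating a b) \<Longrightarrow> finite (separating b c) \<Longrightarrow> finite (separating a c)"
  by (rule finite_subset[of _ "separating a b \<union> separating b c"]) (auto simp: separating_def)

lemma separating_sym: "separating a b = separating b a"
  by (auto simp: separating_def)

section \<open>Separation from the reference point i\<close>

abbreviation "base \<equiv> Pt (Complex 0 1)"

lemma axis_form_base: "axis_form (frame g) base = form_A g + form_C g"
  unfolding axis_form_point by simp

lemma finite_separating_interior:
  assumes "Im z > 0"
  shows "finite (separating base (Pt z))"
proof -
  obtain K where K: "\<And>A B C. B\<^sup>2 - 4 * A * C = 1 \<Longrightarrow>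
    (A + C > 0) \<noteq> (A * ((Re z)\<^sup>2 + (Im z)\<^sup>2) + B * Re z + C > 0) \<Longrightarrow> \<bar>A\<bar> \<le> K \<and> \<bar>B\<bar> \<le> K \<and> \<bar>C\<bar> \<le> (K::real)"
    using binary_form_bound_interior[OF assms, of "Re z"] by blast
  show ?thesis
  proof (rule finite_separating_of_bound[of _ _ K])
    fix g assume g: "g \<in> \<Gamma>" and sep: "(axis_form (frame g) base > 0) \<noteq> (axis_form (frame g) (Pt z) > 0)"
    show "bounded_form K g" unfolding bounded_form_def
      by (rule K[OF form_disc[OF g]])
         (use sep axis_form_point[of g "Re z" "Im z"] in
           \<open>simp only: axis_form_base complex.collapse simp_thms\<close>)
  qed
qed

section \<open>Cusps when B is the rational matrix algebra\<close>

lemma rational_central: assumes "is_M2Q TYPE('b)" shows "v_inf c \<in> \<rat>"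
proof -
  have "\<iota>_inf (eB c) \<in> mat2_over \<rat>" using M2Q[OF assms] by blast
  then have "\<iota>_inf (eB c) $ 1 $ 1 \<in> \<rat>" unfolding mat2_over_def by blast
  then show ?thesis by (simp add: \<iota>_inf(2))
qed

text \<open>The finitely many generators have rational entries with a common denominator, and an
  integral scalar becomes a rational algebraic integer, hence an element of \<int>.\<close>

lemma order_denominator:
  assumes Q: "is_M2Q TYPE('b)"
  obtains m :: int where "m > 0" "\<And>x i j. x \<in> R \<Longrightarrow> of_int m * \<iota>_inf x $ i $ j \<in> \<int>"
proof -
  obtain T where T: "finite T" "R = span_over (integers_of TYPE('f)) (\<lambda>c x. eB c * x) T"
    using R(1) unfolding is_order_def by blast
  define E where "E = (\<lambda>(x, i, j). \<iota>_inf x $ i $ j) ` (T \<times> UNIV \<times> UNIV)"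
  have "E \<subseteq> \<rat>" using M2Q[OF Q] by (auto simp: E_def mat2_over_def)
  moreover have "finite E" using T(1) by (simp add: E_def)
  ultimately obtain E' where E': "finite E'" "E = of_rat ` E'"
    using finite_subset_image[of E of_rat UNIV] unfolding Rats_def by blast
  obtain m :: int where m: "m > 0" "\<forall>r\<in>E'. of_int m * r \<in> \<int>" using common_denominator[OF E'(1)] by blast
  have mE: "of_int m * e \<in> \<int>" if e: "e \<in> E" for e
  proof -
    obtain r where r: "r \<in> E'" "e = of_rat r" using e E' by blast
    obtain k where "of_int m * r = of_int k" using m r by (auto elim: Ints_cases)
    then have "of_rat (of_int m * r) = (of_int k :: real)" by simp
    then show ?thesis by (simp add: r of_rat_mult)
  qed
  have int: "v_inf c \<in> \<int>" if "c \<in> integers_of TYPE('f)" for c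
  proof -
    have c: "algebraic_int c" using that by (simp add: integers_of_def)
    obtain p :: "int poly" where p: "poly (map_poly of_int p) c = 0" "lead_coeff p = 1"
      using c unfolding algebraic_int_altdef_ipoly by blast
    have "poly (map_poly of_int p) (v_inf c) = v_inf (poly (map_poly of_int p) c)"
      by (simp add: poly_altdef ring_hom_sum[OF v_inf] ring_hom_mult[OF v_inf] ring_hom_power[OF v_inf]
          degree_map_poly coeff_map_poly ring_hom_of_int[OF v_inf])
    then have "algebraic_int (v_inf c)"
      unfolding algebraic_int_altdef_ipoly using p by (auto simp: ring_hom_zero[OF v_inf])
    then show ?thesis using rational_algebraic_int_is_int rational_central[OF Q] by blast
  qed
  show ?thesis
  proof (rule that[OF m(1)])
    fix x i j assume "x \<in> R"
    then obtain U c where U: "U \<subseteq> T" "c ` U \<subseteq> integers_of TYPE('f)" "x = (\<Sum>y\<in>U. eB (c y) * y)"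
      unfolding T(2) span_over_def by blast
    have sum: "\<iota>_inf (\<Sum>y\<in>U. f y) $ i $ j = (\<Sum>y\<in>U. \<iota>_inf (f y) $ i $ j)" for f :: "'b \<Rightarrow> 'b" and U
      using inf_add[of 0 0] by (induction U rule: infinite_finite_induct) (simp_all add: inf_add)
    have "\<iota>_inf (eB a * y) $ i $ j = v_inf a * \<iota>_inf y $ i $ j" for a y
      using mat_scale_entry[of "v_inf a" "\<iota>_inf y" i j] by (simp add: inf_mult \<iota>_inf(2) mat_scale_def)
    then have "of_int m * \<iota>_inf x $ i $ j = (\<Sum>y\<in>U. v_inf (c y) * (of_int m * \<iota>_inf y $ i $ j))"
      by (simp add: U(3) sum sum_distrib_left algebra_simps)
    also have "\<dots> \<in> \<int>"
    proof (rule Ints_sum)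
      fix y assume "y \<in> U"
      then have "\<iota>_inf y $ i $ j \<in> E" "c y \<in> integers_of TYPE('f)"
        using U(1,2) by (auto simp: E_def intro!: image_eqI[of _ _ "(y, i, j)"])
      then show "v_inf (c y) * (of_int m * \<iota>_inf y $ i $ j) \<in> \<int>" by (intro Ints_mult int mE)
    qed
    finally show "of_int m * \<iota>_inf x $ i $ j \<in> \<int>" .
  qed
qed

text \<open>A rational fixed point of a conjugate of \<open>\<gamma>\<close> would be realised by a nonzero element of \<open>B\<close>
  on which the conjugate acts by a scalar.\<close>

lemma no_rational_eigenvector:
  assumes Q: "is_M2Q TYPE('b)" and g: "g \<in> \<Gamma>" "g * h = 1"
    and ab: "a \<in> \<rat>" "b \<in> \<rat>" "a \<noteq> 0 \<or> b \<noteq> 0"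
  defines "N \<equiv> \<iota>_inf (g * \<gamma> * h)"
  assumes eigen: "N$1$1 * a + N$1$2 * b = l * a" "N$2$1 * a + N$2$2 * b = l * b"
  shows False
proof -
  have hg: "h * g = 1" by (rule \<Gamma>_right_inverse(2)[OF g])
  have "i = 1 \<or> i = 2" for i :: 2 by (rule exhaust_2)
  \<comment> \<open>Placed as a column of a rational matrix, the vector (a, b) becomes the image of
    an element of B.\<close>
  then have "mat2 a 0 b 0 \<in> mat2_over \<rat>" using ab by (auto simp: mat2_over_def forall_2)
  then obtain x where x: "\<iota>_inf x = mat2 a 0 b 0" using M2Q[OF Q] by (metis imageE)
  have x0: "x \<noteq> 0"
  proof
    assume "x = 0"
    then have "\<iota>_inf x = 0" using inf_add[of 0 0] by simp
    then show False using x ab by (auto simp: mat2_eq_iff)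
  qed
  have "\<iota>_inf (g * \<gamma> * h * x) $ m $ n = l * \<iota>_inf x $ m $ n" for m n
  proof -
    have e: "\<iota>_inf (g * \<gamma> * h * x) = N ** mat2 a 0 b 0" by (simp add: inf_mult N_def x)
    have "m = 1 \<or> m = 2" "n = 1 \<or> n = 2" by (rule exhaust_2)+
    then show ?thesis using eigen by (auto simp: e mat2_mult_entry x)
  qed
  then obtain c where c: "g * \<gamma> * h * x = eB c * x" using inf_proportional[OF x0] by blast
  have central: "eB c * y = y * eB c" for y
    using B(1) by (auto simp: is_quaternion_algebra_def is_algebra_def)
  have "\<gamma> * (h * x) = h * (g * \<gamma> * h * x)" by (simp add: mult.assoc[symmetric] hg)
  also have "\<dots> = eB c * (h * x)" unfolding c by (simp add: central mult.assoc)
  finally have "h * x = 0" by (rule \<gamma>_minus_scalar_cancel)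
  then have "g * h * x = 0" by (simp add: mult.assoc)
  then show False using x0 g(2) by simp
qed

text \<open>The form of a conjugate takes values in (1/m)\<int> at integer pairs and does not vanish
  at (a, b); dividing by s gives the bound 1 / (m s). The pair (1, 0) stands for the cusp
  \<infinity>.\<close>

lemma axis_form_cusp_bound:
  assumes Q: "is_M2Q TYPE('b)" and ab: "0 < (b::int) \<or> b = 0 \<and> (a::int) = 1"
  shows "\<exists>\<epsilon>>0. \<forall>g\<in>\<Gamma>. \<epsilon> \<le> \<bar>form_A g * (of_int a)\<^sup>2 + form_B g * (of_int a * of_int b) + form_C g * (of_int b)\<^sup>2\<bar>"
proof -
  obtain m :: int where m: "m > 0" "\<And>x i j. x \<in> R \<Longrightarrow> of_int m * \<iota>_inf x $ i $ j \<in> \<int>"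
    using order_denominator[OF Q] by blast
  show ?thesis
  proof (intro exI[of _ "1 / (of_int m * s)"] conjI ballI)
    show "0 < 1 / (of_int m * s)" using m s_pos by simp
    fix g assume g: "g \<in> \<Gamma>"
    obtain h where h: "h \<in> \<Gamma>" "g * h = 1" using \<Gamma>_inverse[OF g] by blast
    define N P where "N = \<iota>_inf (g * \<gamma> * h)" and "P = frame g"
    note e = conjugate_entries[OF g h(2), folded N_def P_def]
    define A B where "A = real_of_int a" and "B = real_of_int b"
    define V where "V = N$2$1 * A\<^sup>2 + (N$2$2 - N$1$1) * (A * B) - N$1$2 * B\<^sup>2"
    define W where "W = form_A g * A\<^sup>2 + form_B g * (A * B) + form_C g * B\<^sup>2"
    have VW: "V = s * W" unfolding V_def W_def e form_defs P_def by (simp add: algebra_simps)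
    have inR: "g * \<gamma> * h \<in> R" using g h \<psi>(3) by (intro R_mult) (auto simp: \<Gamma>_R \<gamma>_def)
    have i: "of_int m * N $ i $ j \<in> \<int>" for i j unfolding N_def by (rule m(2)[OF inR])
    have "of_int m * V = of_int m * N$2$1 * A\<^sup>2 + (of_int m * N$2$2 - of_int m * N$1$1) * (A * B) - of_int m * N$1$2 * B\<^sup>2"
      by (simp add: V_def algebra_simps)
    also have "\<dots> \<in> \<int>" unfolding A_def B_def by (intro Ints_add Ints_diff Ints_mult i Ints_power Ints_of_int)
    finally have int: "of_int m * V \<in> \<int>" .
    \<comment> \<open>A zero of the form at (a, b) means that N maps (a, b) to a multiple of
      itself.\<close>
    have V0: "V \<noteq> 0"
    proof
      assume V: "V = 0"
      have AB: "A \<in> \<rat>" "B \<in> \<rat>" by (simp_all add: A_def B_def)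
      show False
      proof (cases "b = 0")
        case True
        then have "A = 1" "B = 0" using ab by (auto simp: A_def B_def)
        then show False
          using no_rational_eigenvector[OF Q g h(2) AB, of "N$1$1"] V by (simp add: V_def N_def)
      next
        case False
        then have B: "B \<noteq> 0" by (simp add: B_def)
        define l where "l = (N$2$1 * A + N$2$2 * B) / B"
        have lB: "N$2$1 * A + N$2$2 * B = l * B" using B by (simp add: l_def)
        have "B * (l * A) = (l * B) * A" by simp
        also have "\<dots> = B * (N$1$1 * A + N$1$2 * B) + V"
          unfolding lB[symmetric] V_def by (simp add: power2_eq_square algebra_simps)
        finally have "N$1$1 * A + N$1$2 * B = l * A" using V B by simp
        then show False using no_rational_eigenvector[OF Q g h(2) AB, of l] lB B by (simp add: N_def)
      qed
    qed
    obtain k where k: "of_int m * V = of_int k" using int by (auto elim: Ints_cases)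
    have "of_int m * V \<noteq> 0" using V0 m(1) by simp
    then have "k \<noteq> 0" using k by auto
    then have "1 \<le> \<bar>real_of_int k\<bar>" by linarith
    then have "1 \<le> of_int m * s * \<bar>W\<bar>" unfolding k[symmetric] VW using m s_pos by (simp add: abs_mult)
    then have "1 / (of_int m * s) \<le> \<bar>W\<bar>" using m s_pos by (simp add: field_simps)
    then show "1 / (of_int m * s) \<le> \<bar>form_A g * (of_int a)\<^sup>2 + form_B g * (of_int a * of_int b) + form_C g * (of_int b)\<^sup>2\<bar>"
      by (simp only: W_def A_def B_def)
  qed
qed

lemma finite_separating_infinity:
  assumes Q: "is_M2Q TYPE('b)"
  shows "finite (separating base Infty)"
proof -
  obtain \<epsilon> where \<epsilon>: "\<epsilon> > 0" "\<And>g. g \<in> \<Gamma> \<Longrightarrow> \<epsilon> \<le> \<bar>form_A g\<bar>"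
    using axis_form_cusp_bound[OF Q, of 0 1] by auto
  obtain K where K: "\<And>A B C. B\<^sup>2 - 4 * A * C = 1 \<Longrightarrow>
    (A * (0\<^sup>2 + 1) + B * 0 + C > 0) \<noteq> (A * 0\<^sup>2 + B * 0 + C > 0) \<Longrightarrow> \<epsilon> \<le> \<bar>A * 0\<^sup>2 + B * 0 + C\<bar> \<Longrightarrow>
    \<bar>A\<bar> \<le> K \<and> \<bar>B\<bar> \<le> K \<and> \<bar>C\<bar> \<le> (K::real)"
    using binary_form_bound_cusp[OF \<epsilon>(1), of 0] by blast
  show ?thesis
  proof (rule finite_separating_of_bound[of _ _ K])
    fix g assume g: "g \<in> \<Gamma>" and sep: "(axis_form (frame g) base > 0) \<noteq> (axis_form (frame g) Infty > 0)"
    \<comment> \<open>With the outer coefficients exchanged, the cusp \<infinity> is treated as the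
      cusp 0.\<close>
    have "\<bar>form_C g\<bar> \<le> K \<and> \<bar>form_B g\<bar> \<le> K \<and> \<bar>form_A g\<bar> \<le> K"
      by (rule K) (use form_disc[OF g] sep[unfolded axis_form_base axis_form_infinity] \<epsilon>(2)[OF g] in
        \<open>simp_all add: mult.commute mult.left_commute add.commute\<close>)
    then show "bounded_form K g" by (simp add: bounded_form_def)
  qed
qed

lemma finite_separating_cusp:
  assumes Q: "is_M2Q TYPE('b)" and z: "z \<in> \<rat>"
  shows "finite (separating base (Pt z))"
proof -
  obtain a b :: int where ab: "b > 0" "z = of_int a / of_int b" using z by (rule Rats_cases')
  define r where "r = real_of_int a / of_int b"
  have z': "z = Complex r 0" using ab by (simp add: r_def complex_eq_iff Re_divide Im_divide power2_eq_square)
  obtain \<epsilon> where \<epsilon>: "\<epsilon> > 0" "\<And>g. g \<in> \<Gamma> \<Longrightarrow> \<epsilon> \<le> \<bar>form_A g * (of_int a)\<^sup>2 + form_B g * (of_int a * of_int b) + form_C g * (of_int b)\<^sup>2\<bar>"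
    using axis_form_cusp_bound[OF Q, of b a] ab(1) by auto
  \<comment> \<open>Dehomogenised: the form at (a, b) is b^2 times its value at r = a / b.\<close>
  define \<delta> where "\<delta> = \<epsilon> / (of_int b)\<^sup>2"
  have \<delta>: "\<delta> > 0" using \<epsilon> ab by (simp add: \<delta>_def)
  obtain K where K: "\<And>A B C. B\<^sup>2 - 4 * A * C = 1 \<Longrightarrow>
    (A * (r\<^sup>2 + 1) + B * r + C > 0) \<noteq> (A * r\<^sup>2 + B * r + C > 0) \<Longrightarrow> \<delta> \<le> \<bar>A * r\<^sup>2 + B * r + C\<bar> \<Longrightarrow>
    \<bar>A\<bar> \<le> K \<and> \<bar>B\<bar> \<le> K \<and> \<bar>C\<bar> \<le> (K::real)"
    using binary_form_bound_cusp[OF \<delta>, of r] by blast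
  \<comment> \<open>The cusp estimate compares r with r + i; the passage from r + i to i is the
    interior case.\<close>
  have "finite (separating (Pt (Complex r 1)) (Pt z))"
  proof (rule finite_separating_of_bound[of _ _ K])
    fix g assume g: "g \<in> \<Gamma>"
      and sep: "(axis_form (frame g) (Pt (Complex r 1)) > 0) \<noteq> (axis_form (frame g) (Pt z) > 0)"
    show "bounded_form K g" unfolding bounded_form_def
    proof (rule K[OF form_disc[OF g]])
      show "(form_A g * (r\<^sup>2 + 1) + form_B g * r + form_C g > 0) \<noteq> (form_A g * r\<^sup>2 + form_B g * r + form_C g > 0)"
        using sep unfolding z' axis_form_point by (simp only: one_power2 zero_power2 add_0_right) simp
      have "form_A g * (of_int a)\<^sup>2 + form_B g * (of_int a * of_int b) + form_C g * (of_int b)\<^sup>2 =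
          (of_int b)\<^sup>2 * (form_A g * r\<^sup>2 + form_B g * r + form_C g)"
        using ab(1) by (simp add: r_def power2_eq_square field_simps)
      then have "\<epsilon> \<le> (of_int b)\<^sup>2 * \<bar>form_A g * r\<^sup>2 + form_B g * r + form_C g\<bar>"
        using \<epsilon>(2)[OF g] by (simp add: abs_mult)
      then show "\<delta> \<le> \<bar>form_A g * r\<^sup>2 + form_B g * r + form_C g\<bar>"
        using ab(1) by (simp add: \<delta>_def pos_divide_le_eq mult.commute)
    qed
  qed
  moreover have "finite (separating base (Pt (Complex r 1)))" by (rule finite_separating_interior) simp
  ultimately show ?thesis by (rule finite_separating_trans[rotated])
qed

lemma finite_separating:
  assumes "x \<in> \<H>" "y \<in> \<H>"
  shows "finite (separating x y)"
proof -
  have "finite (separating base x)" if x: "x \<in> \<H>" for x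
  proof (cases "x \<in> upper_half_plane")
    case True
    then show ?thesis by (auto simp: upper_half_plane_def intro: finite_separating_interior)
  next
    case False
    then have "is_M2Q TYPE('b)" "x \<in> Pt ` \<rat> \<union> {Infty}"
      using x by (auto simp: \<H>_def extended_half_plane_def split: if_splits)
    then show ?thesis by (auto intro: finite_separating_cusp finite_separating_infinity)
  qed
  from this[OF assms(1)] this[OF assms(2)] show ?thesis
    using finite_separating_trans[of x base y] separating_sym[of x base] by simp
qed

section \<open>The cocycle as a difference of sides\<close>

definition crossing :: "complex proj_line \<Rightarrow> complex proj_line \<Rightarrow> 'c proj_line \<Rightarrow>\<^sub>0 int" where
  "crossing a b = (\<Sum>w\<in>separating a b.
     frag_cmul (of_bool (right w b) - of_bool (right w a)) (frag_of (p_pt w)))"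

text \<open>Outside \<open>separating\<close> the coefficient is 0, so divisors with different
  supports can be summed over one common finite set.\<close>

lemma crossing_superset:
  assumes "finite S" "separating a b \<subseteq> S" "S \<subseteq> orbit"
  shows "crossing a b = (\<Sum>w\<in>S. frag_cmul (of_bool (right w b) - of_bool (right w a)) (frag_of (p_pt w)))"
  unfolding crossing_def
  by (rule sum.mono_neutral_left) (use assms in \<open>auto simp: separating_def\<close>)

lemma crossing_add:
  assumes "a \<in> \<H>" "b \<in> \<H>" "c \<in> \<H>"
  shows "crossing a b + crossing b c = crossing a c"
proof -
  define S where "S = separating a b \<union> separating b c \<union> separating a c"
  have S: "finite S" unfolding S_def using assms by (simp add: finite_separating)
  have S': "S \<subseteq> orbit" by (auto simp: S_def separating_def)
  have sub: "separating a b \<subseteq> S" "separating b c \<subseteq> S" "separating a c \<subseteq> S" by (auto simp: S_def)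
  note cr = crossing_superset[OF S sub(1) S'] crossing_superset[OF S sub(2) S'] crossing_superset[OF S sub(3) S']
  have "crossing a b + crossing b c = (\<Sum>w\<in>S. frag_cmul (of_bool (right w b) - of_bool (right w a)) (frag_of (p_pt w))
     + frag_cmul (of_bool (right w c) - of_bool (right w b)) (frag_of (p_pt w)))"
    unfolding cr sum.distrib ..
  also have "\<dots> = (\<Sum>w\<in>S. frag_cmul (of_bool (right w c) - of_bool (right w a)) (frag_of (p_pt w)))"
    unfolding frag_cmul_distrib[symmetric] by simp
  also have "\<dots> = crossing a c" unfolding cr ..
  finally show ?thesis .
qed

lemma crossing_self: "crossing a a = 0"
  by (simp add: crossing_def separating_def)

lemma crossing_swap: "a \<in> \<H> \<Longrightarrow> b \<in> \<H> \<Longrightarrow> crossing b a = - crossing a b"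
  using crossing_add[of a b a] by (simp add: crossing_self eq_neg_iff_add_eq_0 add.commute)

lemma p_pt_translate: assumes "g \<in> \<Gamma>" "w \<in> orbit" shows "p_pt (act g w) = act_p g (p_pt w)"
proof -
  obtain h where h: "h \<in> \<Gamma>" "w = act h \<tau>" using assms(2) by (rule orbitE)
  have "p_pt (act (g * h) \<tau>) = act_p (g * h) (Pt \<tau>_p)" by (rule p_pt_act[OF \<Gamma>_mult[OF assms(1) h(1)]])
  then show ?thesis by (simp only: h(2) act_mult[OF h(1)] act_p_mult[OF h(1)] p_pt_act[OF h(1)])
qed

lemma crossing_translate:
  assumes g: "g \<in> \<Gamma>"
  shows "crossing (act g a) (act g b) = div_action \<iota>_p g (crossing a b)"
proof -
  obtain h where h: "h \<in> \<Gamma>" "h * g = 1" "g * h = 1" using g by (rule \<Gamma>_inverse)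
  have inj: "inj_on (act g) (separating a b)"
    by (rule inj_on_inverseI[of _ "act h"]) (simp add: act_inverse g h)
  have img: "separating (act g a) (act g b) = act g ` separating a b"
  proof (intro equalityI subsetI)
    fix w assume w: "w \<in> separating (act g a) (act g b)"
    define w0 where "w0 = act h w"
    have w0: "w0 \<in> orbit" "w = act g w0" using w h by (auto simp: w0_def separating_def act_orbit act_inverse)
    then have "w0 \<in> separating a b" using w right_translate[OF g w0(1)] by (simp add: separating_def)
    then show "w \<in> act g ` separating a b" using w0 by blast
  next
    fix w assume "w \<in> act g ` separating a b"
    then obtain w0 where "w0 \<in> separating a b" "w = act g w0" by blast
    then show "w \<in> separating (act g a) (act g b)"
      using right_translate[OF g, of w0] act_orbit[OF g, of w0] by (simp add: separating_def)
  qed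
  have "crossing (act g a) (act g b) = (\<Sum>w\<in>separating a b.
     frag_cmul (of_bool (right (act g w) (act g b)) - of_bool (right (act g w) (act g a))) (frag_of (p_pt (act g w))))"
    unfolding crossing_def img by (subst sum.reindex[OF inj]) (simp add: comp_def)
  also have "\<dots> = (\<Sum>w\<in>separating a b.
     frag_cmul (of_bool (right w b) - of_bool (right w a)) (frag_of (act_p g (p_pt w))))"
    by (rule sum.cong) (auto simp: separating_def right_translate g p_pt_translate)
  also have "\<dots> = div_action \<iota>_p g (crossing a b)"
  \<comment> \<open>For an infinite index set both sums take the default value 0, so the identity
    holds for all a and b.\<close>
  proof (cases "finite (separating a b)")
    case True
    then show ?thesis
      by (simp add: crossing_def div_action_def act_p_def frag_extend_sum frag_extend_cmul)
  qed (simp add: crossing_def div_action_def)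
  finally show ?thesis .
qed

lemma crossing_A0: "Poly_Mapping.keys (crossing a b) \<subseteq> A0"
proof -
  have "p_pt w \<in> A0" if w: "w \<in> orbit" for w
  proof -
    obtain g where "g \<in> \<Gamma>" "w = act g \<tau>" using w by (rule orbitE)
    then show ?thesis using act_p_A0[of g "Pt \<tau>_p"] \<tau>_p(2) by (simp add: p_pt_act A0_def)
  qed
  then show ?thesis unfolding crossing_def
    by (intro order.trans[OF keys_sum] UN_least order.trans[OF keys_cmul]) (auto simp: separating_def)
qed

lemma delta_support_eq: "x \<in> \<H> \<Longrightarrow> g \<in> \<Gamma> \<Longrightarrow> delta_support \<Gamma> \<iota>_inf \<gamma> x g = separating x (act g x)"
  unfolding delta_support_def separating_def orbit_def[symmetric] by (auto simp: delta_eq)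

lemma phi_eq:
  assumes "x \<in> \<H>"
  shows "phi \<Gamma> \<iota>_inf \<iota>_p \<gamma> \<tau>_p x = (\<lambda>g\<in>\<Gamma>. crossing x (act g x))"
proof (rule ext)
  fix g
  show "phi \<Gamma> \<iota>_inf \<iota>_p \<gamma> \<tau>_p x g = (\<lambda>g\<in>\<Gamma>. crossing x (act g x)) g"
  proof (cases "g \<in> \<Gamma>")
    case True
    have "(\<Sum>w\<in>separating x (act g x). frag_cmul (delta \<Gamma> \<iota>_inf \<gamma> x g w) (frag_of (p_pt w))) = crossing x (act g x)"
      unfolding crossing_def by (rule sum.cong) (auto simp: separating_def delta_eq assms True)
    then show ?thesis using True assms by (simp add: phi_def delta_support_eq p_pt_def)
  qed (simp add: phi_def)
qed

section \<open>The cocycle and its class\<close>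

abbreviation "G \<equiv> mult_group_on \<Gamma>"
abbreviation "V \<equiv> free_Abelian_group A0"
abbreviation "g_act \<equiv> div_action \<iota>_p"
abbreviation "\<phi> \<equiv> phi \<Gamma> \<iota>_inf \<iota>_p \<gamma> \<tau>_p"
abbreviation "cohomology_class x \<equiv> H1_class G V g_act (\<phi> x)"

lemma div_action_add: "g_act g (x + y) = g_act g x + g_act g y"
  by (simp add: div_action_def frag_extend_add)

lemma phi_cocycle:
  assumes x: "x \<in> \<H>"
  shows "\<phi> x \<in> carrier (Z1 G V g_act)"
proof -
  have "crossing x (act (g * h) x) = crossing x (act g x) + g_act g (crossing x (act h x))"
    if gh: "g \<in> \<Gamma>" "h \<in> \<Gamma>" for g h
    using crossing_add[of x "act g x" "act g (act h x)"] crossing_translate[OF gh(1), of x "act h x"]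
    by (simp add: x act_H gh act_mult)
  then show ?thesis
    unfolding phi_eq[OF x] Z1_def by (auto simp: mult_group_on_def crossing_A0 \<Gamma>_mult)
qed

lemma H1_class_phi:
  assumes x: "x \<in> \<H>"
  shows "cohomology_class x =
    {\<lambda>g\<in>\<Gamma>. (g_act g d + - d) + crossing x (act g x) | d. Poly_Mapping.keys d \<subseteq> A0}"
proof -
  \<comment> \<open>The inverse in \<open>free_Abelian_group A0\<close> is negation on the carrier,
    so the rewriting carries the membership of d along.\<close>
  have inv: "(b = (\<lambda>g\<in>\<Gamma>. g_act g d + inv\<^bsub>V\<^esub> d) \<and> Poly_Mapping.keys d \<subseteq> A0) \<longleftrightarrow>
     (b = (\<lambda>g\<in>\<Gamma>. g_act g d + - d) \<and> Poly_Mapping.keys d \<subseteq> A0)" for b d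
    by (cases "Poly_Mapping.keys d \<subseteq> A0") simp_all
  have B1: "B1 G V g_act = {\<lambda>g\<in>\<Gamma>. g_act g d + - d | d. Poly_Mapping.keys d \<subseteq> A0}"
    unfolding B1_def carrier_free_Abelian_group_iff mult_free_Abelian_group mult_group_on_def
    by (simp only: partial_object.simps inv)
  have m: "(\<lambda>g\<in>\<Gamma>. (\<lambda>g\<in>\<Gamma>. g_act g d + - d) g + (\<lambda>g\<in>\<Gamma>. crossing x (act g x)) g) =
    (\<lambda>g\<in>\<Gamma>. (g_act g d + - d) + crossing x (act g x))" for d
    by (rule restrict_ext) simp
  have carrier: "carrier G = \<Gamma>" by (simp add: mult_group_on_def)
  have "cohomology_class x =
     (\<Union>b\<in>B1 G V g_act. {\<lambda>g\<in>\<Gamma>. b g + (\<lambda>g\<in>\<Gamma>. crossing x (act g x)) g})"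
    unfolding H1_class_def r_coset_def Z1_def phi_eq[OF x] carrier monoid.simps mult_free_Abelian_group ..
  also have "\<dots> = (\<Union>d\<in>{d. Poly_Mapping.keys d \<subseteq> A0}.
     {\<lambda>g\<in>\<Gamma>. (\<lambda>g\<in>\<Gamma>. g_act g d + - d) g + (\<lambda>g\<in>\<Gamma>. crossing x (act g x)) g})"
    unfolding B1 by blast
  also have "\<dots> = {\<lambda>g\<in>\<Gamma>. (g_act g d + - d) + crossing x (act g x) | d. Poly_Mapping.keys d \<subseteq> A0}"
    unfolding m by blast
  finally show ?thesis .
qed

text \<open>The outer legs of the path x, y, g y, g x form a coboundary, absorbed by replacing d
  with d + \<open>crossing y x\<close>. One inclusion is enough, as x and y are
  interchangeable.\<close>

lemma H1_class_subset:
  assumes x: "x \<in> \<H>" and y: "y \<in> \<H>"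
  shows "cohomology_class x \<subseteq> cohomology_class y"
proof
  fix f assume "f \<in> cohomology_class x"
  then obtain d where d: "Poly_Mapping.keys d \<subseteq> A0"
    "f = (\<lambda>g\<in>\<Gamma>. (g_act g d + - d) + crossing x (act g x))"
    unfolding H1_class_phi[OF x] by blast
  define d' where "d' = d + crossing y x"
  have keys: "Poly_Mapping.keys d' \<subseteq> A0"
    using d(1) crossing_A0[of y x] keys_add[of d "crossing y x"] unfolding d'_def by blast
  have "(g_act g d + - d) + crossing x (act g x) = (g_act g d' + - d') + crossing y (act g y)"
    if g: "g \<in> \<Gamma>" for g
  proof -
    have "crossing x (act g x) = crossing x y + crossing y (act g y) + crossing (act g y) (act g x)"
      by (simp add: crossing_add x y act_H g)
    also have "crossing (act g y) (act g x) = g_act g (crossing y x)"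
      by (rule crossing_translate[OF g])
    also have "crossing x y = - crossing y x" by (rule crossing_swap[OF y x])
    finally show ?thesis by (simp add: d'_def div_action_add)
  qed
  then have "f = (\<lambda>g\<in>\<Gamma>. (g_act g d' + - d') + crossing y (act g y))"
    unfolding d(2) by (intro restrict_ext) simp
  then show "f \<in> cohomology_class y"
    unfolding H1_class_phi[OF y] using keys by blast
qed

theorem cocycle_and_class:
  "(\<forall>x\<in>\<H>. (\<forall>g\<in>\<Gamma>. finite (delta_support \<Gamma> \<iota>_inf \<gamma> x g)) \<and>
      \<phi> x \<in> carrier (Z1 G V g_act)) \<and>
   (\<exists>c\<in>carrier (H1 G V g_act). \<forall>x\<in>\<H>. cohomology_class x = c)"
proof (intro conjI ballI)
  fix x assume x: "x \<in> \<H>"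
  show "finite (delta_support \<Gamma> \<iota>_inf \<gamma> x g)" if "g \<in> \<Gamma>" for g
    using x that by (simp add: delta_support_eq finite_separating act_H)
  show "\<phi> x \<in> carrier (Z1 G V g_act)" by (rule phi_cocycle[OF x])
next
  \<comment> \<open>The point i lies in the extended half-plane for every B, so its class can serve
    as the common value.\<close>
  have base: "base \<in> \<H>" by (auto simp: \<H>_def extended_half_plane_def upper_half_plane_def)
  show "\<exists>c\<in>carrier (H1 G V g_act). \<forall>x\<in>\<H>. cohomology_class x = c"
  proof (rule bexI[of _ "cohomology_class base"], rule ballI)
    show "cohomology_class base \<in> carrier (H1 G V g_act)"
      using phi_cocycle[OF base] by (auto simp: H1_def H1_class_def FactGroup_def RCOSETS_def)
  qed (use H1_class_subset base in blast)
qed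

end

section \<open>Specialisation to the given fields and splittings\<close>

theorem proposition4p4:
  fixes eB :: "'f::field_char_0 \<Rightarrow> 'b::ring_1"
    and eK :: "'f \<Rightarrow> 'k::field_char_0"
    and v_inf :: "'f \<Rightarrow> real"
    and \<pp> :: "'f set"
    and p :: nat
    and absp :: "'c::field_char_0 \<Rightarrow> real"
    and jp :: "'k \<Rightarrow> 'c"
    and \<iota>_p :: "'b \<Rightarrow> 'c^2^2"
    and \<iota>_inf :: "'b \<Rightarrow> real^2^2"
    and R :: "'b set"
    and \<O> :: "'k set"
    and \<psi> :: "'k \<Rightarrow> 'b"
    and u :: 'k
    and \<tau>_p :: 'c
  defines "\<Gamma> \<equiv> norm_one_units eB R"
    and "Zp \<equiv> completion_integers_in absp (jp \<circ> eK)"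
    and "\<gamma>_\<psi> \<equiv> \<psi> u"
  defines "G \<equiv> mult_group_on \<Gamma>"
    and "A0 \<equiv> standard_affinoid absp Zp"
  defines "DivA0 \<equiv> free_Abelian_group A0"
  assumes F: "is_number_field TYPE('f)" "is_totally_real TYPE('f)"
      "narrow_class_number TYPE('f) = 1"
    and B: "is_quaternion_algebra eB"
      "{\<sigma>. is_ring_hom \<sigma> \<and> is_split_real eB \<sigma>} = {v_inf}"
    and prime: "primeideal \<pp> (ring_on (integers_of TYPE('f)))" "\<pp> \<noteq> {0}" "of_nat p \<in> \<pp>"
    and Cp: "is_Cp p absp"
    and K: "is_quadratic_ext eK" "is_inert eK \<pp>" "inf_place_splits eK v_inf"
      "\<forall>\<sigma>. is_ring_hom \<sigma> \<and> \<sigma> \<noteq> v_inf \<longrightarrow> inf_place_ramifies eK \<sigma>"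
    and jp: "is_ring_hom jp" "induces_prime absp (jp \<circ> eK) \<pp>"
    and splittings: "is_splitting eB (completion_in absp (jp \<circ> eK)) (jp \<circ> eK) \<iota>_p"
      "is_splitting eB UNIV v_inf \<iota>_inf"
      "is_M2Q TYPE('b) \<Longrightarrow> range \<iota>_inf = mat2_over \<rat>"
    and R: "is_maximal_order eB R" "span_over Zp mat_scale (\<iota>_p ` R) = mat2_over Zp"
    and \<O>: "is_order eK \<O>"
    and \<psi>: "\<psi> \<in> optimal_embeddings eK eB \<O> R"
    and u: "generates_free_part u (norm_one_units_field eK \<O>)"
    and c_nonzero: "\<iota>_inf \<gamma>_\<psi> $ 2 $ 1 \<noteq> 0"
    and \<tau>_p: "\<forall>a. \<iota>_p (\<psi> a) *v vector [\<tau>_p, 1] = jp a *s vector [\<tau>_p, 1]" "Pt \<tau>_p \<in> A0"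
  shows "(\<forall>x\<in>extended_half_plane TYPE('b).
            (\<forall>g\<in>\<Gamma>. finite (delta_support \<Gamma> \<iota>_inf \<gamma>_\<psi> x g)) \<and>
            phi \<Gamma> \<iota>_inf \<iota>_p \<gamma>_\<psi> \<tau>_p x \<in> carrier (Z1 G DivA0 (div_action \<iota>_p))) \<and>
         (\<exists>c\<in>carrier (H1 G DivA0 (div_action \<iota>_p)). \<forall>x\<in>extended_half_plane TYPE('b).
            H1_class G DivA0 (div_action \<iota>_p) (phi \<Gamma> \<iota>_inf \<iota>_p \<gamma>_\<psi> \<tau>_p x) = c)"
proof -
  have na: "is_nonarch_abs absp" using Cp by (simp add: is_Cp_def)
  have eK: "is_ring_hom eK" using K(1) by (simp add: is_quadratic_ext_def)
  interpret nonarch_embedding absp "jp \<circ> eK"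
    using na jp(1) eK by unfold_locales (auto simp: is_ring_hom_def)
  have place: "\<exists>\<rho> :: 'k \<Rightarrow> real. is_ring_hom \<rho> \<and> \<rho> \<circ> eK = v_inf"
  proof -
    have "{\<rho> :: 'k \<Rightarrow> real. is_ring_hom \<rho> \<and> \<rho> \<circ> eK = v_inf} \<noteq> {}"
      using K(3) unfolding inf_place_splits_def by (metis card.empty zero_neq_numeral)
    then show ?thesis by blast
  qed
  \<comment> \<open>Each image is one of the spanning matrices, taken with coefficient 1.\<close>
  have integral: "\<iota>_p x \<in> mat2_over Zp" if "x \<in> R" for x
  proof -
    have "\<iota>_p x \<in> span_over Zp mat_scale (\<iota>_p ` R)"
      by (rule span_over_base) (use that in \<open>simp_all add: Zp_def Z_one mat2_eq_iff\<close>)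
    then show ?thesis using R(2) by simp
  qed
  have uO: "u \<in> \<O>"
    using u by (simp add: generates_free_part_def norm_one_units_field_def Units_def ring_on_def)
  interpret C: embedding_cocycle eB eK v_inf absp jp \<iota>_p \<iota>_inf R \<psi> u \<tau>_p
  proof
    show "is_order eB R" using R(1) by (simp add: is_maximal_order_def)
    show "\<iota>_p x \<in> mat2_over Z" if "x \<in> R" for x
      using integral[OF that] by (simp add: Zp_def)
    show "is_ring_hom \<psi>" "\<psi> u \<in> R" using \<psi> uO by (auto simp: optimal_embeddings_def)
    show "\<psi> (eK c) = eB c" for c using \<psi> by (auto simp: optimal_embeddings_def)
    show "\<iota>_inf (\<psi> u) $ 2 $ 1 \<noteq> 0" using c_nonzero by (simp add: \<gamma>_\<psi>_def)
    show "Pt \<tau>_p \<in> standard_affinoid absp Z" using \<tau>_p(2) by (simp add: A0_def Zp_def)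
  qed (use F B na eK place jp(1) splittings \<tau>_p(1) in \<open>auto simp: is_splitting_def\<close>)
  have "C.\<Gamma> = \<Gamma>" "C.\<gamma> = \<gamma>_\<psi>" "C.A0 = A0"
    by (simp_all add: C.\<Gamma>_def \<Gamma>_def C.\<gamma>_def \<gamma>_\<psi>_def C.A0_def A0_def Zp_def)
  then show ?thesis using C.cocycle_and_class unfolding C.\<H>_def G_def DivA0_def by simp
qed

end
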